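(* Let $\mathcal G$ be a groupoid and $V$ a Banach $\mathcal G$-module. Let $((D^n,\delta_D^n)_{n\in\mathbb N},\ \varepsilon\colon V\to D^0)$ be a strong relatively injective $\mathcal G$-resolution of $V$. Then there exists a canonical semi-norm non-increasing isomorphism of graded $\mathbb R$-modules $$H^\ast(D^{\ast\,\mathcal G})\longrightarrow H_b^\ast(\mathcal G;V),$$ where $D^{\ast\,\mathcal G}$ is the cochain complex of $\mathcal G$-invariants of $D^\ast$.
   Context: **Groupoids and modules.** A groupoid $\mathcal G$ is a small category in which all morphisms are invertible; $g\in\mathcal G$ means that $g$ is a morphism, with source $s(g)$ and target $t(g)$; $gh=g\circ h$ is defined if $s(g)=t(h)$. A normed $\mathcal G$-module $V=(V_e)_{e\in\mathrm{ob}\,\mathcal G}$ is a family of normed real vector spaces with linear isometries $V_{s(g)}\to V_{t(g)}$, $v\mapsto g\cdot v$ ($g\in\mathcal G$), satisfying $g\cdot(h\cdot v)=(gh)\cdot v$ and $\mathrm{id}_e\cdot v=v$; it is a Banach $\mathcal G$-module if each $V_e$ is complete. An $\mathbb R$-morphism $f\colon V\to W$ is a family of bounded linear maps $f_e\colon V_e\to W_e$ with $\|f\|_\infty=\sup_e\|f_e\|<\infty$; it is a $\mathcal G$-map if it is equivariant, i.e. $g\cdot f_{s(g)}(v)=f_{t(g)}(g\cdot v)$. $B(V,W)=(B(V_e,W_e))_e$ (bounded linear maps, operator norm) with action $(g\cdot f)(v)=g\cdot f(g^{-1}\cdot v)$. The invariants are $V^{\mathcal G}=\{v\in\prod_e V_e\mid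 g\cdot v_{s(g)}=v_{t(g)}\ \forall g,\ \sup_e\|v_e\|<\infty\}$ with the sup-norm, and $B_{\mathcal G}(V,W)=B(V,W)^{\mathcal G}$. **Bounded cohomology of groupoids.** $C_n(\mathcal G)_e$ is the real vector space with basis $P_n(\mathcal G)_e=\{(g_0,\dots,g_n)\in\mathcal G^{n+1}\mid s(g_i)=t(g_{i+1})\ (0\le i<n),\ t(g_0)=e\}$, with the $\ell^1$-norm, action $g\cdot(g_0,\dots,g_n)=(gg_0,g_1,\dots,g_n)$ and boundary $\partial_n(g_0,\dots,g_n)=\sum_{i=0}^{n-1}(-1)^i(g_0,\dots,g_ig_{i+1},\dots,g_n)+(-1)^n(g_0,\dots,g_{n-1})$. $H_b^\ast(\mathcal G;V)$ is the cohomology of $B_{\mathcal G}(C_\ast(\mathcal G),V)$ with the semi-norm induced by the norm (infimum over representing cocycles); $H^\ast(D^{\ast\,\mathcal G})$ is semi-normed in the same way. **Resolutions.** A $\mathcal G$-map $i\colon U\to W$ between Banach $\mathcal G$-modules is relatively injective if there is a (not necessarily equivariant) $\mathbb R$-morphism $\sigma\colon W\to U$ with $\sigma\circ i=\mathrm{id}_U$ and $\|\sigma\|_\infty\le 1$. A $\mathcal G$-module $I$ is relatively injective if for each relatively injective $\mathcal G$-map $i\colon U\to W$ between Banach $\mathcal G$-modules and each $\mathcal G$-map $\alpha\colon U\to I$ there is a $\mathcal G$-map $\beta\colon W\to I$ with $\beta\circ i=\alpha$ and $\|\beta\|_\infty\le\|\alpha\|_\infty$. A Banach $\mathcal G$-cochain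 complex $(D^n,\delta^n)_{n\in\mathbb N}$ consists of Banach $\mathcal G$-modules and $\mathcal G$-maps $\delta^n\colon D^n\to D^{n+1}$; it is relatively injective if all $D^n$ are. An augmentation is a $\mathcal G$-map $\varepsilon\colon V\to D^0$ with $\delta^0\circ\varepsilon=0$. The augmented complex is a strong resolution of $V$ if there are (not necessarily equivariant) $\mathbb R$-morphisms $s^n\colon D^n\to D^{n-1}$ ($n>0$), $s^0\colon D^0\to V$, all of norm $\le1$, with $s^0\varepsilon=\mathrm{id}_V$, $s^1\delta^0+\varepsilon s^0=\mathrm{id}$, and $s^{n+1}\delta^n+\delta^{n-1}s^n=\mathrm{id}$ for $n\ge1$. "Canonical" means: the isomorphism is induced by a bounded $\mathcal G$-cochain map $D^\ast\to B(C_\ast(\mathcal G),V)$ extending $\mathrm{id}_V$, where $B(C_\ast(\mathcal G),V)$ is augmented by $V\to B(C_0(\mathcal G),V)$, $v\mapsto(g\mapsto v)$. *)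

theory Defs
  imports "HOL-Analysis.Analysis" "HOL-Analysis.Finite_Function_Topology"
    "HOL-Library.Function_Algebras"
begin

instantiation "fun" :: (type, real_vector) real_vector
begin

definition "c *\<^sub>R f = (\<lambda>x. c *\<^sub>R f x)"

instance
  by standard (simp_all add: scaleR_fun_def fun_eq_iff scaleR_add_right scaleR_add_left)

end

section \<open>Groupoids\<close>

text \<open>\<open>comp G g h\<close> is \<open>g \<circ> h\<close>; it is meaningful only if \<open>src G g = tgt G h\<close>.\<close>

record ('o, 'g) groupoid_data =
  Ob :: "'o set"
  Mor :: "'g set"
  src :: "'g \<Rightarrow> 'o"
  tgt :: "'g \<Rightarrow> 'o"
  comp :: "'g \<Rightarrow> 'g \<Rightarrow> 'g"
  ident :: "'o \<Rightarrow> 'g"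

definition is_inverse :: "('o, 'g) groupoid_data \<Rightarrow> 'g \<Rightarrow> 'g \<Rightarrow> bool" where
  "is_inverse G g h \<longleftrightarrow> h \<in> Mor G \<and> src G h = tgt G g \<and> tgt G h = src G g \<and>
     comp G g h = ident G (tgt G g) \<and> comp G h g = ident G (src G g)"

definition groupoid :: "('o, 'g) groupoid_data \<Rightarrow> bool" where
  "groupoid G \<longleftrightarrow>
     (\<forall>g\<in>Mor G. src G g \<in> Ob G \<and> tgt G g \<in> Ob G) \<and>
     (\<forall>g\<in>Mor G. \<forall>h\<in>Mor G. src G g = tgt G h \<longrightarrow>
        comp G g h \<in> Mor G \<and> src G (comp G g h) = src G h \<and> tgt G (comp G g h) = tgt G g) \<and>
     (\<forall>g\<in>Mor G. \<forall>h\<in>Mor G. \<forall>k\<in>Mor G. src G g = tgt G h \<longrightarrow> src G h = tgt G k \<longrightarrow>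
        comp G (comp G g h) k = comp G g (comp G h k)) \<and>
     (\<forall>e\<in>Ob G. ident G e \<in> Mor G \<and> src G (ident G e) = e \<and> tgt G (ident G e) = e) \<and>
     (\<forall>g\<in>Mor G. comp G (ident G (tgt G g)) g = g \<and> comp G g (ident G (src G g)) = g) \<and>
     (\<forall>g\<in>Mor G. \<exists>h. is_inverse G g h)"

definition ginv :: "('o, 'g) groupoid_data \<Rightarrow> 'g \<Rightarrow> 'g" where
  "ginv G g = (THE h. is_inverse G g h)"

section \<open>Normed modules over a groupoid\<close>

text \<open>
  The members \<open>V\<^sub>e\<close> of a family of normed spaces are subspaces of one ambient real vector
  space, each with its own norm. Any family has this form: take the direct sum as
  ambient space. Values of \<open>nrm\<close> and \<open>act\<close> outside the carriers are irrelevant.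
\<close>

record ('o, 'g, 'v) gmodule =
  car :: "'o \<Rightarrow> 'v set"
  nrm :: "'o \<Rightarrow> 'v \<Rightarrow> real"
  act :: "'g \<Rightarrow> 'v \<Rightarrow> 'v"

definition lin_on :: "'v::real_vector set \<Rightarrow> ('v \<Rightarrow> 'w::real_vector) \<Rightarrow> bool" where
  "lin_on S f \<longleftrightarrow>
     (\<forall>x\<in>S. \<forall>y\<in>S. f (x + y) = f x + f y) \<and> (\<forall>c. \<forall>x\<in>S. f (c *\<^sub>R x) = c *\<^sub>R f x)"

definition normed_space_on :: "'v::real_vector set \<Rightarrow> ('v \<Rightarrow> real) \<Rightarrow> bool" where
  "normed_space_on S N \<longleftrightarrow> subspace S \<and>
     (\<forall>x\<in>S. 0 \<le> N x \<and> (N x = 0 \<longleftrightarrow> x = 0)) \<and>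
     (\<forall>x\<in>S. \<forall>y\<in>S. N (x + y) \<le> N x + N y) \<and>
     (\<forall>c. \<forall>x\<in>S. N (c *\<^sub>R x) = \<bar>c\<bar> * N x)"

definition complete_on :: "'v::real_vector set \<Rightarrow> ('v \<Rightarrow> real) \<Rightarrow> bool" where
  "complete_on S N \<longleftrightarrow>
     (\<forall>X::nat \<Rightarrow> 'v. (\<forall>n. X n \<in> S) \<longrightarrow>
        (\<forall>r>0. \<exists>M. \<forall>m\<ge>M. \<forall>n\<ge>M. N (X m - X n) < r) \<longrightarrow>
        (\<exists>x\<in>S. (\<lambda>n. N (X n - x)) \<longlonglongrightarrow> 0))"

definition normed_gmodule ::
  "('o, 'g) groupoid_data \<Rightarrow> ('o, 'g, 'v::real_vector) gmodule \<Rightarrow> bool" where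
  "normed_gmodule G V \<longleftrightarrow>
     (\<forall>e\<in>Ob G. normed_space_on (car V e) (nrm V e)) \<and>
     (\<forall>g\<in>Mor G. lin_on (car V (src G g)) (act V g) \<and>
        (\<forall>v\<in>car V (src G g). act V g v \<in> car V (tgt G g) \<and>
           nrm V (tgt G g) (act V g v) = nrm V (src G g) v)) \<and>
     (\<forall>g\<in>Mor G. \<forall>h\<in>Mor G. src G g = tgt G h \<longrightarrow>
        (\<forall>v\<in>car V (src G h). act V g (act V h v) = act V (comp G g h) v)) \<and>
     (\<forall>e\<in>Ob G. \<forall>v\<in>car V e. act V (ident G e) v = v)"

definition banach_gmodule ::
  "('o, 'g) groupoid_data \<Rightarrow> ('o, 'g, 'v::real_vector) gmodule \<Rightarrow> bool" where
  "banach_gmodule G V \<longleftrightarrow>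
     normed_gmodule G V \<and> (\<forall>e\<in>Ob G. complete_on (car V e) (nrm V e))"

definition bounded_linear_betw ::
  "'v::real_vector set \<Rightarrow> ('v \<Rightarrow> real) \<Rightarrow> 'w::real_vector set \<Rightarrow> ('w \<Rightarrow> real) \<Rightarrow>
   ('v \<Rightarrow> 'w) \<Rightarrow> bool" where
  "bounded_linear_betw S N T M f \<longleftrightarrow>
     lin_on S f \<and> (\<forall>x\<in>S. f x \<in> T) \<and> (\<exists>K. \<forall>x\<in>S. M (f x) \<le> K * N x)"

text \<open>The operator norm, as in \<^const>\<open>onorm\<close>: the quotient is \<open>0\<close> at \<open>x = 0\<close>.\<close>

definition op_norm :: "'v set \<Rightarrow> ('v \<Rightarrow> real) \<Rightarrow> ('w \<Rightarrow> real) \<Rightarrow> ('v \<Rightarrow> 'w) \<Rightarrow> real" where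
  "op_norm S N M f = (SUP x\<in>S. M (f x) / N x)"

definition mor_op_norm ::
  "('o, 'g, 'v) gmodule \<Rightarrow> ('o, 'g, 'w) gmodule \<Rightarrow> ('o \<Rightarrow> 'v \<Rightarrow> 'w) \<Rightarrow> 'o \<Rightarrow> real" where
  "mor_op_norm V W f e = op_norm (car V e) (nrm V e) (nrm W e) (f e)"

text \<open>A supremum of nonnegative numbers; inserting \<open>0\<close> only matters for the empty groupoid.\<close>

definition sup_over_Ob :: "('o, 'g) groupoid_data \<Rightarrow> ('o \<Rightarrow> real) \<Rightarrow> real" where
  "sup_over_Ob G r = Sup (insert 0 (r ` Ob G))"

definition r_morphism ::
  "('o, 'g) groupoid_data \<Rightarrow> ('o, 'g, 'v::real_vector) gmodule \<Rightarrow>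
   ('o, 'g, 'w::real_vector) gmodule \<Rightarrow> ('o \<Rightarrow> 'v \<Rightarrow> 'w) \<Rightarrow> bool" where
  "r_morphism G V W f \<longleftrightarrow>
     (\<forall>e\<in>Ob G. bounded_linear_betw (car V e) (nrm V e) (car W e) (nrm W e) (f e)) \<and>
     bdd_above (mor_op_norm V W f ` Ob G)"

definition mor_norm ::
  "('o, 'g) groupoid_data \<Rightarrow> ('o, 'g, 'v) gmodule \<Rightarrow> ('o, 'g, 'w) gmodule \<Rightarrow>
   ('o \<Rightarrow> 'v \<Rightarrow> 'w) \<Rightarrow> real" where
  "mor_norm G V W f = sup_over_Ob G (mor_op_norm V W f)"

definition g_map ::
  "('o, 'g) groupoid_data \<Rightarrow> ('o, 'g, 'v::real_vector) gmodule \<Rightarrow>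
   ('o, 'g, 'w::real_vector) gmodule \<Rightarrow> ('o \<Rightarrow> 'v \<Rightarrow> 'w) \<Rightarrow> bool" where
  "g_map G V W f \<longleftrightarrow> r_morphism G V W f \<and>
     (\<forall>g\<in>Mor G. \<forall>v\<in>car V (src G g). act W g (f (src G g) v) = f (tgt G g) (act V g v))"

text \<open>
  Elements of \<open>B(V\<^sub>e, W\<^sub>e)\<close> are represented by functions that vanish outside \<open>V\<^sub>e\<close>, so that
  equality of functions is equality of maps on \<open>V\<^sub>e\<close>.
\<close>

definition hom_module ::
  "('o, 'g) groupoid_data \<Rightarrow> ('o, 'g, 'v::real_vector) gmodule \<Rightarrow>
   ('o, 'g, 'w::real_vector) gmodule \<Rightarrow> ('o, 'g, 'v \<Rightarrow> 'w) gmodule" where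
  "hom_module G V W = \<lparr>
     car = (\<lambda>e. {f. bounded_linear_betw (car V e) (nrm V e) (car W e) (nrm W e) f \<and>
                    (\<forall>x. x \<notin> car V e \<longrightarrow> f x = 0)}),
     nrm = (\<lambda>e. op_norm (car V e) (nrm V e) (nrm W e)),
     act = (\<lambda>g f v. if v \<in> car V (tgt G g) then act W g (f (act V (ginv G g) v)) else 0)\<rparr>"

text \<open>Likewise, elements of \<open>\<Prod>\<^sub>e V\<^sub>e\<close> vanish outside the set of objects.\<close>

definition invariants ::
  "('o, 'g) groupoid_data \<Rightarrow> ('o, 'g, 'v::real_vector) gmodule \<Rightarrow> ('o \<Rightarrow> 'v) set" where
  "invariants G V = {v. (\<forall>e\<in>Ob G. v e \<in> car V e) \<and> (\<forall>e. e \<notin> Ob G \<longrightarrow> v e = 0) \<and>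
     (\<forall>g\<in>Mor G. act V g (v (src G g)) = v (tgt G g)) \<and>
     bdd_above ((\<lambda>e. nrm V e (v e)) ` Ob G)}"

definition inv_norm ::
  "('o, 'g) groupoid_data \<Rightarrow> ('o, 'g, 'v) gmodule \<Rightarrow> ('o \<Rightarrow> 'v) \<Rightarrow> real" where
  "inv_norm G V v = sup_over_Ob G (\<lambda>e. nrm V e (v e))"

definition apply_family ::
  "('o, 'g) groupoid_data \<Rightarrow> ('o \<Rightarrow> 'v \<Rightarrow> 'w::zero) \<Rightarrow> ('o \<Rightarrow> 'v) \<Rightarrow> 'o \<Rightarrow> 'w" where
  "apply_family G f v = (\<lambda>e. if e \<in> Ob G then f e (v e) else 0)"

section \<open>Cohomology of normed cochain complexes\<close>

record 'a normed_complex =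
  sp :: "nat \<Rightarrow> 'a set"
  cnrm :: "nat \<Rightarrow> 'a \<Rightarrow> real"
  dif :: "nat \<Rightarrow> 'a \<Rightarrow> 'a"

definition cocycles :: "'a::real_vector normed_complex \<Rightarrow> nat \<Rightarrow> 'a set" where
  "cocycles K n = {z \<in> sp K n. dif K n z = 0}"

definition coboundaries :: "'a::real_vector normed_complex \<Rightarrow> nat \<Rightarrow> 'a set" where
  "coboundaries K n = (case n of 0 \<Rightarrow> {0} | Suc m \<Rightarrow> dif K m ` sp K m)"

definition coh_class :: "'a::real_vector normed_complex \<Rightarrow> nat \<Rightarrow> 'a \<Rightarrow> 'a set" where
  "coh_class K n z = (+) z ` coboundaries K n"

definition cohomology :: "'a::real_vector normed_complex \<Rightarrow> nat \<Rightarrow> 'a set set" where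
  "cohomology K n = coh_class K n ` cocycles K n"

definition coh_add :: "'a::real_vector set \<Rightarrow> 'a set \<Rightarrow> 'a set" where
  "coh_add X Y = {x + y | x y. x \<in> X \<and> y \<in> Y}"

text \<open>Adding the coboundaries only matters for \<open>c = 0\<close>.\<close>

definition coh_scale ::
  "'a::real_vector normed_complex \<Rightarrow> nat \<Rightarrow> real \<Rightarrow> 'a set \<Rightarrow> 'a set" where
  "coh_scale K n c X = {c *\<^sub>R x + b | x b. x \<in> X \<and> b \<in> coboundaries K n}"

text \<open>The members of a class are precisely the cocycles representing it.\<close>

definition coh_seminorm :: "'a normed_complex \<Rightarrow> nat \<Rightarrow> 'a set \<Rightarrow> real" where
  "coh_seminorm K n X = (INF z\<in>X. cnrm K n z)"

definition graded_iso ::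
  "'a::real_vector normed_complex \<Rightarrow> 'b::real_vector normed_complex \<Rightarrow>
   (nat \<Rightarrow> 'a set \<Rightarrow> 'b set) \<Rightarrow> bool" where
  "graded_iso K L \<phi> \<longleftrightarrow> (\<forall>n.
     bij_betw (\<phi> n) (cohomology K n) (cohomology L n) \<and>
     (\<forall>X\<in>cohomology K n. \<forall>Y\<in>cohomology K n.
        \<phi> n (coh_add X Y) = coh_add (\<phi> n X) (\<phi> n Y)) \<and>
     (\<forall>c. \<forall>X\<in>cohomology K n. \<phi> n (coh_scale K n c X) = coh_scale L n c (\<phi> n X)))"

definition seminorm_nonincreasing ::
  "'a::real_vector normed_complex \<Rightarrow> 'b::real_vector normed_complex \<Rightarrow>
   (nat \<Rightarrow> 'a set \<Rightarrow> 'b set) \<Rightarrow> bool" where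
  "seminorm_nonincreasing K L \<phi> \<longleftrightarrow>
     (\<forall>n. \<forall>X\<in>cohomology K n. coh_seminorm L n (\<phi> n X) \<le> coh_seminorm K n X)"

definition invariant_complex ::
  "('o, 'g) groupoid_data \<Rightarrow> (nat \<Rightarrow> ('o, 'g, 'd::real_vector) gmodule) \<Rightarrow>
   (nat \<Rightarrow> 'o \<Rightarrow> 'd \<Rightarrow> 'd) \<Rightarrow> ('o \<Rightarrow> 'd) normed_complex" where
  "invariant_complex G D \<delta> = \<lparr>
     sp = (\<lambda>n. invariants G (D n)),
     cnrm = (\<lambda>n. inv_norm G (D n)),
     dif = (\<lambda>n. apply_family G (\<delta> n))\<rparr>"

section \<open>Bounded cohomology of groupoids\<close>

definition bar_tuples :: "('o, 'g) groupoid_data \<Rightarrow> nat \<Rightarrow> 'o \<Rightarrow> 'g list set" where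
  "bar_tuples G n e = {xs. length xs = Suc n \<and> set xs \<subseteq> Mor G \<and>
     (\<forall>i<n. src G (xs ! i) = tgt G (xs ! Suc i)) \<and> tgt G (xs ! 0) = e}"

definition lin_ext :: "('a \<Rightarrow> 'b::real_vector) \<Rightarrow> ('a \<Rightarrow>\<^sub>0 real) \<Rightarrow> 'b" where
  "lin_ext b c = (\<Sum>x\<in>Poly_Mapping.keys c. Poly_Mapping.lookup c x *\<^sub>R b x)"

abbreviation basis_vec :: "'a \<Rightarrow> ('a \<Rightarrow>\<^sub>0 real)" where
  "basis_vec x \<equiv> Poly_Mapping.single x 1"

text \<open>The library norm on finitely supported functions is the \<open>\<ell>\<^sup>1\<close>-norm.\<close>

definition bar_module ::
  "('o, 'g) groupoid_data \<Rightarrow> nat \<Rightarrow> ('o, 'g, 'g list \<Rightarrow>\<^sub>0 real) gmodule" where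
  "bar_module G n = \<lparr>
     car = (\<lambda>e. {c. Poly_Mapping.keys c \<subseteq> bar_tuples G n e}),
     nrm = (\<lambda>e. norm),
     act = (\<lambda>g. lin_ext (\<lambda>xs. basis_vec (comp G g (hd xs) # tl xs)))\<rparr>"

text \<open>The boundary of a basis element \<open>(g\<^sub>0, \<dots>, g\<^sub>n)\<close>, where \<open>n\<close> is the length minus one; used for \<open>n \<ge> 1\<close>.\<close>

definition bar_boundary_basis ::
  "('o, 'g) groupoid_data \<Rightarrow> 'g list \<Rightarrow> ('g list \<Rightarrow>\<^sub>0 real)" where
  "bar_boundary_basis G xs = (let n = length xs - 1 in
     (\<Sum>i<n. (-1) ^ i *\<^sub>R basis_vec (take i xs @ comp G (xs ! i) (xs ! Suc i) # drop (i + 2) xs)) +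
     (-1) ^ n *\<^sub>R basis_vec (butlast xs))"

definition bar_boundary ::
  "('o, 'g) groupoid_data \<Rightarrow> ('g list \<Rightarrow>\<^sub>0 real) \<Rightarrow> ('g list \<Rightarrow>\<^sub>0 real)" where
  "bar_boundary G = lin_ext (bar_boundary_basis G)"

definition std_module ::
  "('o, 'g) groupoid_data \<Rightarrow> ('o, 'g, 'v::real_vector) gmodule \<Rightarrow> nat \<Rightarrow>
   ('o, 'g, ('g list \<Rightarrow>\<^sub>0 real) \<Rightarrow> 'v) gmodule" where
  "std_module G V n = hom_module G (bar_module G n) V"

definition std_coboundary ::
  "('o, 'g) groupoid_data \<Rightarrow> nat \<Rightarrow> 'o \<Rightarrow>
   (('g list \<Rightarrow>\<^sub>0 real) \<Rightarrow> 'v::real_vector) \<Rightarrow> (('g list \<Rightarrow>\<^sub>0 real) \<Rightarrow> 'v)" where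
  "std_coboundary G n e f =
     (\<lambda>c. if c \<in> car (bar_module G (Suc n)) e then f (bar_boundary G c) else 0)"

definition std_augmentation ::
  "('o, 'g) groupoid_data \<Rightarrow> 'o \<Rightarrow> 'v::real_vector \<Rightarrow> (('g list \<Rightarrow>\<^sub>0 real) \<Rightarrow> 'v)" where
  "std_augmentation G e v =
     (\<lambda>c. if c \<in> car (bar_module G 0) e then lin_ext (\<lambda>_. v) c else 0)"

definition bounded_cochains ::
  "('o, 'g) groupoid_data \<Rightarrow> ('o, 'g, 'v::real_vector) gmodule \<Rightarrow>
   ('o \<Rightarrow> ('g list \<Rightarrow>\<^sub>0 real) \<Rightarrow> 'v) normed_complex" where
  "bounded_cochains G V = invariant_complex G (std_module G V) (std_coboundary G)"

section \<open>Strong relatively injective resolutions\<close>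

definition rel_injective_map ::
  "('o, 'g) groupoid_data \<Rightarrow> ('o, 'g, 'u::real_vector) gmodule \<Rightarrow>
   ('o, 'g, 'w::real_vector) gmodule \<Rightarrow> ('o \<Rightarrow> 'u \<Rightarrow> 'w) \<Rightarrow> bool" where
  "rel_injective_map G U W i \<longleftrightarrow> g_map G U W i \<and>
     (\<exists>\<sigma>. r_morphism G W U \<sigma> \<and> (\<forall>e\<in>Ob G. \<forall>u\<in>car U e. \<sigma> e (i e u) = u) \<and> mor_norm G W U \<sigma> \<le> 1)"

text \<open>
  HOL cannot quantify over all modules at once, so the test modules \<open>U\<close> and \<open>W\<close> range over
  the modules whose ambient space is \<open>'u\<close>. Using the same type for both is no restriction,
  since \<open>U\<close> is isomorphic to a module carried by the image of \<open>i\<close>.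
\<close>

definition rel_injective_module ::
  "'u::real_vector itself \<Rightarrow> ('o, 'g) groupoid_data \<Rightarrow>
   ('o, 'g, 'v::real_vector) gmodule \<Rightarrow> bool" where
  "rel_injective_module _ G I \<longleftrightarrow>
     (\<forall>(U :: ('o, 'g, 'u) gmodule) (W :: ('o, 'g, 'u) gmodule) i \<alpha>.
        banach_gmodule G U \<longrightarrow> banach_gmodule G W \<longrightarrow>
        rel_injective_map G U W i \<longrightarrow> g_map G U I \<alpha> \<longrightarrow>
        (\<exists>\<beta>. g_map G W I \<beta> \<and> (\<forall>e\<in>Ob G. \<forall>u\<in>car U e. \<beta> e (i e u) = \<alpha> e u) \<and>
             mor_norm G W I \<beta> \<le> mor_norm G U I \<alpha>))"

text \<open>
  For a resolution of \<open>V\<close> by modules \<open>D\<^sup>n\<close> with ambient spaces \<open>'v\<close> and \<open>'d\<close>, test modules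
  are taken in the following type. It contains (isomorphic copies of) all modules with
  ambient space \<open>'d\<close> or that of the modules \<open>B(C\<^sub>n(G), V)\<close>. Assuming the extension property
  for these test modules only is a weaker hypothesis than assuming it for all Banach
  modules.
\<close>

type_synonym ('g, 'v, 'd) test_space = "'d \<times> (('g list \<Rightarrow>\<^sub>0 real) \<Rightarrow> 'v)"

definition banach_cochain_complex ::
  "('o, 'g) groupoid_data \<Rightarrow> (nat \<Rightarrow> ('o, 'g, 'd::real_vector) gmodule) \<Rightarrow>
   (nat \<Rightarrow> 'o \<Rightarrow> 'd \<Rightarrow> 'd) \<Rightarrow> bool" where
  "banach_cochain_complex G D \<delta> \<longleftrightarrow>
     (\<forall>n. banach_gmodule G (D n) \<and> g_map G (D n) (D (Suc n)) (\<delta> n)) \<and>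
     (\<forall>n. \<forall>e\<in>Ob G. \<forall>x\<in>car (D n) e. \<delta> (Suc n) e (\<delta> n e x) = 0)"

definition augmentation ::
  "('o, 'g) groupoid_data \<Rightarrow> ('o, 'g, 'v::real_vector) gmodule \<Rightarrow>
   (nat \<Rightarrow> ('o, 'g, 'd::real_vector) gmodule) \<Rightarrow> (nat \<Rightarrow> 'o \<Rightarrow> 'd \<Rightarrow> 'd) \<Rightarrow>
   ('o \<Rightarrow> 'v \<Rightarrow> 'd) \<Rightarrow> bool" where
  "augmentation G V D \<delta> \<epsilon> \<longleftrightarrow>
     g_map G V (D 0) \<epsilon> \<and> (\<forall>e\<in>Ob G. \<forall>v\<in>car V e. \<delta> 0 e (\<epsilon> e v) = 0)"

text \<open>
  In the contraction below, \<open>s0 : D\<^sup>0 \<rightarrow> V\<close>, and \<open>s n : D\<^sup>n\<^sup>+\<^sup>1 \<rightarrow> D\<^sup>n\<close> is the map in degree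
  \<open>n + 1\<close>.
\<close>

definition strong_resolution ::
  "('o, 'g) groupoid_data \<Rightarrow> ('o, 'g, 'v::real_vector) gmodule \<Rightarrow>
   (nat \<Rightarrow> ('o, 'g, 'd::real_vector) gmodule) \<Rightarrow> (nat \<Rightarrow> 'o \<Rightarrow> 'd \<Rightarrow> 'd) \<Rightarrow>
   ('o \<Rightarrow> 'v \<Rightarrow> 'd) \<Rightarrow> bool" where
  "strong_resolution G V D \<delta> \<epsilon> \<longleftrightarrow>
     banach_cochain_complex G D \<delta> \<and> augmentation G V D \<delta> \<epsilon> \<and>
     (\<exists>s0 s.
        r_morphism G (D 0) V s0 \<and> mor_norm G (D 0) V s0 \<le> 1 \<and>
        (\<forall>n. r_morphism G (D (Suc n)) (D n) (s n) \<and> mor_norm G (D (Suc n)) (D n) (s n) \<le> 1) \<and>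
        (\<forall>e\<in>Ob G. \<forall>v\<in>car V e. s0 e (\<epsilon> e v) = v) \<and>
        (\<forall>e\<in>Ob G. \<forall>x\<in>car (D 0) e. s 0 e (\<delta> 0 e x) + \<epsilon> e (s0 e x) = x) \<and>
        (\<forall>n. \<forall>e\<in>Ob G. \<forall>x\<in>car (D (Suc n)) e.
           s (Suc n) e (\<delta> (Suc n) e x) + \<delta> n e (s n e x) = x))"

text \<open>A bounded equivariant cochain map \<open>D \<rightarrow> B(C(G), V)\<close> extending the identity of \<open>V\<close>.\<close>

definition cochain_map_extending_id ::
  "('o, 'g) groupoid_data \<Rightarrow> ('o, 'g, 'v::real_vector) gmodule \<Rightarrow>
   (nat \<Rightarrow> ('o, 'g, 'd::real_vector) gmodule) \<Rightarrow> (nat \<Rightarrow> 'o \<Rightarrow> 'd \<Rightarrow> 'd) \<Rightarrow>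
   ('o \<Rightarrow> 'v \<Rightarrow> 'd) \<Rightarrow> (nat \<Rightarrow> 'o \<Rightarrow> 'd \<Rightarrow> ('g list \<Rightarrow>\<^sub>0 real) \<Rightarrow> 'v) \<Rightarrow> bool" where
  "cochain_map_extending_id G V D \<delta> \<epsilon> f \<longleftrightarrow>
     (\<forall>n. g_map G (D n) (std_module G V n) (f n)) \<and>
     (\<forall>n. \<forall>e\<in>Ob G. \<forall>x\<in>car (D n) e.
        f (Suc n) e (\<delta> n e x) = std_coboundary G n e (f n e x)) \<and>
     (\<forall>e\<in>Ob G. \<forall>v\<in>car V e. f 0 e (\<epsilon> e v) = std_augmentation G e v)"

definition canonical ::
  "('o, 'g) groupoid_data \<Rightarrow> ('o, 'g, 'v::real_vector) gmodule \<Rightarrow>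
   (nat \<Rightarrow> ('o, 'g, 'd::real_vector) gmodule) \<Rightarrow> (nat \<Rightarrow> 'o \<Rightarrow> 'd \<Rightarrow> 'd) \<Rightarrow>
   ('o \<Rightarrow> 'v \<Rightarrow> 'd) \<Rightarrow>
   (nat \<Rightarrow> ('o \<Rightarrow> 'd) set \<Rightarrow> ('o \<Rightarrow> ('g list \<Rightarrow>\<^sub>0 real) \<Rightarrow> 'v) set) \<Rightarrow> bool" where
  "canonical G V D \<delta> \<epsilon> \<phi> \<longleftrightarrow>
     (\<exists>f. cochain_map_extending_id G V D \<delta> \<epsilon> f \<and>
        (\<forall>n. \<forall>z\<in>cocycles (invariant_complex G D \<delta>) n.
           \<phi> n (coh_class (invariant_complex G D \<delta>) n z) =
             coh_class (bounded_cochains G V) n (apply_family G (f n) z)))"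

end

theory Submission
  imports Defs
begin

text \<open>
  A \<open>G\<close>-map into \<open>B(C\<^sub>n(G), V)\<close> is freely determined by its values on the tuples starting with an
  identity. Hence the contraction \<open>s\<close> of \<open>D\<close> yields, by recursion on the degree, an explicit comparison
  map \<open>f : D \<rightarrow> B(C(G), V)\<close> over \<open>id\<^sub>V\<close>, and \<open>\<parallel>f\<parallel> \<le> 1\<close> because \<open>\<parallel>s\<parallel> \<le> 1\<close>. In the other direction norms do
  not matter: a \<open>G\<close>-map \<open>A\<close> on \<open>X\<close> that vanishes on the kernel of \<open>d : X \<rightarrow> Y\<close> extends along \<open>d\<close> by
  relative injectivity applied to the closed submodule \<open>im d = ker d'\<close> of \<open>Y\<close>, on which \<open>A \<circ> s\<close> is
  equivariant. This one extension property gives a comparison map \<open>B(C(G), V) \<rightarrow> D\<close> and all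
  homotopies, so \<open>f\<close> is a homotopy equivalence of complexes of invariants.
\<close>

section \<open>Normed spaces given by a carrier and a norm\<close>

text \<open>Norms decide which comparison map is built by hand. The retraction
  \<open>d \<circ> s\<close> of \<open>Y\<close> onto \<open>im d\<close> has norm at most that of
  \<open>d\<close>, and a differential may have norm greater than 1. Extending degree by degree
  along \<open>d\<close> multiplies such factors, so a comparison map obtained in this way need not
  be semi-norm non-increasing. Hence the map from \<open>D\<close> to \<open>B(C(G), V)\<close> is
  written down explicitly, while its inverse up to homotopy and the homotopies may have arbitrary
  norm. The other obstacle is logical. Relative injectivity of \<open>D\<close> is assumed only for
  test modules inside one fixed type, so a module along which a map into \<open>D\<close> is
  extended must first be moved into \<open>test_space\<close> by an embedding with a left inverse:
  the first factor receives the modules of \<open>D\<close>, the second one those of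
  \<open>B(C(G), V)\<close>. For maps into \<open>B(C(G), V)\<close> the property
  \<open>extends_over\<close> is checked directly, by prescribing values. Both cases then feed the
  same recursions, which are run for two resolutions of \<open>V\<close>, namely \<open>D\<close>
  and the bar resolution.\<close>

lemma lin_on_add: "lin_on S f \<Longrightarrow> x \<in> S \<Longrightarrow> y \<in> S \<Longrightarrow> f (x + y) = f x + f y"
  and lin_on_scale: "lin_on S f \<Longrightarrow> x \<in> S \<Longrightarrow> f (c *\<^sub>R x) = c *\<^sub>R f x"
  by (auto simp: lin_on_def)

lemma lin_on_zero: "lin_on S f \<Longrightarrow> subspace S \<Longrightarrow> f 0 = 0"
  by (metis lin_on_scale scaleR_zero_left subspace_0)

lemma lin_on_minus: "lin_on S f \<Longrightarrow> x \<in> S \<Longrightarrow> f (- x) = - f x"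
  using lin_on_scale[of S f x "-1"] by simp

lemma lin_on_diff:
  assumes "lin_on S f" "subspace S" "x \<in> S" "y \<in> S"
  shows "f (x - y) = f x - f y"
  using lin_on_add[OF assms(1,3), of "- y"] lin_on_minus[OF assms(1,4)] subspace_neg[OF assms(2,4)]
  by simp

lemma lin_on_sum:
  assumes "lin_on S f" "subspace S" "\<And>i. i \<in> A \<Longrightarrow> u i \<in> S"
  shows "f (\<Sum>i\<in>A. u i) = (\<Sum>i\<in>A. f (u i))"
  using assms(3)
proof (induction A rule: infinite_finite_induct)
  case (insert a A)
  then have "(\<Sum>i\<in>A. u i) \<in> S"
    by (intro subspace_sum[OF assms(2)]) auto
  then show ?case
    using insert by (simp add: lin_on_add[OF assms(1)])
qed (use lin_on_zero[OF assms(1,2)] in simp_all)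

lemma lin_on_compose:
  assumes "lin_on S f" "\<And>x. x \<in> S \<Longrightarrow> f x \<in> T" "lin_on T g"
  shows "lin_on S (\<lambda>x. g (f x))"
  using assms by (simp add: lin_on_def)

lemma lin_on_difference:
  assumes "lin_on S f" "lin_on S g"
  shows "lin_on S (\<lambda>x. f x - g x)"
  using assms by (simp add: lin_on_def algebra_simps)

lemma lin_on_subset: "lin_on S f \<Longrightarrow> T \<subseteq> S \<Longrightarrow> lin_on T f"
  unfolding lin_on_def by blast

lemma subspace_kernel:
  assumes "subspace S" "lin_on S f"
  shows "subspace {x \<in> S. f x = 0}"
  using assms lin_on_zero[OF assms(2,1)]
  by (auto simp: subspace_def lin_on_add lin_on_scale)

section \<open>Estimates for a norm on a carrier and for the operator norm\<close>

context
  fixes S :: "'v::real_vector set" and N :: "'v \<Rightarrow> real"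
  assumes ns: "normed_space_on S N"
begin

lemma normed_space_subspace: "subspace S"
  and normed_space_nonneg: "x \<in> S \<Longrightarrow> 0 \<le> N x"
  and normed_space_eq_0: "x \<in> S \<Longrightarrow> N x = 0 \<longleftrightarrow> x = 0"
  and normed_space_triangle: "x \<in> S \<Longrightarrow> y \<in> S \<Longrightarrow> N (x + y) \<le> N x + N y"
  and normed_space_scale: "x \<in> S \<Longrightarrow> N (c *\<^sub>R x) = \<bar>c\<bar> * N x"
  using ns by (auto simp: normed_space_on_def)

lemma normed_space_0 [simp]: "0 \<in> S" "N 0 = 0"
  using normed_space_subspace normed_space_eq_0 by (auto simp: subspace_0)

lemma normed_space_minus: "x \<in> S \<Longrightarrow> N (- x) = N x"
  using normed_space_scale[of x "-1"] by simp

lemma normed_space_diff: "x \<in> S \<Longrightarrow> y \<in> S \<Longrightarrow> N (x - y) \<le> N x + N y"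
  using normed_space_triangle[of x "- y"] normed_space_minus[of y] subspace_neg[OF normed_space_subspace]
  by simp

lemma normed_space_sum:
  assumes "\<And>i. i \<in> A \<Longrightarrow> u i \<in> S"
  shows "N (\<Sum>i\<in>A. u i) \<le> (\<Sum>i\<in>A. N (u i))"
  using assms
proof (induction A rule: infinite_finite_induct)
  case (insert a A)
  then have "(\<Sum>i\<in>A. u i) \<in> S"
    by (intro subspace_sum[OF normed_space_subspace]) auto
  then show ?case
    using insert normed_space_triangle[of "u a" "\<Sum>i\<in>A. u i"] by simp
qed simp_all

lemma normed_space_limit_unique:
  assumes "\<And>n. X n \<in> S" "a \<in> S" "b \<in> S"
    and "(\<lambda>n. N (X n - a)) \<longlonglongrightarrow> 0" "(\<lambda>n. N (X n - b)) \<longlonglongrightarrow> 0"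
  shows "a = b"
proof -
  note sub = normed_space_subspace
  have "N (a - b) \<le> N (X n - b) + N (X n - a)" for n
    using normed_space_diff[of "X n - b" "X n - a"] assms subspace_diff[OF sub] by simp
  moreover have "(\<lambda>n. N (X n - b) + N (X n - a)) \<longlonglongrightarrow> 0"
    using tendsto_add[OF assms(5,4)] by simp
  ultimately have "N (a - b) \<le> 0"
    by (intro LIMSEQ_le_const) auto
  moreover have "a - b \<in> S"
    using assms subspace_diff[OF sub] by blast
  ultimately show ?thesis
    using normed_space_nonneg[of "a - b"] normed_space_eq_0[of "a - b"] by simp
qed

text \<open>The quotient in \<open>op_norm\<close> is 0 where \<open>N x = 0\<close>, so
  \<open>0 \<le> K\<close> is what bounds it there; elsewhere one divides by
  \<open>N x\<close>.\<close>

lemma op_norm_le: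
  assumes "0 \<le> K" "\<And>x. x \<in> S \<Longrightarrow> M (f x) \<le> K * N x"
  shows "op_norm S N M f \<le> K"
  unfolding op_norm_def
proof (rule cSUP_least)
  show "S \<noteq> {}"
    using normed_space_0(1) by blast
  fix x assume x: "x \<in> S"
  show "M (f x) / N x \<le> K"
  proof (cases "N x = 0")
    case False
    then have "0 < N x"
      using normed_space_nonneg[OF x] by simp
    then show ?thesis
      using assms(2)[OF x] by (simp add: divide_simps)
  qed (use assms in simp)
qed

lemma op_norm_bdd_above:
  assumes "\<And>x. x \<in> S \<Longrightarrow> M (f x) \<le> K * N x"
  shows "bdd_above ((\<lambda>x. M (f x) / N x) ` S)"
proof (rule bdd_aboveI2)
  fix x assume x: "x \<in> S"
  \<comment> \<open>\<open>K\<close> may be negative, for instance when \<open>S = {0}\<close>,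
    where the quotient takes the value 0; hence the absolute value.\<close>
  show "M (f x) / N x \<le> \<bar>K\<bar>"
  proof (cases "N x = 0")
    case False
    then have "0 < N x"
      using normed_space_nonneg[OF x] by simp
    moreover have "M (f x) \<le> \<bar>K\<bar> * N x"
      using assms[OF x] mult_right_mono[of K "\<bar>K\<bar>" "N x"] \<open>0 < N x\<close> by linarith
    ultimately show ?thesis
      by (simp add: divide_simps)
  qed simp
qed

lemma op_norm_bound:
  assumes "normed_space_on T M" "bounded_linear_betw S N T M f" "x \<in> S"
  shows "M (f x) \<le> op_norm S N M f * N x"
proof -
  from assms(2) obtain K where K: "\<And>x. x \<in> S \<Longrightarrow> M (f x) \<le> K * N x"
    by (auto simp: bounded_linear_betw_def)
  show ?thesis
  proof (cases "N x = 0")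
    case True
    then show ?thesis
      using K[OF assms(3)] by simp
  next
    case False
    then have "0 < N x"
      using normed_space_nonneg[OF assms(3)] by simp
    moreover have "M (f x) / N x \<le> op_norm S N M f"
      unfolding op_norm_def by (rule cSUP_upper[OF assms(3) op_norm_bdd_above[of M f, OF K]])
    ultimately show ?thesis
      by (simp add: divide_simps)
  qed
qed

lemma op_norm_nonneg:
  assumes "bounded_linear_betw S N T M f"
  shows "0 \<le> op_norm S N M f"
proof -
  from assms obtain K where K: "\<And>x. x \<in> S \<Longrightarrow> M (f x) \<le> K * N x"
    by (auto simp: bounded_linear_betw_def)
  show ?thesis
    unfolding op_norm_def
    using cSUP_upper[OF normed_space_0(1) op_norm_bdd_above[of M f, OF K]] by simp
qed

end

section \<open>Completeness of kernels and of spaces of bounded linear maps\<close>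

lemma complete_on_kernel:
  assumes S: "normed_space_on S N" and comp: "complete_on S N"
    and T: "normed_space_on T M" and bl: "bounded_linear_betw S N T M f"
  shows "complete_on {x \<in> S. f x = 0} N"
  unfolding complete_on_def
proof (intro allI impI)
  fix X :: "nat \<Rightarrow> 'a"
  assume X: "\<forall>n. X n \<in> {x \<in> S. f x = 0}" "\<forall>r>0. \<exists>L. \<forall>m\<ge>L. \<forall>n\<ge>L. N (X m - X n) < r"
  then obtain x where x: "x \<in> S" "(\<lambda>n. N (X n - x)) \<longlonglongrightarrow> 0"
    using comp[unfolded complete_on_def, rule_format, of X] by blast
  have lin: "lin_on S f" and f: "\<And>x. x \<in> S \<Longrightarrow> f x \<in> T"
    using bl by (auto simp: bounded_linear_betw_def)
  \<comment> \<open>All \<open>X n\<close> lie in the kernel, so \<open>f (X n - x) = - f x\<close>;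
    the left side does not depend on \<open>n\<close> and is squeezed to 0.\<close>
  have "M (f x) \<le> op_norm S N M f * N (X n - x)" for n
  proof -
    have n: "X n \<in> S" "f (X n) = 0"
      using X(1) by auto
    then have "f (X n - x) = - f x"
      using lin_on_diff[OF lin normed_space_subspace[OF S]] x(1) by simp
    then show ?thesis
      using op_norm_bound[OF S T bl, of "X n - x"] subspace_diff[OF normed_space_subspace[OF S] n(1) x(1)]
        normed_space_minus[OF T f[OF x(1)]] by simp
  qed
  moreover have "(\<lambda>n. op_norm S N M f * N (X n - x)) \<longlonglongrightarrow> 0"
    using tendsto_mult_right_zero[OF x(2)] .
  ultimately have "M (f x) \<le> 0"
    by (intro LIMSEQ_le_const) auto
  then have "f x = 0"
    using normed_space_nonneg[OF T f[OF x(1)]] normed_space_eq_0[OF T f[OF x(1)]] by simp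
  then show "\<exists>x\<in>{x \<in> S. f x = 0}. (\<lambda>n. N (X n - x)) \<longlonglongrightarrow> 0"
    using x by blast
qed

text \<open>Completeness of \<open>T\<close> gives pointwise limits, and the Cauchy condition
  survives the limit uniformly relative to \<open>N x\<close>; this yields both boundedness of the
  limit and convergence in operator norm. The domain is an arbitrary normed space because the bar
  modules, consisting of finitely supported functions with the l1-norm, are in general
  incomplete.\<close>

lemma complete_on_bounded_linear:
  assumes S: "normed_space_on S N" and T: "normed_space_on T M" and "complete_on T M"
  shows "complete_on {f. bounded_linear_betw S N T M f \<and> (\<forall>x. x \<notin> S \<longrightarrow> f x = 0)} (op_norm S N M)"
  unfolding complete_on_def
proof (intro allI impI)
  let ?H = "{f. bounded_linear_betw S N T M f \<and> (\<forall>x. x \<notin> S \<longrightarrow> f x = 0)}"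
  note subS = normed_space_subspace[OF S] and subT = normed_space_subspace[OF T]
  fix X :: "nat \<Rightarrow> 'a \<Rightarrow> 'b"
  assume "\<forall>n. X n \<in> ?H"
    and cauchy: "\<forall>r>0. \<exists>L. \<forall>m\<ge>L. \<forall>n\<ge>L. op_norm S N M (X m - X n) < r"
  then have bl: "bounded_linear_betw S N T M (X n)" and out: "x \<notin> S \<Longrightarrow> X n x = 0" for n x
    by auto
  have lin: "lin_on S (X n)" and XT: "x \<in> S \<Longrightarrow> X n x \<in> T" for n x
    using bl[of n] by (auto simp: bounded_linear_betw_def)
  have bl_diff: "bounded_linear_betw S N T M (X m - X n)" for m n
    unfolding bounded_linear_betw_def
  proof (intro conjI ballI)
    show "lin_on S (X m - X n)"
      using lin_on_difference[OF lin[of m] lin[of n]] by (simp add: fun_diff_def)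
    show "(X m - X n) x \<in> T" if "x \<in> S" for x
      using XT[OF that] subspace_diff[OF subT] by simp
    have "M ((X m - X n) x) \<le> (op_norm S N M (X m) + op_norm S N M (X n)) * N x" if "x \<in> S" for x
      using normed_space_diff[OF T XT[OF that] XT[OF that], of m n]
        op_norm_bound[OF S T bl[of m] that] op_norm_bound[OF S T bl[of n] that]
      by (simp add: algebra_simps)
    then show "\<exists>K. \<forall>x\<in>S. M ((X m - X n) x) \<le> K * N x"
      by blast
  qed
  have dist: "M (X m x - X n x) \<le> op_norm S N M (X m - X n) * N x" if "x \<in> S" for m n x
    using op_norm_bound[OF S T bl_diff that, of m n] by simp
  have "\<exists>y\<in>T. (\<lambda>n. M (X n x - y)) \<longlonglongrightarrow> 0" if x: "x \<in> S" for x
  proof -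
    have "\<exists>L. \<forall>m\<ge>L. \<forall>n\<ge>L. M (X m x - X n x) < r" if "0 < r" for r
    proof -
      \<comment> \<open>Adding 1 keeps the denominator positive when \<open>x = 0\<close> and makes
        the final inequality strict.\<close>
      have pos: "0 < r / (N x + 1)"
        using that normed_space_nonneg[OF S x] by simp
      then obtain L where L: "\<And>m n. m \<ge> L \<Longrightarrow> n \<ge> L \<Longrightarrow> op_norm S N M (X m - X n) < r / (N x + 1)"
        using cauchy by blast
      have "M (X m x - X n x) < r" if "m \<ge> L" "n \<ge> L" for m n
      proof -
        have "M (X m x - X n x) \<le> r / (N x + 1) * N x"
          using dist[OF x, of m n] L[OF that] normed_space_nonneg[OF S x]
          by (meson less_imp_le mult_right_mono order_trans)
        also have "\<dots> < r / (N x + 1) * (N x + 1)"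
          using pos by (intro mult_strict_left_mono) simp_all
        also have "\<dots> = r"
          using normed_space_nonneg[OF S x] by simp
        finally show ?thesis .
      qed
      then show ?thesis
        by blast
    qed
    then show ?thesis
      using assms(3)[unfolded complete_on_def, rule_format, of "\<lambda>n. X n x"] XT[OF x] by blast
  qed
  then obtain Y0 where Y0: "\<And>x. x \<in> S \<Longrightarrow> Y0 x \<in> T" "\<And>x. x \<in> S \<Longrightarrow> (\<lambda>n. M (X n x - Y0 x)) \<longlonglongrightarrow> 0"
    by metis
  \<comment> \<open>The value 0 outside \<open>S\<close> is the normal form required of the elements
    of this space.\<close>
  define Y where "Y x = (if x \<in> S then Y0 x else 0)" for x
  have YT: "Y x \<in> T" and lim: "(\<lambda>n. M (X n x - Y x)) \<longlonglongrightarrow> 0" if "x \<in> S" for x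
    using Y0 that by (auto simp: Y_def)
  have "lin_on S Y"
    unfolding lin_on_def
  proof (intro conjI ballI allI)
    fix x y assume xy: "x \<in> S" "y \<in> S"
    note s = subspace_add[OF subS xy]
    have "M (X n (x + y) - (Y x + Y y)) \<le> M (X n x - Y x) + M (X n y - Y y)" for n
      using normed_space_triangle[OF T, of "X n x - Y x" "X n y - Y y"] xy XT YT subspace_diff[OF subT]
      by (simp add: lin_on_add[OF lin xy] algebra_simps)
    moreover have "(\<lambda>n. M (X n x - Y x) + M (X n y - Y y)) \<longlonglongrightarrow> 0"
      using tendsto_add[OF lim[OF xy(1)] lim[OF xy(2)]] by simp
    moreover have "0 \<le> M (X n (x + y) - (Y x + Y y))" for n
      by (intro normed_space_nonneg[OF T] subspace_diff[OF subT] subspace_add[OF subT] XT YT s xy)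
    ultimately have "(\<lambda>n. M (X n (x + y) - (Y x + Y y))) \<longlonglongrightarrow> 0"
      by - (rule Lim_null_comparison[OF always_eventually, rotated], assumption, simp)
    then show "Y (x + y) = Y x + Y y"
      by (intro normed_space_limit_unique[OF T _ _ _ lim[OF s], of "Y x + Y y"])
        (auto intro!: XT YT s subspace_add[OF subT] xy)
  next
    fix c x assume x: "x \<in> S"
    note s = subspace_scale[OF subS x, of c]
    have "M (X n (c *\<^sub>R x) - c *\<^sub>R Y x) = \<bar>c\<bar> * M (X n x - Y x)" for n
      using normed_space_scale[OF T, of "X n x - Y x" c] x XT YT subspace_diff[OF subT]
      by (simp add: lin_on_scale[OF lin x] algebra_simps)
    then have "(\<lambda>n. M (X n (c *\<^sub>R x) - c *\<^sub>R Y x)) \<longlonglongrightarrow> 0"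
      using tendsto_mult_right_zero[OF lim[OF x]] by simp
    then show "Y (c *\<^sub>R x) = c *\<^sub>R Y x"
      by (intro normed_space_limit_unique[OF T _ _ _ lim[OF s], of "c *\<^sub>R Y x"])
        (auto intro!: XT YT s subspace_scale[OF subT] x)
  qed
  \<comment> \<open>The distance from \<open>X n x\<close> to \<open>X m x\<close> is at most
    \<open>r * N x\<close> for all late \<open>m\<close> and \<open>n\<close>. Letting
    \<open>m\<close> tend to infinity with \<open>n\<close> and \<open>x\<close> fixed keeps this
    bound, with a threshold \<open>L\<close> independent of \<open>x\<close>.\<close>
  have close: "\<exists>L. \<forall>n\<ge>L. \<forall>x\<in>S. M (X n x - Y x) \<le> r * N x" if r: "0 < r" for r
  proof -
    obtain L where L: "\<And>m n. m \<ge> L \<Longrightarrow> n \<ge> L \<Longrightarrow> op_norm S N M (X m - X n) < r"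
      using cauchy r by blast
    have "M (X n x - Y x) \<le> r * N x" if n: "n \<ge> L" and x: "x \<in> S" for n x
    proof -
      have "M (X n x - Y x) \<le> r * N x + M (X m x - Y x)" if "m \<ge> L" for m
      proof -
        have "M (X n x - X m x) \<le> r * N x"
          using dist[OF x, of n m] L[OF n that] normed_space_nonneg[OF S x]
          by (meson less_imp_le mult_right_mono order_trans)
        moreover have "M (X n x - Y x) \<le> M (X n x - X m x) + M (X m x - Y x)"
          using normed_space_triangle[OF T, of "X n x - X m x" "X m x - Y x"] x XT YT subspace_diff[OF subT]
          by simp
        ultimately show ?thesis
          by simp
      qed
      moreover have "(\<lambda>m. r * N x + M (X m x - Y x)) \<longlonglongrightarrow> r * N x"
        using tendsto_add[OF tendsto_const lim[OF x]] by simp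
      ultimately show ?thesis
        by (intro LIMSEQ_le_const) auto
    qed
    then show ?thesis
      by blast
  qed
  have "bounded_linear_betw S N T M Y"
    unfolding bounded_linear_betw_def
  proof (intro conjI ballI)
    obtain n where n: "\<And>x. x \<in> S \<Longrightarrow> M (X n x - Y x) \<le> 1 * N x"
      using close[of 1] by auto
    have "M (Y x) \<le> (op_norm S N M (X n) + 1) * N x" if x: "x \<in> S" for x
      using normed_space_diff[OF T XT[OF x] subspace_diff[OF subT XT[OF x] YT[OF x]], of n n] n[OF x]
        op_norm_bound[OF S T bl x, of n]
      by (simp add: algebra_simps)
    then show "\<exists>K. \<forall>x\<in>S. M (Y x) \<le> K * N x"
      by blast
  qed (use \<open>lin_on S Y\<close> YT in auto)
  then have H: "Y \<in> ?H"
    by (simp add: Y_def)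
  have "(\<lambda>n. op_norm S N M (X n - Y)) \<longlonglongrightarrow> 0"
  proof (rule LIMSEQ_I)
    fix r :: real assume "0 < r"
    \<comment> \<open>Half of \<open>r\<close>, since \<open>close\<close> only provides a weak
      inequality and a strict one is required.\<close>
    then obtain L where L: "\<And>n x. n \<ge> L \<Longrightarrow> x \<in> S \<Longrightarrow> M (X n x - Y x) \<le> r / 2 * N x"
      using close[of "r / 2"] by auto
    have "norm (op_norm S N M (X n - Y) - 0) < r" if "n \<ge> L" for n
    proof -
      have "bounded_linear_betw S N T M (X n - Y)"
        unfolding bounded_linear_betw_def
        using lin_on_difference[OF lin[of n] \<open>lin_on S Y\<close>] subspace_diff[OF subT XT YT] L[OF that]
        by (auto simp: fun_diff_def intro!: exI[of _ "r / 2"])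
      then have "0 \<le> op_norm S N M (X n - Y)"
        by (rule op_norm_nonneg[OF S])
      moreover have "op_norm S N M (X n - Y) \<le> r / 2"
        using \<open>0 < r\<close> L[OF that] by (intro op_norm_le[OF S]) auto
      ultimately show ?thesis
        using \<open>0 < r\<close> by simp
    qed
    then show "\<exists>no. \<forall>n\<ge>no. norm (op_norm S N M (X n - Y) - 0) < r"
      by blast
  qed
  then show "\<exists>x\<in>?H. (\<lambda>n. op_norm S N M (X n - x)) \<longlonglongrightarrow> 0"
    using H by blast
qed

section \<open>Groupoids and their modules\<close>

locale groupoid_on =
  fixes G :: "('o, 'g) groupoid_data"
  assumes G: "groupoid G"
begin

lemma src_in_Ob: "g \<in> Mor G \<Longrightarrow> src G g \<in> Ob G"
  and tgt_in_Ob: "g \<in> Mor G \<Longrightarrow> tgt G g \<in> Ob G"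
  and comp_in_Mor: "g \<in> Mor G \<Longrightarrow> h \<in> Mor G \<Longrightarrow> src G g = tgt G h \<Longrightarrow> comp G g h \<in> Mor G"
  and src_comp: "g \<in> Mor G \<Longrightarrow> h \<in> Mor G \<Longrightarrow> src G g = tgt G h \<Longrightarrow> src G (comp G g h) = src G h"
  and tgt_comp: "g \<in> Mor G \<Longrightarrow> h \<in> Mor G \<Longrightarrow> src G g = tgt G h \<Longrightarrow> tgt G (comp G g h) = tgt G g"
  and comp_assoc: "g \<in> Mor G \<Longrightarrow> h \<in> Mor G \<Longrightarrow> k \<in> Mor G \<Longrightarrow> src G g = tgt G h \<Longrightarrow>
    src G h = tgt G k \<Longrightarrow> comp G (comp G g h) k = comp G g (comp G h k)"
  and ident_in_Mor: "e \<in> Ob G \<Longrightarrow> ident G e \<in> Mor G"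
  and src_ident: "e \<in> Ob G \<Longrightarrow> src G (ident G e) = e"
  and tgt_ident: "e \<in> Ob G \<Longrightarrow> tgt G (ident G e) = e"
  and comp_ident_left: "g \<in> Mor G \<Longrightarrow> comp G (ident G (tgt G g)) g = g"
  and comp_ident_right: "g \<in> Mor G \<Longrightarrow> comp G g (ident G (src G g)) = g"
  using G unfolding groupoid_def by blast+

text \<open>\<open>ginv\<close> is a definite description, so the point is uniqueness: two inverses
  satisfy \<open>h' = h' (g h) = (h' g) h = h\<close>.\<close>

lemma is_inverse_ginv:
  assumes g: "g \<in> Mor G"
  shows "is_inverse G g (ginv G g)"
proof -
  obtain h where h: "is_inverse G g h"
    using G g unfolding groupoid_def by blast
  have "h' = h" if h': "is_inverse G g h'" for h'
  proof -
    have "h' = comp G h' (comp G g h)"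
      using h h' comp_ident_right[of h'] by (simp add: is_inverse_def)
    also have "\<dots> = comp G (comp G h' g) h"
      using h h' g comp_assoc[of h' g h] by (simp add: is_inverse_def)
    also have "\<dots> = h"
      using h h' comp_ident_left[of h] by (simp add: is_inverse_def)
    finally show ?thesis .
  qed
  then show ?thesis
    unfolding ginv_def using h by (rule theI[of "is_inverse G g", rotated])
qed

lemma ginv_in_Mor: "g \<in> Mor G \<Longrightarrow> ginv G g \<in> Mor G"
  and src_ginv: "g \<in> Mor G \<Longrightarrow> src G (ginv G g) = tgt G g"
  and tgt_ginv: "g \<in> Mor G \<Longrightarrow> tgt G (ginv G g) = src G g"
  and comp_ginv_right: "g \<in> Mor G \<Longrightarrow> comp G g (ginv G g) = ident G (tgt G g)"
  and comp_ginv_left: "g \<in> Mor G \<Longrightarrow> comp G (ginv G g) g = ident G (src G g)"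
  using is_inverse_ginv by (auto simp: is_inverse_def)

lemmas groupoid_simps = src_in_Ob tgt_in_Ob comp_in_Mor src_comp tgt_comp ident_in_Mor src_ident
  tgt_ident comp_ident_left comp_ident_right ginv_in_Mor src_ginv tgt_ginv

lemma gmodule_normed_space: "normed_gmodule G V \<Longrightarrow> e \<in> Ob G \<Longrightarrow> normed_space_on (car V e) (nrm V e)"
  and act_lin_on: "normed_gmodule G V \<Longrightarrow> g \<in> Mor G \<Longrightarrow> lin_on (car V (src G g)) (act V g)"
  and act_in_car: "normed_gmodule G V \<Longrightarrow> g \<in> Mor G \<Longrightarrow> v \<in> car V (src G g) \<Longrightarrow> act V g v \<in> car V (tgt G g)"
  and nrm_act: "normed_gmodule G V \<Longrightarrow> g \<in> Mor G \<Longrightarrow> v \<in> car V (src G g) \<Longrightarrow>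
    nrm V (tgt G g) (act V g v) = nrm V (src G g) v"
  and act_act: "normed_gmodule G V \<Longrightarrow> g \<in> Mor G \<Longrightarrow> h \<in> Mor G \<Longrightarrow> src G g = tgt G h \<Longrightarrow>
    v \<in> car V (src G h) \<Longrightarrow> act V g (act V h v) = act V (comp G g h) v"
  and act_ident: "normed_gmodule G V \<Longrightarrow> e \<in> Ob G \<Longrightarrow> v \<in> car V e \<Longrightarrow> act V (ident G e) v = v"
  unfolding normed_gmodule_def by blast+

lemmas gmodule_subspace = normed_space_subspace[OF gmodule_normed_space]

lemma act_ginv_act:
  "normed_gmodule G V \<Longrightarrow> g \<in> Mor G \<Longrightarrow> v \<in> car V (src G g) \<Longrightarrow> act V (ginv G g) (act V g v) = v"
  by (simp add: act_act groupoid_simps comp_ginv_left act_ident)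

lemma act_act_ginv:
  "normed_gmodule G V \<Longrightarrow> g \<in> Mor G \<Longrightarrow> v \<in> car V (tgt G g) \<Longrightarrow> act V g (act V (ginv G g) v) = v"
  by (simp add: act_act groupoid_simps comp_ginv_right act_ident)

lemma act_ginv_in_car:
  "normed_gmodule G V \<Longrightarrow> g \<in> Mor G \<Longrightarrow> v \<in> car V (tgt G g) \<Longrightarrow> act V (ginv G g) v \<in> car V (src G g)"
  using act_in_car[of V "ginv G g" v] by (simp add: groupoid_simps)

lemma nrm_act_ginv:
  "normed_gmodule G V \<Longrightarrow> g \<in> Mor G \<Longrightarrow> v \<in> car V (tgt G g) \<Longrightarrow>
    nrm V (src G g) (act V (ginv G g) v) = nrm V (tgt G g) v"
  using nrm_act[of V "ginv G g" v] by (simp add: groupoid_simps)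

section \<open>Families of bounded maps and equivariant maps\<close>

lemma r_morphism_lin: "r_morphism G V W f \<Longrightarrow> e \<in> Ob G \<Longrightarrow> lin_on (car V e) (f e)"
  and r_morphism_in: "r_morphism G V W f \<Longrightarrow> e \<in> Ob G \<Longrightarrow> v \<in> car V e \<Longrightarrow> f e v \<in> car W e"
  by (auto simp: r_morphism_def bounded_linear_betw_def)

lemma mor_norm_nonneg: "r_morphism G V W f \<Longrightarrow> 0 \<le> mor_norm G V W f"
  unfolding mor_norm_def sup_over_Ob_def r_morphism_def by (intro cSup_upper) auto

lemma r_morphism_bound:
  assumes "normed_gmodule G V" "normed_gmodule G W" "r_morphism G V W f" "e \<in> Ob G" "v \<in> car V e"
  shows "nrm W e (f e v) \<le> mor_norm G V W f * nrm V e v"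
proof -
  have "nrm W e (f e v) \<le> mor_op_norm V W f e * nrm V e v"
    unfolding mor_op_norm_def using assms
    by (intro op_norm_bound[OF gmodule_normed_space gmodule_normed_space]) (auto simp: r_morphism_def)
  moreover have "mor_op_norm V W f e \<le> mor_norm G V W f"
    unfolding mor_norm_def sup_over_Ob_def
    using assms(3,4) by (intro cSup_upper) (auto simp: r_morphism_def)
  ultimately show ?thesis
    using normed_space_nonneg[OF gmodule_normed_space[OF assms(1,4)] assms(5)]
    by (meson mult_right_mono order_trans)
qed

lemma nrm_le_if_mor_norm_le_1:
  assumes "normed_gmodule G V" "normed_gmodule G W" "r_morphism G V W f" "mor_norm G V W f \<le> 1"
    "e \<in> Ob G" "v \<in> car V e"
  shows "nrm W e (f e v) \<le> nrm V e v"
  using r_morphism_bound[OF assms(1-3,5,6)]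
    mult_right_mono[OF assms(4) normed_space_nonneg[OF gmodule_normed_space[OF assms(1,5)] assms(6)]]
  by simp

lemma mor_norm_le:
  assumes "normed_gmodule G V" "0 \<le> K"
    and "\<And>e v. e \<in> Ob G \<Longrightarrow> v \<in> car V e \<Longrightarrow> nrm W e (f e v) \<le> K * nrm V e v"
  shows "mor_norm G V W f \<le> K"
  unfolding mor_norm_def sup_over_Ob_def mor_op_norm_def
  using assms by (intro cSup_least) (auto intro: op_norm_le[OF gmodule_normed_space])

text \<open>A single constant \<open>K\<close> for all objects gives boundedness at each object and
  the finite supremum at once.\<close>

lemma r_morphismI:
  assumes "normed_gmodule G V" "0 \<le> K"
    and "\<And>e. e \<in> Ob G \<Longrightarrow> lin_on (car V e) (f e)"
    and "\<And>e v. e \<in> Ob G \<Longrightarrow> v \<in> car V e \<Longrightarrow> f e v \<in> car W e"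
    and "\<And>e v. e \<in> Ob G \<Longrightarrow> v \<in> car V e \<Longrightarrow> nrm W e (f e v) \<le> K * nrm V e v"
  shows "r_morphism G V W f"
  unfolding r_morphism_def mor_op_norm_def bounded_linear_betw_def
  using assms by (auto intro!: exI[of _ K] bdd_aboveI2[where M = K] op_norm_le[OF gmodule_normed_space])

lemma g_map_r_morphism: "g_map G V W f \<Longrightarrow> r_morphism G V W f"
  and g_map_equivariant: "g_map G V W f \<Longrightarrow> g \<in> Mor G \<Longrightarrow> v \<in> car V (src G g) \<Longrightarrow>
    act W g (f (src G g) v) = f (tgt G g) (act V g v)"
  by (auto simp: g_map_def)

lemmas g_map_lin = r_morphism_lin[OF g_map_r_morphism]
  and g_map_in = r_morphism_in[OF g_map_r_morphism]

lemma r_morphism_compose: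
  assumes "normed_gmodule G U" "normed_gmodule G V" "normed_gmodule G W"
    and "r_morphism G U V f" "r_morphism G V W h"
  shows "r_morphism G U W (\<lambda>e x. h e (f e x))"
proof (rule r_morphismI[where K = "mor_norm G V W h * mor_norm G U V f"])
  fix e u assume e: "e \<in> Ob G" and u: "u \<in> car U e"
  have "nrm W e (h e (f e u)) \<le> mor_norm G V W h * nrm V e (f e u)"
    using assms e u by (intro r_morphism_bound) (auto intro: r_morphism_in)
  also have "\<dots> \<le> mor_norm G V W h * (mor_norm G U V f * nrm U e u)"
    using assms e u by (intro mult_left_mono r_morphism_bound mor_norm_nonneg)
  finally show "nrm W e (h e (f e u)) \<le> mor_norm G V W h * mor_norm G U V f * nrm U e u"
    by (simp add: mult.assoc)
qed (use assms in \<open>auto intro: r_morphism_in mult_nonneg_nonneg mor_norm_nonneg lin_on_compose r_morphism_lin\<close>)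

lemma g_map_compose:
  assumes "normed_gmodule G U" "normed_gmodule G V" "normed_gmodule G W"
    and "g_map G U V f" "g_map G V W h"
  shows "g_map G U W (\<lambda>e x. h e (f e x))"
  using assms unfolding g_map_def
  by (auto intro: r_morphism_compose simp: r_morphism_in src_in_Ob)

lemma g_map_difference:
  assumes V: "normed_gmodule G V" and W: "normed_gmodule G W"
    and f: "g_map G V W f" and h: "g_map G V W h"
  shows "g_map G V W (\<lambda>e x. f e x - h e x)"
  unfolding g_map_def
proof (intro conjI ballI)
  note fr = g_map_r_morphism[OF f] and hr = g_map_r_morphism[OF h]
  show "r_morphism G V W (\<lambda>e x. f e x - h e x)"
  proof (rule r_morphismI[where K = "mor_norm G V W f + mor_norm G V W h"])
    fix e v assume ev: "e \<in> Ob G" "v \<in> car V e"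
    show "f e v - h e v \<in> car W e"
      using ev by (intro subspace_diff[OF gmodule_subspace[OF W]] r_morphism_in[OF fr] r_morphism_in[OF hr])
    have "nrm W e (f e v - h e v) \<le> nrm W e (f e v) + nrm W e (h e v)"
      using ev by (intro normed_space_diff[OF gmodule_normed_space[OF W]] r_morphism_in[OF fr] r_morphism_in[OF hr])
    then show "nrm W e (f e v - h e v) \<le> (mor_norm G V W f + mor_norm G V W h) * nrm V e v"
      using r_morphism_bound[OF V W fr ev] r_morphism_bound[OF V W hr ev] by (simp add: algebra_simps)
  qed (use V fr hr in \<open>auto intro: add_nonneg_nonneg mor_norm_nonneg lin_on_difference r_morphism_lin\<close>)
  fix g v assume g: "g \<in> Mor G" and v: "v \<in> car V (src G g)"
  have "act W g (f (src G g) v - h (src G g) v) = act W g (f (src G g) v) - act W g (h (src G g) v)"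
    using g v by (intro lin_on_diff[OF act_lin_on[OF W]] gmodule_subspace[OF W] r_morphism_in[OF fr]
      r_morphism_in[OF hr] src_in_Ob)
  then show "act W g (f (src G g) v - h (src G g) v) = f (tgt G g) (act V g v) - h (tgt G g) (act V g v)"
    using g_map_equivariant[OF f g v] g_map_equivariant[OF h g v] by simp
qed

lemma g_map_id: "normed_gmodule G V \<Longrightarrow> g_map G V V (\<lambda>e x. x)"
  unfolding g_map_def by (auto intro!: r_morphismI[where K = 1] simp: lin_on_def)

lemma banach_imp_normed: "banach_gmodule G V \<Longrightarrow> normed_gmodule G V"
  by (simp add: banach_gmodule_def)

section \<open>Extension along relatively injective maps\<close>

text \<open>Stands for the image of the preceding differential: in an exact complex the two agree,
  and as a kernel it is visibly closed.\<close>

definition kernel_module ::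
  "('o, 'g, 'y) gmodule \<Rightarrow> ('o \<Rightarrow> 'y \<Rightarrow> 'z::zero) \<Rightarrow> ('o, 'g, 'y) gmodule" where
  "kernel_module Y d = Y\<lparr>car := \<lambda>e. {y \<in> car Y e. d e y = 0}\<rparr>"

lemma kernel_module_simps [simp]:
  "car (kernel_module Y d) e = {y \<in> car Y e. d e y = 0}"
  "nrm (kernel_module Y d) = nrm Y"
  "act (kernel_module Y d) = act Y"
  by (simp_all add: kernel_module_def)

text \<open>Equivariance of \<open>d\<close> makes the family of kernels stable under the action,
  and boundedness makes each kernel closed, hence complete.\<close>

lemma banach_kernel_module:
  assumes "banach_gmodule G Y" "normed_gmodule G Z" "g_map G Y Z d"
  shows "banach_gmodule G (kernel_module Y d)"
proof -
  note Y = banach_imp_normed[OF assms(1)]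
  have ker: "act Y g y \<in> car Y (tgt G g) \<and> d (tgt G g) (act Y g y) = 0"
    if g: "g \<in> Mor G" and y: "y \<in> car Y (src G g)" "d (src G g) y = 0" for g y
    using g_map_equivariant[OF assms(3) g y(1)] y(2) act_in_car[OF Y g y(1)]
      lin_on_zero[OF act_lin_on[OF assms(2) g] gmodule_subspace[OF assms(2)]] g
    by (simp add: src_in_Ob)
  have "normed_space_on {y \<in> car Y e. d e y = 0} (nrm Y e)" if "e \<in> Ob G" for e
    using subspace_kernel[OF gmodule_subspace[OF Y that] g_map_lin[OF assms(3) that]]
      gmodule_normed_space[OF Y that] by (simp add: normed_space_on_def)
  moreover have "complete_on {y \<in> car Y e. d e y = 0} (nrm Y e)" if "e \<in> Ob G" for e
    using assms that g_map_r_morphism[OF assms(3)]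
    by (intro complete_on_kernel[OF gmodule_normed_space[OF Y] _ gmodule_normed_space[OF assms(2)]])
      (auto simp: banach_gmodule_def r_morphism_def)
  moreover have "lin_on {y \<in> car Y (src G g). d (src G g) y = 0} (act Y g)" if "g \<in> Mor G" for g
    by (rule lin_on_subset[OF act_lin_on[OF Y that]]) auto
  ultimately show ?thesis
    using Y ker unfolding banach_gmodule_def normed_gmodule_def by simp
qed

text \<open>The isometric copy of \<open>Y\<close> on the image of an embedding \<open>j\<close>
  into another ambient space. The map \<open>p\<close> is a left inverse of \<open>j\<close>, and
  only its values on the image matter.\<close>

definition transport_module ::
  "('y \<Rightarrow> 't) \<Rightarrow> ('t \<Rightarrow> 'y) \<Rightarrow> ('o, 'g, 'y) gmodule \<Rightarrow> ('o, 'g, 't) gmodule" where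
  "transport_module j p Y = \<lparr>car = \<lambda>e. j ` car Y e, nrm = \<lambda>e x. nrm Y e (p x), act = \<lambda>g x. j (act Y g (p x))\<rparr>"

lemma banach_transport_module:
  assumes Y: "banach_gmodule G Y" and j: "linear j" and pj: "\<And>y. p (j y) = y"
  shows "banach_gmodule G (transport_module j p Y)"
proof -
  note nY = banach_imp_normed[OF Y]
  interpret j: linear j by fact
  have j0: "j x = 0 \<longleftrightarrow> x = 0" for x
    by (metis pj j.zero)
  have "normed_space_on (j ` car Y e) (\<lambda>x. nrm Y e (p x))" if "e \<in> Ob G" for e
    using gmodule_normed_space[OF nY that] linear_subspace_image[OF j, of "car Y e"]
    by (auto simp: normed_space_on_def pj j0 simp flip: j.add j.scaleR)
  moreover have "complete_on (j ` car Y e) (\<lambda>x. nrm Y e (p x))" if "e \<in> Ob G" for e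
    unfolding complete_on_def
  proof (intro allI impI)
    fix X :: "nat \<Rightarrow> _" assume X: "\<forall>n. X n \<in> j ` car Y e"
      "\<forall>r>0. \<exists>M. \<forall>m\<ge>M. \<forall>n\<ge>M. nrm Y e (p (X m - X n)) < r"
    have Xp: "X n = j (p (X n))" "p (X n) \<in> car Y e" for n
      using X(1) pj by (metis imageE)+
    \<comment> \<open>\<open>p\<close> is not assumed linear; on the image of \<open>j\<close> it is
      additive because \<open>j\<close> is additive and \<open>p (j y) = y\<close>.\<close>
    have diff: "p (X m - X n) = p (X m) - p (X n)" for m n
      by (metis Xp(1) j.diff pj)
    have "complete_on (car Y e) (nrm Y e)"
      using Y that by (simp add: banach_gmodule_def)
    then obtain y where y: "y \<in> car Y e" "(\<lambda>n. nrm Y e (p (X n) - y)) \<longlonglongrightarrow> 0"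
      using X(2)[unfolded diff] Xp(2)
      unfolding complete_on_def by (elim allE[of _ "\<lambda>n. p (X n)"]) blast
    moreover have "p (X n - j y) = p (X n) - y" for n
      by (metis Xp(1) j.diff pj)
    ultimately show "\<exists>x\<in>j ` car Y e. (\<lambda>n. nrm Y e (p (X n - x))) \<longlonglongrightarrow> 0"
      by (intro bexI[of _ "j y"]) simp_all
  qed
  ultimately show ?thesis
    using nY unfolding banach_gmodule_def normed_gmodule_def transport_module_def
    by (auto simp: pj lin_on_def simp flip: j.add j.scaleR)
qed

text \<open>A \<open>G\<close>-map on \<open>X\<close> that kills the kernel of \<open>d\<close>
  factors through \<open>d\<close>, by a map defined on all of \<open>Y\<close>. This is the only
  consequence of injectivity used in the recursions below. No test type occurs in it, so it can be
  established for the modules of \<open>D\<close> and for the bar cochains by different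
  means.\<close>

definition extends_over ::
  "('o, 'g, 'x::real_vector) gmodule \<Rightarrow> ('o, 'g, 'y::real_vector) gmodule \<Rightarrow> ('o \<Rightarrow> 'x \<Rightarrow> 'y) \<Rightarrow>
   ('o, 'g, 'i::real_vector) gmodule \<Rightarrow> bool" where
  "extends_over X Y d I \<longleftrightarrow>
     (\<forall>A. g_map G X I A \<longrightarrow> (\<forall>e\<in>Ob G. \<forall>x\<in>car X e. d e x = 0 \<longrightarrow> A e x = 0) \<longrightarrow>
        (\<exists>\<beta>. g_map G Y I \<beta> \<and> (\<forall>e\<in>Ob G. \<forall>x\<in>car X e. \<beta> e (d e x) = A e x)))"


text \<open>
  No norm control is claimed: this allows a retraction \<open>\<sigma>\<close> of arbitrary norm, since it becomes a
  contraction when the inclusion of the submodule is rescaled.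
\<close>

lemma rel_injective_extension:
  fixes Y :: "('o, 'g, 'y::real_vector) gmodule"
    and I :: "('o, 'g, 'i::real_vector) gmodule"
    and j :: "'y \<Rightarrow> 't::real_vector"
  assumes inj: "rel_injective_module TYPE('t) G I" and I: "normed_gmodule G I"
    and j: "linear j" and pj: "\<And>y. p (j y) = y"
    and Y: "banach_gmodule G Y" and U: "banach_gmodule G (Y\<lparr>car := C\<rparr>)"
    and sub: "\<And>e. e \<in> Ob G \<Longrightarrow> C e \<subseteq> car Y e"
    and \<sigma>: "r_morphism G Y (Y\<lparr>car := C\<rparr>) \<sigma>" and \<sigma>_id: "\<And>e u. e \<in> Ob G \<Longrightarrow> u \<in> C e \<Longrightarrow> \<sigma> e u = u"
    and \<alpha>: "g_map G (Y\<lparr>car := C\<rparr>) I \<alpha>"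
  shows "\<exists>\<beta>. g_map G Y I \<beta> \<and> (\<forall>e\<in>Ob G. \<forall>u\<in>C e. \<beta> e u = \<alpha> e u)"
proof -
  let ?U = "Y\<lparr>car := C\<rparr>" and ?T = "transport_module j p"
  interpret j: linear j by fact
  note nY = banach_imp_normed[OF Y] and nU = banach_imp_normed[OF U]
  have TY: "banach_gmodule G (?T Y)" and TU: "banach_gmodule G (?T ?U)"
    by (rule banach_transport_module[OF Y j pj] banach_transport_module[OF U j pj])+
  note nTY = banach_imp_normed[OF TY] and nTU = banach_imp_normed[OF TU]
  \<comment> \<open>Scaling the inclusion by \<open>c\<close> replaces the retraction by \<sigma>
    divided by \<open>c\<close>, whose norm is at most 1. The maximum with 1 ensures that
    \<open>c\<close> is invertible.\<close>
  define c where "c = max 1 (mor_norm G Y ?U \<sigma>)"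
  have c: "c > 0" "c \<ge> mor_norm G Y ?U \<sigma>"
    by (auto simp: c_def)
  have scC: "r *\<^sub>R u \<in> C e" if "e \<in> Ob G" "u \<in> C e" for r e u
    using subspace_scale[OF gmodule_subspace[OF nU that(1)]] that(2) by simp
  define i where "i = (\<lambda>(e::'o) x. c *\<^sub>R (x::'t))"
  define \<sigma>' where "\<sigma>' = (\<lambda>e w. (1 / c) *\<^sub>R j (\<sigma> e (p w)))"
  \<comment> \<open>The same factor \<open>c\<close> appears here as in \<open>i\<close>, so that it
    cancels when the extension of \<alpha>' along \<open>i\<close> is compared with
    \<alpha>.\<close>
  define \<alpha>' where "\<alpha>' = (\<lambda>e w. c *\<^sub>R \<alpha> e (p w))"
  have i: "g_map G (?T ?U) (?T Y) i"
    unfolding g_map_def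
  proof (intro conjI ballI)
    show "r_morphism G (?T ?U) (?T Y) i"
    proof (rule r_morphismI[where K = c])
      fix e x assume "e \<in> Ob G" "x \<in> car (?T ?U) e"
      then obtain u where u: "u \<in> C e" "x = j u"
        by (auto simp: transport_module_def)
      have ix: "i e (j u) = j (c *\<^sub>R u)"
        by (simp add: i_def j.scaleR)
      show "i e x \<in> car (?T Y) e"
        using scC[OF \<open>e \<in> Ob G\<close> u(1)] sub[OF \<open>e \<in> Ob G\<close>] by (auto simp: ix u(2) transport_module_def)
      show "nrm (?T Y) e (i e x) \<le> c * nrm (?T ?U) e x"
        using normed_space_scale[OF gmodule_normed_space[OF nU \<open>e \<in> Ob G\<close>]] u c
        by (simp add: ix transport_module_def pj)
    qed (use nTU c in \<open>auto simp: i_def lin_on_def scaleR_add_right\<close>)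
    fix g x assume g: "g \<in> Mor G" and x: "x \<in> car (?T ?U) (src G g)"
    then obtain u where u: "u \<in> C (src G g)" "x = j u"
      by (auto simp: transport_module_def)
    have ix: "i e (j y) = j (c *\<^sub>R y)" for e y
      by (simp add: i_def j.scaleR)
    show "act (?T Y) g (i (src G g) x) = i (tgt G g) (act (?T ?U) g x)"
      using lin_on_scale[OF act_lin_on[OF nU g], of u c] u
      by (simp add: ix transport_module_def pj)
  qed
  have lin_p: "lin_on (j ` S) p" for S
    unfolding lin_on_def by (auto simp: pj simp flip: j.add j.scaleR)
  have \<sigma>': "r_morphism G (?T Y) (?T ?U) \<sigma>'" "mor_norm G (?T Y) (?T ?U) \<sigma>' \<le> 1"
  proof -
    have bound: "nrm (?T ?U) e (\<sigma>' e w) \<le> nrm (?T Y) e w"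
      and inU: "\<sigma>' e w \<in> car (?T ?U) e" if e: "e \<in> Ob G" and w: "w \<in> car (?T Y) e" for e w
    proof -
      from w obtain y where y: "y \<in> car Y e" "w = j y"
        by (auto simp: transport_module_def)
      have s: "\<sigma>' e (j y) = j ((1 / c) *\<^sub>R \<sigma> e y)"
        by (simp add: \<sigma>'_def pj j.scaleR)
      have sy: "\<sigma> e y \<in> C e"
        using r_morphism_in[OF \<sigma> e y(1)] by simp
      show "\<sigma>' e w \<in> car (?T ?U) e"
        using scC[OF e sy] by (auto simp: s y(2) transport_module_def)
      have "nrm Y e (\<sigma> e y) \<le> c * nrm Y e y"
        using r_morphism_bound[OF nY nU \<sigma> e y(1)] c
          mult_right_mono[OF c(2) normed_space_nonneg[OF gmodule_normed_space[OF nY e] y(1)]] by simp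
      then have "c * nrm Y e ((1 / c) *\<^sub>R \<sigma> e y) \<le> c * nrm Y e y"
        using normed_space_scale[OF gmodule_normed_space[OF nU e], of "\<sigma> e y" "1 / c"] sy c(1)
        by simp
      then show "nrm (?T ?U) e (\<sigma>' e w) \<le> nrm (?T Y) e w"
        using c(1) by (simp add: s transport_module_def pj y(2))
    qed
    have "lin_on (car (?T Y) e) (\<sigma>' e)" if e: "e \<in> Ob G" for e
    proof -
      have "lin_on (j ` car Y e) (\<lambda>w. \<sigma> e (p w))"
        by (rule lin_on_compose[OF lin_p _ r_morphism_lin[OF \<sigma> e]]) (auto simp: pj)
      then show ?thesis
        by (auto simp: lin_on_def \<sigma>'_def transport_module_def j.add j.scaleR scaleR_add_right)
    qed
    then show "r_morphism G (?T Y) (?T ?U) \<sigma>'"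
      by (intro r_morphismI[where K = 1, OF nTY]) (auto intro: inU bound)
    show "mor_norm G (?T Y) (?T ?U) \<sigma>' \<le> 1"
      by (intro mor_norm_le[OF nTY]) (auto intro: bound)
  qed
  have \<sigma>i: "\<sigma>' e (i e u) = u" if e: "e \<in> Ob G" and u: "u \<in> car (?T ?U) e" for e u
  proof -
    obtain v where v: "v \<in> C e" "u = j v"
      using u by (auto simp: transport_module_def)
    have "i e u = j (c *\<^sub>R v)"
      by (simp add: i_def v j.scaleR)
    then have "\<sigma>' e (i e u) = (1 / c) *\<^sub>R j (c *\<^sub>R v)"
      using \<sigma>_id[OF e scC[OF e v(1)]] by (simp add: \<sigma>'_def pj)
    then show ?thesis
      using c(1) by (simp add: v(2) j.scaleR)
  qed
  have \<alpha>': "g_map G (?T ?U) I \<alpha>'"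
    unfolding g_map_def
  proof (intro conjI ballI)
    show "r_morphism G (?T ?U) I \<alpha>'"
    proof (rule r_morphismI[where K = "c * mor_norm G ?U I \<alpha>"])
      show "0 \<le> c * mor_norm G ?U I \<alpha>"
        using c(1) mor_norm_nonneg[OF g_map_r_morphism[OF \<alpha>]] by simp
    next
      fix e assume e: "e \<in> Ob G"
      have "lin_on (j ` C e) (\<lambda>w. \<alpha> e (p w))"
        using g_map_lin[OF \<alpha> e] by (intro lin_on_compose[OF lin_p]) (auto simp: pj)
      then show "lin_on (car (?T ?U) e) (\<alpha>' e)"
        by (auto simp: lin_on_def \<alpha>'_def transport_module_def scaleR_add_right)
      fix x assume "x \<in> car (?T ?U) e"
      then obtain u where u: "u \<in> C e" "x = j u"
        by (auto simp: transport_module_def)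
      have \<alpha>u: "\<alpha> e u \<in> car I e"
        using g_map_in[OF \<alpha> e] u by simp
      then show "\<alpha>' e x \<in> car I e"
        by (simp add: \<alpha>'_def u pj subspace_scale[OF gmodule_subspace[OF I e]])
      show "nrm I e (\<alpha>' e x) \<le> c * mor_norm G ?U I \<alpha> * nrm (?T ?U) e x"
        using normed_space_scale[OF gmodule_normed_space[OF I e] \<alpha>u, of c] c(1) u
          r_morphism_bound[OF nU I g_map_r_morphism[OF \<alpha>] e, of u]
        by (simp add: \<alpha>'_def pj transport_module_def)
    qed (use nTU in auto)
    fix g x assume g: "g \<in> Mor G" and "x \<in> car (?T ?U) (src G g)"
    then obtain u where u: "u \<in> C (src G g)" "x = j u"
      by (auto simp: transport_module_def)
    have "act I g (c *\<^sub>R \<alpha> (src G g) u) = c *\<^sub>R act I g (\<alpha> (src G g) u)"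
      using u g_map_in[OF \<alpha> src_in_Ob[OF g]] by (intro lin_on_scale[OF act_lin_on[OF I g]]) simp
    then show "act I g (\<alpha>' (src G g) x) = \<alpha>' (tgt G g) (act (?T ?U) g x)"
      using g_map_equivariant[OF \<alpha> g, of u] u by (simp add: \<alpha>'_def pj transport_module_def)
  qed
  have "rel_injective_map G (?T ?U) (?T Y) i"
    unfolding rel_injective_map_def using i \<sigma>' \<sigma>i by blast
  then obtain \<beta>' where \<beta>': "g_map G (?T Y) I \<beta>'"
    and \<beta>'i: "\<And>e u. e \<in> Ob G \<Longrightarrow> u \<in> car (?T ?U) e \<Longrightarrow> \<beta>' e (i e u) = \<alpha>' e u"
    using inj[unfolded rel_injective_module_def, rule_format, OF TU TY _ \<alpha>'] by blast
  define \<beta> where "\<beta> = (\<lambda>e y. \<beta>' e (j y))"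
  have jY: "j y \<in> car (?T Y) e" if "y \<in> car Y e" for e y
    using that by (simp add: transport_module_def)
  have "g_map G Y I \<beta>"
    unfolding g_map_def
  proof (intro conjI ballI)
    show "r_morphism G Y I \<beta>"
    proof (rule r_morphismI[where K = "mor_norm G (?T Y) I \<beta>'"])
      fix e assume e: "e \<in> Ob G"
      show "lin_on (car Y e) (\<beta> e)"
        unfolding \<beta>_def
        by (rule lin_on_compose[OF _ _ g_map_lin[OF \<beta>' e]]) (auto simp: lin_on_def j.add j.scaleR jY)
      fix y assume y: "y \<in> car Y e"
      show "\<beta> e y \<in> car I e"
        unfolding \<beta>_def by (rule g_map_in[OF \<beta>' e jY[OF y]])
      show "nrm I e (\<beta> e y) \<le> mor_norm G (?T Y) I \<beta>' * nrm Y e y"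
        using r_morphism_bound[OF nTY I g_map_r_morphism[OF \<beta>'] e jY[OF y]]
        by (simp add: \<beta>_def transport_module_def pj)
    qed (use nY mor_norm_nonneg[OF g_map_r_morphism[OF \<beta>']] in auto)
    fix g y assume g: "g \<in> Mor G" and y: "y \<in> car Y (src G g)"
    show "act I g (\<beta> (src G g) y) = \<beta> (tgt G g) (act Y g y)"
      using g_map_equivariant[OF \<beta>' g jY[OF y]] by (simp add: \<beta>_def transport_module_def pj)
  qed
  moreover have "\<beta> e u = \<alpha> e u" if e: "e \<in> Ob G" and u: "u \<in> C e" for e u
  proof -
    have u': "j u \<in> car (?T ?U) e"
      using u by (simp add: transport_module_def)
    \<comment> \<open>\<open>\<beta>'\<close> is known on the scaled inclusion only; linearity moves
      \<open>c\<close> outside, where it can be cancelled.\<close>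
    have "c *\<^sub>R \<beta> e u = \<beta>' e (i e (j u))"
      using lin_on_scale[OF g_map_lin[OF \<beta>' e] jY, of u c] u sub[OF e] by (auto simp: \<beta>_def i_def)
    also have "\<dots> = c *\<^sub>R \<alpha> e u"
      by (simp add: \<beta>'i[OF e u'] \<alpha>'_def pj)
    finally show ?thesis
      using c(1) by simp
  qed
  ultimately show ?thesis
    by blast
qed

text \<open>The map \<open>s\<close> is not equivariant, but for \<open>y\<close> in the kernel of
  \<open>d'\<close> both \<open>s (g y)\<close> and \<open>g (s y)\<close> are preimages of
  \<open>g y\<close> under \<open>d\<close>. They differ by an element of the kernel of
  \<open>d\<close>, which \<open>A\<close> does not see; so \<open>A \<circ> s\<close> is
  equivariant on that kernel. The retraction needed for relative injectivity is
  \<open>d \<circ> s\<close>.\<close>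

lemma extends_over_rel_injective:
  fixes Y :: "('o, 'g, 'y::real_vector) gmodule"
    and I :: "('o, 'g, 'i::real_vector) gmodule"
    and j :: "'y \<Rightarrow> 't::real_vector"
  assumes inj: "rel_injective_module TYPE('t) G I" and I: "normed_gmodule G I"
    and j: "linear j" and pj: "\<And>y. p (j y) = y"
    and X: "normed_gmodule G X" and Y: "banach_gmodule G Y" and Z: "normed_gmodule G Z"
    and d: "g_map G X Y d" and d': "g_map G Y Z d'" and s: "r_morphism G Y X s"
    and dd: "\<And>e x. e \<in> Ob G \<Longrightarrow> x \<in> car X e \<Longrightarrow> d' e (d e x) = 0"
    and exact: "\<And>e y. e \<in> Ob G \<Longrightarrow> y \<in> car Y e \<Longrightarrow> d' e y = 0 \<Longrightarrow> d e (s e y) = y"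
  shows "extends_over X Y d I"
  unfolding extends_over_def
proof (intro allI impI)
  fix A assume A: "g_map G X I A" and "\<forall>e\<in>Ob G. \<forall>x\<in>car X e. d e x = 0 \<longrightarrow> A e x = 0"
  \<comment> \<open>The value of \<open>A\<close> depends only on the image under \<open>d\<close>.
    This is used twice: for the equivariance of \<open>A \<circ> s\<close> and for the final
    identity, where \<open>x\<close> is compared with \<open>s (d x)\<close>.\<close>
  then have A0: "A e x = A e y" if "e \<in> Ob G" "x \<in> car X e" "y \<in> car X e" "d e x = d e y" for e x y
    using lin_on_diff[OF g_map_lin[OF d] gmodule_subspace[OF X]]
      lin_on_diff[OF g_map_lin[OF A] gmodule_subspace[OF X]] that
      subspace_diff[OF gmodule_subspace[OF X]]
    by (metis right_minus_eq)
  note nY = banach_imp_normed[OF Y]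
  have U: "banach_gmodule G (kernel_module Y d')"
    by (rule banach_kernel_module[OF Y Z d'])
  note nU = banach_imp_normed[OF U]
  have "r_morphism G Y Y (\<lambda>e y. d e (s e y))"
    by (rule r_morphism_compose[OF nY X nY s g_map_r_morphism[OF d]])
  \<comment> \<open>The image of \<open>d \<circ> s\<close> lies in the kernel because
    \<open>d' \<circ> d = 0\<close>; that it fixes the kernel is the hypothesis
    \<open>exact\<close>.\<close>
  then have \<sigma>: "r_morphism G Y (kernel_module Y d') (\<lambda>e y. d e (s e y))"
    by (intro r_morphismI[OF nY, where K = "mor_norm G Y Y (\<lambda>e y. d e (s e y))"])
      (use r_morphism_bound[OF nY nY] in \<open>auto intro: mor_norm_nonneg r_morphism_lin r_morphism_in
        dd r_morphism_in[OF s]\<close>)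
  have s': "r_morphism G (kernel_module Y d') X s"
    by (intro r_morphismI[OF nU, where K = "mor_norm G Y X s"])
      (use r_morphism_bound[OF nY X s] s in \<open>auto intro: mor_norm_nonneg lin_on_subset[OF r_morphism_lin]
        r_morphism_in\<close>)
  have \<alpha>: "g_map G (kernel_module Y d') I (\<lambda>e y. A e (s e y))"
    unfolding g_map_def
  proof (intro conjI ballI)
    show "r_morphism G (kernel_module Y d') I (\<lambda>e y. A e (s e y))"
      by (rule r_morphism_compose[OF nU X I s' g_map_r_morphism[OF A]])
    fix g y assume g: "g \<in> Mor G" and y: "y \<in> car (kernel_module Y d') (src G g)"
    have gy: "act Y g y \<in> car Y (tgt G g)" "d' (tgt G g) (act Y g y) = 0"
      using act_in_car[OF nU g y] by auto
    have sy: "s (src G g) y \<in> car X (src G g)"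
      using y by (intro r_morphism_in[OF s] src_in_Ob g) auto
    \<comment> \<open>Both candidates for a preimage of \<open>g y\<close> are pushed forward by
      \<open>d\<close> and compared there.\<close>
    have "d (tgt G g) (act X g (s (src G g) y)) = act Y g y"
      using g_map_equivariant[OF d g sy] exact[OF src_in_Ob[OF g]] y by simp
    also have "\<dots> = d (tgt G g) (s (tgt G g) (act Y g y))"
      using exact[OF tgt_in_Ob[OF g] gy] by simp
    finally have "A (tgt G g) (act X g (s (src G g) y)) = A (tgt G g) (s (tgt G g) (act Y g y))"
      by (intro A0 tgt_in_Ob g act_in_car[OF X g sy] r_morphism_in[OF s] gy)
    then show "act I g (A (src G g) (s (src G g) y)) = A (tgt G g) (s (tgt G g) (act (kernel_module Y d') g y))"
      using g_map_equivariant[OF A g sy] by simp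
  qed
  obtain \<beta> where \<beta>: "g_map G Y I \<beta>"
    "\<And>e u. e \<in> Ob G \<Longrightarrow> u \<in> car Y e \<Longrightarrow> d' e u = 0 \<Longrightarrow> \<beta> e u = A e (s e u)"
    using rel_injective_extension[OF inj I j pj Y U[unfolded kernel_module_def] _
        \<sigma>[unfolded kernel_module_def] _ \<alpha>[unfolded kernel_module_def]] exact
    by auto
  have "\<beta> e (d e x) = A e x" if e: "e \<in> Ob G" and x: "x \<in> car X e" for e x
  proof -
    have dx: "d e x \<in> car Y e" "d' e (d e x) = 0"
      using g_map_in[OF d e x] dd[OF e x] by auto
    then show ?thesis
      using \<beta>(2)[OF e dx] A0[OF e _ x] exact[OF e dx] r_morphism_in[OF s e dx(1)] by simp
  qed
  then show "\<exists>\<beta>. g_map G Y I \<beta> \<and> (\<forall>e\<in>Ob G. \<forall>x\<in>car X e. \<beta> e (d e x) = A e x)"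
    using \<beta>(1) by blast
qed

end

section \<open>Linear extension from a basis\<close>

lemma lookup_scaleR: "Poly_Mapping.lookup (r *\<^sub>R c) x = r *\<^sub>R Poly_Mapping.lookup c x"
proof -
  have "finite {x. r *\<^sub>R Poly_Mapping.lookup c x \<noteq> 0}"
    by (rule finite_subset[of _ "Poly_Mapping.keys c"]) (auto simp: in_keys_iff)
  then show ?thesis
    by (simp add: scaleR_poly_mapping_def)
qed

text \<open>Padding with zero coefficients lets sums over the different supports of
  \<open>c\<close>, \<open>d\<close> and \<open>c + d\<close> be taken over one common finite set;
  linearity in \<open>c\<close> rests on this.\<close>

lemma lin_ext_superset:
  assumes "finite A" "Poly_Mapping.keys c \<subseteq> A"
  shows "lin_ext b c = (\<Sum>x\<in>A. Poly_Mapping.lookup c x *\<^sub>R b x)"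
  unfolding lin_ext_def using assms by (intro sum.mono_neutral_left) (auto simp: in_keys_iff)

lemma linear_lin_ext: "linear (lin_ext b)"
proof
  fix c d :: "'a \<Rightarrow>\<^sub>0 real" and r :: real
  let ?A = "Poly_Mapping.keys c \<union> Poly_Mapping.keys d"
  have "Poly_Mapping.keys (c + d) \<subseteq> ?A" "Poly_Mapping.keys (r *\<^sub>R c) \<subseteq> ?A"
    by (auto simp: in_keys_iff lookup_add lookup_scaleR)
  then show "lin_ext b (c + d) = lin_ext b c + lin_ext b d"
    and "lin_ext b (r *\<^sub>R c) = r *\<^sub>R lin_ext b c"
    by (simp_all add: lin_ext_superset[of ?A] lookup_add lookup_scaleR scaleR_add_left sum.distrib
        scaleR_sum_right)
qed

lemma lin_ext_basis_vec [simp]: "lin_ext b (basis_vec x) = b x"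
  by (simp add: lin_ext_def)

lemma lin_ext_cong: "(\<And>x. x \<in> Poly_Mapping.keys c \<Longrightarrow> b x = b' x) \<Longrightarrow> lin_ext b c = lin_ext b' c"
  by (simp add: lin_ext_def)

lemma lin_ext_zero_fun [simp]: "lin_ext (\<lambda>_. 0) c = 0"
  by (simp add: lin_ext_def)

lemma lin_ext_in_subspace:
  assumes "subspace S" "\<And>x. x \<in> Poly_Mapping.keys c \<Longrightarrow> b x \<in> S"
  shows "lin_ext b c \<in> S"
  unfolding lin_ext_def using assms by (intro subspace_sum subspace_scale)

lemma lin_on_lin_ext:
  assumes "lin_on S f" "subspace S" "\<And>x. x \<in> Poly_Mapping.keys c \<Longrightarrow> b x \<in> S"
  shows "f (lin_ext b c) = lin_ext (\<lambda>x. f (b x)) c"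
  unfolding lin_ext_def using assms
  by (subst lin_on_sum[OF assms(1,2)]) (auto intro: subspace_scale simp: lin_on_scale)

lemma lin_ext_id: "lin_ext basis_vec c = c"
proof (rule poly_mapping_eqI)
  fix x
  have "Poly_Mapping.lookup (lin_ext basis_vec c) x
      = (\<Sum>y\<in>Poly_Mapping.keys c. Poly_Mapping.lookup c y * (if y = x then 1 else 0))"
    by (simp add: lin_ext_def lookup_sum lookup_scaleR lookup_single when_def)
  also have "\<dots> = Poly_Mapping.lookup c x"
    by (simp add: if_distrib[of "\<lambda>z. _ * z"] in_keys_iff cong: if_cong)
  finally show "Poly_Mapping.lookup (lin_ext basis_vec c) x = Poly_Mapping.lookup c x" .
qed

lemma linear_lin_on: "linear f \<Longrightarrow> lin_on S f"
  by (simp add: lin_on_def linear_add linear_scale)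

text \<open>Together with \<open>lin_ext_cong\<close> this reduces an identity between composites of
  linear extensions to basis elements in the support.\<close>

lemma lin_ext_lin_ext: "lin_ext b (lin_ext b' c) = lin_ext (\<lambda>x. lin_ext b (b' x)) c"
  by (rule lin_on_lin_ext[of UNIV]) (auto intro: linear_lin_on linear_lin_ext)

lemma norm_poly_mapping_real:
  "norm c = (\<Sum>x\<in>Poly_Mapping.keys c. \<bar>Poly_Mapping.lookup c x\<bar>)" for c :: "'a \<Rightarrow>\<^sub>0 real"
  by (simp add: norm_poly_mapping_def dist_poly_mapping_def)

lemma norm_basis_vec [simp]: "norm (basis_vec x) = 1"
  by (simp add: norm_poly_mapping_real)

text \<open>With the l1-norm a bound on basis vectors is a bound for the whole linear extension. The
  norm estimates for the boundary, the action and the extended cochains all come from here.\<close>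

lemma lin_ext_bound:
  assumes "normed_space_on S N"
    and "\<And>x. x \<in> Poly_Mapping.keys c \<Longrightarrow> b x \<in> S" "\<And>x. x \<in> Poly_Mapping.keys c \<Longrightarrow> N (b x) \<le> M"
  shows "N (lin_ext b c) \<le> M * norm c"
proof -
  have "N (lin_ext b c) \<le> (\<Sum>x\<in>Poly_Mapping.keys c. N (Poly_Mapping.lookup c x *\<^sub>R b x))"
    unfolding lin_ext_def using assms(2)
    by (intro normed_space_sum[OF assms(1)] subspace_scale[OF normed_space_subspace[OF assms(1)]])
  also have "\<dots> = (\<Sum>x\<in>Poly_Mapping.keys c. \<bar>Poly_Mapping.lookup c x\<bar> * N (b x))"
    using assms(2) by (intro sum.cong) (simp_all add: normed_space_scale[OF assms(1)])
  also have "\<dots> \<le> (\<Sum>x\<in>Poly_Mapping.keys c. \<bar>Poly_Mapping.lookup c x\<bar> * M)"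
    using assms(3) by (intro sum_mono mult_left_mono) simp_all
  finally show ?thesis
    by (simp add: norm_poly_mapping_real sum_distrib_left mult.commute)
qed

lemma normed_space_on_UNIV: "normed_space_on UNIV (norm :: 'a::real_normed_vector \<Rightarrow> real)"
  by (simp add: normed_space_on_def norm_triangle_ineq)

lemma norm_lin_ext_le:
  fixes b :: "'a \<Rightarrow> 'b::real_normed_vector"
  assumes "\<And>x. x \<in> Poly_Mapping.keys c \<Longrightarrow> norm (b x) \<le> M"
  shows "norm (lin_ext b c) \<le> M * norm c"
  using assms by (intro lin_ext_bound[OF normed_space_on_UNIV]) auto

section \<open>The bar modules\<close>

lemma subspace_keys_subset: "subspace {c :: 'a \<Rightarrow>\<^sub>0 real. Poly_Mapping.keys c \<subseteq> A}"
  by (auto simp: subspace_def in_keys_iff lookup_add lookup_scaleR subset_iff) (metis add_0)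

lemma keys_lin_ext_subset:
  fixes b :: "'a \<Rightarrow> ('b \<Rightarrow>\<^sub>0 real)"
  assumes "\<And>x. x \<in> Poly_Mapping.keys c \<Longrightarrow> Poly_Mapping.keys (b x) \<subseteq> A"
  shows "Poly_Mapping.keys (lin_ext b c) \<subseteq> A"
  using lin_ext_in_subspace[OF subspace_keys_subset, of c b A] assms by simp

lemma bar_module_simps [simp]:
  "c \<in> car (bar_module G n) e \<longleftrightarrow> Poly_Mapping.keys c \<subseteq> bar_tuples G n e"
  "nrm (bar_module G n) e = norm"
  "act (bar_module G n) g = lin_ext (\<lambda>xs. basis_vec (comp G g (hd xs) # tl xs))"
  by (simp_all add: bar_module_def)

text \<open>
  Tuples with the first entry removed. Allowing the empty tail makes the formulas below uniform in
  the degree: \<^const>\<open>bar_boundary_basis\<close> maps \<open>[g]\<close> to the basis vector of \<open>[]\<close>, so in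
  degree \<open>0\<close> it is the augmentation.
\<close>

definition bar_tails :: "('o, 'g) groupoid_data \<Rightarrow> nat \<Rightarrow> 'o \<Rightarrow> 'g list set" where
  "bar_tails G n e = (case n of 0 \<Rightarrow> {[]} | Suc m \<Rightarrow> bar_tuples G m e)"

lemma bar_tails_simps [simp]: "bar_tails G 0 e = {[]}" "bar_tails G (Suc n) e = bar_tuples G n e"
  by (simp_all add: bar_tails_def)

text \<open>Turns the indexed composability condition into a recursion on the list: behind the first
  morphism stands a tuple based at its source, or nothing in degree 0.\<close>

lemma bar_tuples_Cons:
  "g # t \<in> bar_tuples G n e \<longleftrightarrow> g \<in> Mor G \<and> tgt G g = e \<and> t \<in> bar_tails G n (src G g)"
proof (cases n)
  case 0
  then show ?thesis
    by (auto simp: bar_tuples_def)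
next
  case (Suc m)
  show ?thesis
    unfolding Suc bar_tails_simps bar_tuples_def
    by (auto simp: nth_Cons less_Suc_eq_0_disj all_conj_distrib split: nat.splits)
qed

lemma bar_tuplesE:
  assumes "xs \<in> bar_tuples G n e"
  obtains g t where "xs = g # t" "g \<in> Mor G" "tgt G g = e" "t \<in> bar_tails G n (src G g)"
  using assms bar_tuples_Cons[of _ _ G n e] by (cases xs) (auto simp: bar_tuples_def)

text \<open>For an identity \<open>g\<close> this is the contracting homotopy of the bar complex.
  Other \<open>g\<close> are needed because removing the first entry leaves a boundary of the
  shorter tuple behind an arbitrary morphism.\<close>

definition bar_cons :: "'g \<Rightarrow> ('g list \<Rightarrow>\<^sub>0 real) \<Rightarrow> ('g list \<Rightarrow>\<^sub>0 real)" where
  "bar_cons g = lin_ext (\<lambda>t. basis_vec (g # t))"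

lemma linear_bar_cons: "linear (bar_cons g)"
  by (simp add: bar_cons_def linear_lin_ext)

lemma bar_cons_basis_vec [simp]: "bar_cons g (basis_vec t) = basis_vec (g # t)"
  by (simp add: bar_cons_def)

lemma keys_bar_cons:
  assumes "g \<in> Mor G" "Poly_Mapping.keys c \<subseteq> bar_tails G n (src G g)"
  shows "Poly_Mapping.keys (bar_cons g c) \<subseteq> bar_tuples G n (tgt G g)"
  unfolding bar_cons_def using assms by (intro keys_lin_ext_subset) (auto simp: bar_tuples_Cons)

lemma norm_bar_cons_le: "norm (bar_cons g c) \<le> norm c"
  using norm_lin_ext_le[of c "\<lambda>t. basis_vec (g # t)" 1] by (simp add: bar_cons_def)

section \<open>The bar boundary: recursion, equivariance, contraction\<close>

lemma bar_boundary_basis_vec [simp]: "bar_boundary G (basis_vec xs) = bar_boundary_basis G xs"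
  by (simp add: bar_boundary_def)

lemma linear_bar_boundary: "linear (bar_boundary G)"
  by (simp add: bar_boundary_def linear_lin_ext)

lemma bar_boundary_basis_single: "bar_boundary_basis G [g] = basis_vec []"
  by (simp add: bar_boundary_basis_def)

text \<open>Only the face of index 0 involves \<open>g\<close>, by composing it with
  \<open>h\<close>. All other faces keep \<open>g\<close> in front and are the faces of
  \<open>h # t\<close> with the index shifted by one, which accounts for the minus sign.\<close>

lemma bar_boundary_basis_Cons:
  "bar_boundary_basis G (g # h # t) = basis_vec (comp G g h # t) - bar_cons g (bar_boundary_basis G (h # t))"
proof -
  interpret b: linear "bar_cons g"
    by (rule linear_bar_cons)
  show ?thesis
    by (simp del: sum.lessThan_Suc add: bar_boundary_basis_def Let_def sum.lessThan_Suc_shift b.add b.sum b.scaleR sum_negf)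
qed

context groupoid_on
begin

lemma keys_bar_boundary_basis:
  "xs \<in> bar_tuples G n e \<Longrightarrow> Poly_Mapping.keys (bar_boundary_basis G xs) \<subseteq> bar_tails G n e"
proof (induction n arbitrary: xs e)
  case 0
  then show ?case
    by (auto elim!: bar_tuplesE simp: bar_boundary_basis_single)
next
  case (Suc n)
  then obtain g h t where xs: "xs = g # h # t" and g: "g \<in> Mor G" "tgt G g = e"
    and h: "h \<in> Mor G" "tgt G h = src G g" and t: "t \<in> bar_tails G n (src G h)"
    by (auto elim!: bar_tuplesE)
  have "Poly_Mapping.keys (bar_boundary_basis G (h # t)) \<subseteq> bar_tails G n (src G g)"
    by (rule Suc.IH) (simp add: bar_tuples_Cons h t)
  then have "Poly_Mapping.keys (bar_cons g (bar_boundary_basis G (h # t))) \<subseteq> bar_tuples G n e"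
    using keys_bar_cons[OF g(1)] g(2) by blast
  moreover have "Poly_Mapping.keys (basis_vec (comp G g h # t) :: 'g list \<Rightarrow>\<^sub>0 real) \<subseteq> bar_tuples G n e"
    using g h t by (simp add: bar_tuples_Cons groupoid_simps)
  ultimately show ?case
    using subspace_diff[OF subspace_keys_subset, of _ "bar_tuples G n e"]
    by (simp add: xs bar_boundary_basis_Cons)
qed

text \<open>A nonempty tuple has as many faces as entries; the extra 1 makes the estimate hold for
  the empty list as well, whose formal boundary is the basis vector of \<open>[]\<close>.\<close>

lemma norm_bar_boundary_basis_le: "norm (bar_boundary_basis G xs) \<le> real (length xs) + 1"
proof (induction xs rule: induct_list012)
  case 1
  then show ?case by (simp add: bar_boundary_basis_def)
next
  case (2 x)
  then show ?case by (simp add: bar_boundary_basis_single)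
next
  case (3 x y zs)
  then show ?case
    using norm_triangle_ineq4[of "basis_vec (comp G x y # zs)" "bar_cons x (bar_boundary_basis G (y # zs))"]
      norm_bar_cons_le[of x "bar_boundary_basis G (y # zs)"]
    by (simp add: bar_boundary_basis_Cons)
qed

lemma bar_boundary_in_car:
  assumes "Poly_Mapping.keys c \<subseteq> bar_tuples G n e"
  shows "Poly_Mapping.keys (bar_boundary G c) \<subseteq> bar_tails G n e"
  unfolding bar_boundary_def using assms keys_bar_boundary_basis by (intro keys_lin_ext_subset) blast

lemma norm_bar_boundary_le:
  assumes "Poly_Mapping.keys c \<subseteq> bar_tuples G n e"
  shows "norm (bar_boundary G c) \<le> (real n + 2) * norm c"
  unfolding bar_boundary_def
proof (rule norm_lin_ext_le)
  fix xs assume "xs \<in> Poly_Mapping.keys c"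
  then have "length xs = Suc n"
    using assms by (auto simp: bar_tuples_def)
  then show "norm (bar_boundary_basis G xs) \<le> real n + 2"
    using norm_bar_boundary_basis_le[of xs] by simp
qed

lemma act_bar_cons: "act (bar_module G n) k (bar_cons g c) = bar_cons (comp G k g) c"
  by (simp add: bar_cons_def lin_ext_lin_ext)

lemma linear_act_bar: "linear (act (bar_module G n) k)"
  by (simp add: linear_lin_ext)

text \<open>The action changes the first entry only, so the one face to check is the composite of
  the first two entries, where associativity applies. The degree is positive because the formula for
  the action has no meaning on the empty tail.\<close>

lemma bar_boundary_act:
  assumes "k \<in> Mor G" "Poly_Mapping.keys c \<subseteq> bar_tuples G (Suc n) (src G k)"
  shows "bar_boundary G (act (bar_module G (Suc n)) k c) = act (bar_module G n) k (bar_boundary G c)"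
proof -
  interpret k: linear "act (bar_module G n) k"
    by (rule linear_act_bar)
  have "bar_boundary_basis G (comp G k (hd xs) # tl xs)
      = act (bar_module G n) k (bar_boundary_basis G xs)" if "xs \<in> Poly_Mapping.keys c" for xs
  proof -
    have "xs \<in> bar_tuples G (Suc n) (src G k)"
      using that assms(2) by blast
    then obtain g h t where xs: "xs = g # h # t" and g: "g \<in> Mor G" "tgt G g = src G k"
      and h: "h \<in> Mor G" "tgt G h = src G g"
      by (auto elim!: bar_tuplesE)
    show ?thesis
      using assms(1) g h comp_assoc[of k g h]
      by (simp add: xs bar_boundary_basis_Cons k.diff act_bar_cons del: bar_module_simps(3))
        simp
  qed
  then show ?thesis
    by (simp add: bar_boundary_def lin_ext_lin_ext cong: lin_ext_cong)
qed

text \<open>The homotopy formula \<open>\<partial> h + h \<partial> = id\<close>: the first face of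
  \<open>ident G e # xs\<close> composes the identity into \<open>xs\<close> and gives back
  \<open>xs\<close>. Degree 0 is included, with the augmentation in place of the boundary.\<close>

lemma bar_boundary_cons_ident:
  assumes "e \<in> Ob G" "Poly_Mapping.keys c \<subseteq> bar_tuples G n e"
  shows "bar_boundary G (bar_cons (ident G e) c) = c - bar_cons (ident G e) (bar_boundary G c)"
proof -
  interpret b: linear "bar_cons (ident G e)"
    by (rule linear_bar_cons)
  have *: "lin_ext f c - lin_ext f' c = lin_ext (\<lambda>x. f x - f' x) c" for f f' :: "'g list \<Rightarrow> ('g list \<Rightarrow>\<^sub>0 real)"
    by (simp add: lin_ext_def scaleR_diff_right sum_subtractf)
  have "bar_boundary_basis G (ident G e # xs)
      = basis_vec xs - bar_cons (ident G e) (bar_boundary_basis G xs)" if "xs \<in> Poly_Mapping.keys c" for xs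
  proof -
    have "xs \<in> bar_tuples G n e"
      using that assms(2) by blast
    then obtain g t where "xs = g # t" "g \<in> Mor G" "tgt G g = e"
      by (rule bar_tuplesE)
    then show ?thesis
      using comp_ident_left[of g] by (simp add: bar_boundary_basis_Cons)
  qed
  then have "bar_boundary G (bar_cons (ident G e) c)
      = lin_ext (\<lambda>xs. basis_vec xs - bar_cons (ident G e) (bar_boundary_basis G xs)) c"
    by (simp add: bar_boundary_def bar_cons_def[of "ident G e"] lin_ext_lin_ext cong: lin_ext_cong)
  also have "\<dots> = c - bar_cons (ident G e) (bar_boundary G c)"
    by (simp flip: * add: lin_ext_id)
      (simp add: bar_boundary_def bar_cons_def lin_ext_lin_ext)
  finally show ?thesis .
qed

text \<open>The contraction replaces the usual cancellation in a double sum. By equivariance the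
  tuple may be taken to start with an identity, so that it is of the form \<open>h t\<close>, and
  the homotopy formula applied twice gives
  \<open>\<partial> \<partial> h t = h \<partial> \<partial> t\<close>, which is 0 by
  induction.\<close>

lemma bar_boundary_boundary_basis:
  "xs \<in> bar_tuples G (Suc n) e \<Longrightarrow> bar_boundary G (bar_boundary_basis G xs) = 0"
proof (induction n arbitrary: xs e)
  interpret d: linear "bar_boundary G"
    by (rule linear_bar_boundary)
  {
    case 0
    then obtain g h where "xs = [g, h]"
      by (auto elim!: bar_tuplesE)
    then show ?case
      by (simp add: bar_boundary_basis_Cons bar_boundary_basis_single d.diff)
  next
    case (Suc n)
    then obtain g t where xs: "xs = g # t" and g: "g \<in> Mor G" and t: "t \<in> bar_tuples G (Suc n) (src G g)"
      by (auto elim!: bar_tuplesE simp del: bar_tails_simps(1))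
    let ?i = "ident G (src G g)"
    note s = src_in_Ob[OF g]
    have it: "?i # t \<in> bar_tuples G (Suc (Suc n)) (src G g)"
      using t s by (simp add: bar_tuples_Cons groupoid_simps)
    \<comment> \<open>The tuple \<open>g # t\<close> is the translate by \<open>g\<close> of the
      tuple \<open>t\<close> prefixed with the identity at the source of \<open>g\<close>.\<close>
    have "bar_boundary_basis G xs = bar_boundary G (act (bar_module G (Suc (Suc n))) g (basis_vec (?i # t)))"
      using g by (simp add: xs comp_ident_right)
    also have "\<dots> = act (bar_module G (Suc n)) g (bar_boundary_basis G (?i # t))"
      using it by (subst bar_boundary_act[OF g]) simp_all
    finally have "bar_boundary G (bar_boundary_basis G xs)
        = act (bar_module G n) g (bar_boundary G (bar_boundary_basis G (?i # t)))"
      using bar_boundary_act[OF g, of "bar_boundary_basis G (?i # t)" n] keys_bar_boundary_basis[OF it] by simp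
    also have "bar_boundary_basis G (?i # t) = basis_vec t - bar_cons ?i (bar_boundary_basis G t)"
      using bar_boundary_cons_ident[OF s, of "basis_vec t" "Suc n"] t by simp
    also have "bar_boundary G \<dots> = bar_cons ?i (bar_boundary G (bar_boundary_basis G t))"
      using bar_boundary_cons_ident[OF s, of "bar_boundary_basis G t" n] keys_bar_boundary_basis[OF t]
      by (simp add: d.diff)
    also have "\<dots> = 0"
      by (simp add: Suc.IH[OF t] linear_0[OF linear_bar_cons])
    finally show ?case
      by (simp add: linear_0[OF linear_lin_ext])
  }
qed

lemma bar_boundary_boundary:
  assumes "Poly_Mapping.keys c \<subseteq> bar_tuples G (Suc n) e"
  shows "bar_boundary G (bar_boundary G c) = 0"
proof -
  have "bar_boundary G (bar_boundary G c) = lin_ext (\<lambda>xs. bar_boundary G (bar_boundary_basis G xs)) c"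
    by (simp add: bar_boundary_def[of G] lin_ext_lin_ext)
  also have "\<dots> = lin_ext (\<lambda>_. 0) c"
    using assms bar_boundary_boundary_basis by (intro lin_ext_cong) blast
  finally show ?thesis
    by simp
qed

lemma normed_bar_module: "normed_gmodule G (bar_module G n)"
proof -
  have in_car: "Poly_Mapping.keys (act (bar_module G n) g c) \<subseteq> bar_tuples G n (tgt G g)"
    if g: "g \<in> Mor G" and c: "Poly_Mapping.keys c \<subseteq> bar_tuples G n (src G g)" for g c
  proof -
    have "Poly_Mapping.keys (basis_vec (comp G g (hd xs) # tl xs) :: 'g list \<Rightarrow>\<^sub>0 real) \<subseteq> bar_tuples G n (tgt G g)"
      if "xs \<in> Poly_Mapping.keys c" for xs
    proof -
      have "xs \<in> bar_tuples G n (src G g)"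
        using that c by blast
      then show ?thesis
        using g by (auto elim!: bar_tuplesE simp: bar_tuples_Cons groupoid_simps)
    qed
    then show ?thesis
      unfolding bar_module_simps by (rule keys_lin_ext_subset)
  qed
  have comp: "act (bar_module G n) g (act (bar_module G n) h c) = act (bar_module G n) (comp G g h) c"
    if "g \<in> Mor G" "h \<in> Mor G" "src G g = tgt G h" "Poly_Mapping.keys c \<subseteq> bar_tuples G n (src G h)" for g h c
  proof -
    have "comp G g (comp G h (hd xs)) = comp G (comp G g h) (hd xs)" if "xs \<in> Poly_Mapping.keys c" for xs
    proof -
      have "xs \<in> bar_tuples G n (src G h)"
        using that \<open>Poly_Mapping.keys c \<subseteq> _\<close> by blast
      then show ?thesis
        using \<open>g \<in> Mor G\<close> \<open>h \<in> Mor G\<close> \<open>src G g = tgt G h\<close> comp_assoc[of g h "hd xs"]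
        by (auto elim!: bar_tuplesE)
    qed
    then show ?thesis
      by (simp add: lin_ext_lin_ext cong: lin_ext_cong)
  qed
  have id: "act (bar_module G n) (ident G e) c = c"
    if "e \<in> Ob G" "Poly_Mapping.keys c \<subseteq> bar_tuples G n e" for e c
  proof -
    have "comp G (ident G e) (hd xs) # tl xs = xs" if "xs \<in> Poly_Mapping.keys c" for xs
    proof -
      have "xs \<in> bar_tuples G n e"
        using that \<open>Poly_Mapping.keys c \<subseteq> _\<close> by blast
      then show ?thesis
        by (auto elim!: bar_tuplesE simp: comp_ident_left)
    qed
    then have "act (bar_module G n) (ident G e) c = lin_ext basis_vec c"
      unfolding bar_module_simps by (intro lin_ext_cong) simp
    then show ?thesis
      by (simp only: lin_ext_id)
  qed
  \<comment> \<open>This half holds for every \<open>g\<close>, since basis vectors go to basis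
    vectors. Applied to the inverse morphism it gives the other half, so that the action is
    isometric.\<close>
  have le: "norm (act (bar_module G n) g c) \<le> norm c" for g c
    using norm_lin_ext_le[of c "\<lambda>xs. basis_vec (comp G g (hd xs) # tl xs)" 1] by simp
  have eq: "norm (act (bar_module G n) g c) = norm c"
    if g: "g \<in> Mor G" and c: "Poly_Mapping.keys c \<subseteq> bar_tuples G n (src G g)" for g c
  proof -
    have "c = act (bar_module G n) (ginv G g) (act (bar_module G n) g c)"
      using g c by (subst comp) (simp_all del: bar_module_simps(3) add: groupoid_simps comp_ginv_left id)
    then have "norm c \<le> norm (act (bar_module G n) g c)"
      by (metis le)
    then show ?thesis
      using le[of g c] by simp
  qed
  have "normed_space_on {c :: 'g list \<Rightarrow>\<^sub>0 real. Poly_Mapping.keys c \<subseteq> bar_tuples G n e} norm" for e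
    using subspace_keys_subset[of "bar_tuples G n e"] by (auto simp: normed_space_on_def norm_triangle_ineq)
  then have "normed_space_on (car (bar_module G n) e) norm" for e
    by (simp add: bar_module_def)
  then show ?thesis
    unfolding normed_gmodule_def using in_car comp id eq
    by (simp del: bar_module_simps(3) add: linear_lin_on linear_act_bar)
qed

end

section \<open>Modules of bounded linear maps\<close>

context groupoid_on
begin

lemma hom_module_car:
  "f \<in> car (hom_module G X V) e \<longleftrightarrow>
    bounded_linear_betw (car X e) (nrm X e) (car V e) (nrm V e) f \<and> (\<forall>x. x \<notin> car X e \<longrightarrow> f x = 0)"
  by (simp add: hom_module_def)

lemma hom_act: "act (hom_module G X V) g f v =
    (if v \<in> car X (tgt G g) then act V g (f (act X (ginv G g) v)) else 0)"
  by (simp add: hom_module_def)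

lemma hom_lin_on: "f \<in> car (hom_module G X V) e \<Longrightarrow> lin_on (car X e) f"
  and hom_in: "f \<in> car (hom_module G X V) e \<Longrightarrow> x \<in> car X e \<Longrightarrow> f x \<in> car V e"
  and hom_outside: "f \<in> car (hom_module G X V) e \<Longrightarrow> x \<notin> car X e \<Longrightarrow> f x = 0"
  by (auto simp: hom_module_car bounded_linear_betw_def)

lemma hom_eqI:
  assumes "f \<in> car (hom_module G X V) e" "h \<in> car (hom_module G X V) e"
    and "\<And>x. x \<in> car X e \<Longrightarrow> f x = h x"
  shows "f = h"
proof
  show "f x = h x" for x
    using assms by (metis hom_outside)
qed

context
  fixes X :: "('o, 'g, 'x::real_vector) gmodule" and V :: "('o, 'g, 'v::real_vector) gmodule"
  assumes X: "normed_gmodule G X" and V: "normed_gmodule G V"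
begin

lemma hom_bound:
  assumes "f \<in> car (hom_module G X V) e" "e \<in> Ob G" "x \<in> car X e"
  shows "nrm V e (f x) \<le> nrm (hom_module G X V) e f * nrm X e x"
  using assms op_norm_bound[OF gmodule_normed_space[OF X] gmodule_normed_space[OF V]]
  by (simp add: hom_module_def)

lemma hom_memI:
  assumes "e \<in> Ob G" "lin_on (car X e) f" "\<And>x. x \<in> car X e \<Longrightarrow> f x \<in> car V e"
    and "\<And>x. x \<in> car X e \<Longrightarrow> nrm V e (f x) \<le> K * nrm X e x" "\<And>x. x \<notin> car X e \<Longrightarrow> f x = 0"
  shows "f \<in> car (hom_module G X V) e"
  unfolding hom_module_car bounded_linear_betw_def using assms by blast

lemma hom_nrm_le:
  assumes "e \<in> Ob G" "0 \<le> K" "\<And>x. x \<in> car X e \<Longrightarrow> nrm V e (f x) \<le> K * nrm X e x"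
  shows "nrm (hom_module G X V) e f \<le> K"
  using assms by (simp add: hom_module_def op_norm_le[OF gmodule_normed_space[OF X]])

lemma hom_nrm_nonneg:
  "f \<in> car (hom_module G X V) e \<Longrightarrow> e \<in> Ob G \<Longrightarrow> 0 \<le> nrm (hom_module G X V) e f"
  using op_norm_nonneg[OF gmodule_normed_space[OF X, of e], of "car V e" "nrm V e" f]
  by (simp add: hom_module_def)

lemma normed_space_hom:
  assumes e: "e \<in> Ob G"
  shows "normed_space_on (car (hom_module G X V) e) (nrm (hom_module G X V) e)"
proof -
  let ?H = "hom_module G X V"
  note nX = gmodule_normed_space[OF X e] and nV = gmodule_normed_space[OF V e]
  note subX = normed_space_subspace[OF nX] and subV = normed_space_subspace[OF nV]
  have add: "f + h \<in> car ?H e \<and> nrm ?H e (f + h) \<le> nrm ?H e f + nrm ?H e h"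
    if f: "f \<in> car ?H e" and h: "h \<in> car ?H e" for f h
  proof -
    have *: "nrm V e ((f + h) x) \<le> (nrm ?H e f + nrm ?H e h) * nrm X e x" if "x \<in> car X e" for x
      using normed_space_triangle[OF nV hom_in[OF f that] hom_in[OF h that]]
        hom_bound[OF f e that] hom_bound[OF h e that] by (simp add: algebra_simps)
    have "lin_on (car X e) (f + h)"
      using hom_lin_on[OF f] hom_lin_on[OF h] by (simp add: lin_on_def algebra_simps)
    then have "f + h \<in> car ?H e"
      using * hom_in[OF f] hom_in[OF h] hom_outside[OF f] hom_outside[OF h] subspace_add[OF subV]
      by (intro hom_memI[OF e]) auto
    moreover have "nrm ?H e (f + h) \<le> nrm ?H e f + nrm ?H e h"
      using * hom_nrm_nonneg[OF f e] hom_nrm_nonneg[OF h e] by (intro hom_nrm_le[OF e]) auto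
    ultimately show ?thesis
      by blast
  qed
  have scale_le: "c *\<^sub>R f \<in> car ?H e \<and> nrm ?H e (c *\<^sub>R f) \<le> \<bar>c\<bar> * nrm ?H e f"
    if f: "f \<in> car ?H e" for c f
  proof -
    have *: "nrm V e ((c *\<^sub>R f) x) \<le> (\<bar>c\<bar> * nrm ?H e f) * nrm X e x" if "x \<in> car X e" for x
      using normed_space_scale[OF nV hom_in[OF f that], of c]
        mult_left_mono[OF hom_bound[OF f e that], of "\<bar>c\<bar>"] by (simp add: scaleR_fun_def mult.assoc)
    have "lin_on (car X e) (c *\<^sub>R f)"
      using hom_lin_on[OF f] by (simp add: lin_on_def scaleR_fun_def algebra_simps)
    then have "c *\<^sub>R f \<in> car ?H e"
      using * hom_in[OF f] hom_outside[OF f] subspace_scale[OF subV]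
      by (intro hom_memI[OF e]) (auto simp: scaleR_fun_def)
    moreover have "nrm ?H e (c *\<^sub>R f) \<le> \<bar>c\<bar> * nrm ?H e f"
      using * hom_nrm_nonneg[OF f e] by (intro hom_nrm_le[OF e]) auto
    ultimately show ?thesis
      by blast
  qed
  \<comment> \<open>For \<open>c \<noteq> 0\<close> the missing inequality is
    \<open>scale_le\<close> for \<open>1 / c\<close> applied to
    \<open>c *\<^sub>R f\<close>.\<close>
  have scale: "nrm ?H e (c *\<^sub>R f) = \<bar>c\<bar> * nrm ?H e f" if f: "f \<in> car ?H e" for c f
  proof (cases "c = 0")
    case True
    then show ?thesis
      using scale_le[OF f, of 0] hom_nrm_nonneg[OF _ e, of "0 *\<^sub>R f"] by simp
  next
    case False
    then show ?thesis
      using scale_le[OF f, of c] scale_le[of "c *\<^sub>R f" "1 / c"] by (simp add: field_simps)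
  qed
  have zero: "0 \<in> car ?H e"
    by (rule hom_memI[OF e, where K = 0]) (use normed_space_0[OF nV] in \<open>auto simp: lin_on_def\<close>)
  have "f = 0" if f: "f \<in> car ?H e" and "nrm ?H e f = 0" for f
  proof (rule hom_eqI[OF f zero])
    fix x assume x: "x \<in> car X e"
    show "f x = 0 x"
      using hom_bound[OF f e x] that(2) normed_space_nonneg[OF nV hom_in[OF f x]]
        normed_space_eq_0[OF nV hom_in[OF f x]] by simp
  qed
  moreover have "nrm ?H e 0 = 0"
    using scale[OF zero, of 0] by simp
  moreover have "subspace (car ?H e)"
    unfolding subspace_def using zero add scale_le by blast
  ultimately show ?thesis
    unfolding normed_space_on_def using add scale hom_nrm_nonneg[OF _ e] by blast
qed

text \<open>The operator norm does not grow because \<open>g\<close> acts isometrically on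
  \<open>V\<close> and its inverse acts isometrically on \<open>X\<close>. The inverse morphism
  later turns the inequality into an equality.\<close>

lemma hom_act_in_car:
  assumes g: "g \<in> Mor G" and f: "f \<in> car (hom_module G X V) (src G g)"
  shows "act (hom_module G X V) g f \<in> car (hom_module G X V) (tgt G g)"
    and "nrm (hom_module G X V) (tgt G g) (act (hom_module G X V) g f) \<le> nrm (hom_module G X V) (src G g) f"
proof -
  let ?H = "hom_module G X V"
  note s = src_in_Ob[OF g] and t = tgt_in_Ob[OF g]
  have *: "nrm V (tgt G g) (act ?H g f x) \<le> nrm ?H (src G g) f * nrm X (tgt G g) x"
    if x: "x \<in> car X (tgt G g)" for x
    using hom_bound[OF f s act_ginv_in_car[OF X g x]] nrm_act_ginv[OF X g x]
      nrm_act[OF V g hom_in[OF f act_ginv_in_car[OF X g x]]] x by (simp add: hom_act)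
  then show "nrm ?H (tgt G g) (act ?H g f) \<le> nrm ?H (src G g) f"
    by (intro hom_nrm_le[OF t] hom_nrm_nonneg[OF f s])
  have "lin_on (car X (tgt G g)) (act X (ginv G g))"
    using act_lin_on[OF X ginv_in_Mor[OF g]] g by (simp add: groupoid_simps)
  then have "lin_on (car X (tgt G g)) (\<lambda>x. f (act X (ginv G g) x))"
    using act_ginv_in_car[OF X g] by (rule lin_on_compose[OF _ _ hom_lin_on[OF f]])
  then have "lin_on (car X (tgt G g)) (\<lambda>x. act V g (f (act X (ginv G g) x)))"
    using hom_in[OF f act_ginv_in_car[OF X g]] by (rule lin_on_compose[OF _ _ act_lin_on[OF V g]])
  then have "lin_on (car X (tgt G g)) (act ?H g f)"
    using subspace_add[OF gmodule_subspace[OF X t]] subspace_scale[OF gmodule_subspace[OF X t]]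
    by (simp add: lin_on_def hom_act)
  then show "act ?H g f \<in> car ?H (tgt G g)"
    using * hom_in[OF f act_ginv_in_car[OF X g]] act_in_car[OF V g]
    by (intro hom_memI[OF t]) (auto simp: hom_act)
qed

lemma normed_hom_module: "normed_gmodule G (hom_module G X V)"
proof -
  let ?H = "hom_module G X V"
  have lin: "lin_on (car ?H (src G g)) (act ?H g)" if g: "g \<in> Mor G" for g
    unfolding lin_on_def
  proof (intro conjI ballI allI)
    fix f h assume f: "f \<in> car ?H (src G g)" and h: "h \<in> car ?H (src G g)"
    show "act ?H g (f + h) = act ?H g f + act ?H g h"
      using lin_on_add[OF act_lin_on[OF V g] hom_in[OF f] hom_in[OF h]] act_ginv_in_car[OF X g]
      by (auto simp: fun_eq_iff hom_act)
  next
    fix c f assume f: "f \<in> car ?H (src G g)"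
    show "act ?H g (c *\<^sub>R f) = c *\<^sub>R act ?H g f"
      using lin_on_scale[OF act_lin_on[OF V g] hom_in[OF f]] act_ginv_in_car[OF X g]
      by (auto simp: fun_eq_iff hom_act scaleR_fun_def)
  qed
  have comp: "act ?H g (act ?H h f) = act ?H (comp G g h) f"
    if g: "g \<in> Mor G" and h: "h \<in> Mor G" and gh: "src G g = tgt G h" and f: "f \<in> car ?H (src G h)" for g h f
  proof
    fix x
    have c: "comp G g h \<in> Mor G" "src G (comp G g h) = src G h" "tgt G (comp G g h) = tgt G g"
      using g h gh by (simp_all add: groupoid_simps)
    show "act ?H g (act ?H h f) x = act ?H (comp G g h) f x"
    proof (cases "x \<in> car X (tgt G g)")
      case True
      \<comment> \<open>That the inverse of a composite is the reversed composite of inverses is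
        verified on vectors: \<open>g (h ?y) = x\<close>, and undoing \<open>g\<close> and then
        \<open>h\<close> returns \<open>?y\<close>.\<close>
      let ?y = "act X (ginv G (comp G g h)) x"
      have y: "?y \<in> car X (src G h)"
        using act_ginv_in_car[OF X c(1)] True by (simp add: c)
      have "act X h ?y = act X (ginv G g) (act X g (act X h ?y))"
        using act_ginv_act[OF X g, of "act X h ?y"] act_in_car[OF X h y] gh by simp
      also have "\<dots> = act X (ginv G g) x"
        using act_act[OF X g h gh y] act_act_ginv[OF X c(1)] True by (simp add: c)
      finally have "act X (ginv G h) (act X (ginv G g) x) = ?y"
        using act_ginv_act[OF X h y] by simp
      then show ?thesis
        using True act_ginv_in_car[OF X g] act_act[OF V g h gh hom_in[OF f y]] gh
        by (simp add: hom_act c)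
    qed (simp add: hom_act c)
  qed
  have ident: "act ?H (ident G e) f = f" if e: "e \<in> Ob G" and f: "f \<in> car ?H e" for e f
  proof
    fix x
    show "act ?H (ident G e) f x = f x"
    proof (cases "x \<in> car X e")
      case True
      then have "act X (ginv G (ident G e)) x = x"
        using act_ginv_act[OF X ident_in_Mor[OF e], of x] e act_ident[OF X e] by (simp add: groupoid_simps)
      then show ?thesis
        using True act_ident[OF V e hom_in[OF f True]] e by (simp add: hom_act groupoid_simps)
    qed (use e hom_outside[OF f] in \<open>simp add: hom_act groupoid_simps\<close>)
  qed
  have nrm: "nrm ?H (tgt G g) (act ?H g f) = nrm ?H (src G g) f"
    if g: "g \<in> Mor G" and f: "f \<in> car ?H (src G g)" for g f
  proof (rule antisym)
    have "act ?H (ginv G g) (act ?H g f) = f"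
      using comp[OF ginv_in_Mor[OF g] g _ f] ident[OF src_in_Ob[OF g] f] g
      by (simp add: groupoid_simps comp_ginv_left)
    then show "nrm ?H (src G g) f \<le> nrm ?H (tgt G g) (act ?H g f)"
      using hom_act_in_car(2)[OF ginv_in_Mor[OF g], of "act ?H g f"] hom_act_in_car(1)[OF g f] g
      by (simp add: groupoid_simps)
  qed (rule hom_act_in_car(2)[OF g f])
  show ?thesis
    unfolding normed_gmodule_def
    using normed_space_hom lin hom_act_in_car(1) nrm comp ident by blast
qed

lemma banach_hom_module:
  assumes "banach_gmodule G V"
  shows "banach_gmodule G (hom_module G X V)"
  unfolding banach_gmodule_def
proof (intro conjI ballI normed_hom_module)
  fix e assume e: "e \<in> Ob G"
  then have "complete_on (car V e) (nrm V e)"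
    using assms by (simp add: banach_gmodule_def)
  then show "complete_on (car (hom_module G X V) e) (nrm (hom_module G X V) e)"
    using complete_on_bounded_linear[OF gmodule_normed_space[OF X e] gmodule_normed_space[OF V e]]
    by (simp add: hom_module_def)
qed

end

end

section \<open>The standard resolution\<close>

context groupoid_on
begin

lemma lin_on_bar_expand:
  assumes "lin_on (car (bar_module G n) e) f" "c \<in> car (bar_module G n) e"
  shows "f c = lin_ext (\<lambda>xs. f (basis_vec xs)) c"
proof -
  have "subspace (car (bar_module G n) e)"
    using subspace_keys_subset by (simp add: bar_module_def)
  then have "f (lin_ext basis_vec c) = lin_ext (\<lambda>xs. f (basis_vec xs)) c"
    using assms by (intro lin_on_lin_ext[OF assms(1)]) auto
  then show ?thesis
    by (simp add: lin_ext_id)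
qed

text \<open>
  A \<open>G\<close>-map \<open>Y \<rightarrow> B(C\<^sub>n(G), V)\<close> is determined by its values \<open>k\<close> on the tuples
  \<open>(id, g\<^sub>1, \<dots>, g\<^sub>n)\<close>, which can be prescribed arbitrarily.
\<close>

definition std_extension ::
  "('o, 'g, 'y) gmodule \<Rightarrow> ('o, 'g, 'v::real_vector) gmodule \<Rightarrow> nat \<Rightarrow>
   ('o \<Rightarrow> 'y \<Rightarrow> 'g list \<Rightarrow> 'v) \<Rightarrow> 'o \<Rightarrow> 'y \<Rightarrow> ('g list \<Rightarrow>\<^sub>0 real) \<Rightarrow> 'v" where
  "std_extension Y V n k e y = (\<lambda>c. if c \<in> car (bar_module G n) e
     then lin_ext (\<lambda>xs. act V (hd xs) (k (src G (hd xs)) (act Y (ginv G (hd xs)) y) (tl xs))) c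
     else 0)"

lemma banach_std_module: "banach_gmodule G V \<Longrightarrow> banach_gmodule G (std_module G V n)"
  unfolding std_module_def by (rule banach_hom_module[OF normed_bar_module banach_imp_normed])

context
  fixes V :: "('o, 'g, 'v::real_vector) gmodule"
  assumes V: "normed_gmodule G V"
begin

lemma normed_std_module: "normed_gmodule G (std_module G V n)"
  unfolding std_module_def by (rule normed_hom_module[OF normed_bar_module V])

lemma std_lin_on: "f \<in> car (std_module G V n) e \<Longrightarrow> lin_on (car (bar_module G n) e) f"
  and std_in: "f \<in> car (std_module G V n) e \<Longrightarrow> Poly_Mapping.keys c \<subseteq> bar_tuples G n e \<Longrightarrow> f c \<in> car V e"
  and std_outside: "f \<in> car (std_module G V n) e \<Longrightarrow> \<not> Poly_Mapping.keys c \<subseteq> bar_tuples G n e \<Longrightarrow> f c = 0"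
  using hom_lin_on[of f "bar_module G n" V e] hom_in[of f "bar_module G n" V e c]
    hom_outside[of f "bar_module G n" V e c]
  by (simp_all add: std_module_def)

lemma subspace_bar: "subspace (car (bar_module G n) e)"
  using subspace_keys_subset by (simp add: bar_module_def)

lemma std_diff:
  "f \<in> car (std_module G V n) e \<Longrightarrow> Poly_Mapping.keys c \<subseteq> bar_tuples G n e \<Longrightarrow>
    Poly_Mapping.keys d \<subseteq> bar_tuples G n e \<Longrightarrow> f (c - d) = f c - f d"
  using lin_on_diff[OF std_lin_on subspace_bar] by simp

lemma std_zero: "f \<in> car (std_module G V n) e \<Longrightarrow> f 0 = 0"
  using lin_on_zero[OF std_lin_on subspace_bar] .

lemma std_lin_ext:
  "f \<in> car (std_module G V n) e \<Longrightarrow>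
    (\<And>x. x \<in> Poly_Mapping.keys c \<Longrightarrow> Poly_Mapping.keys (b x) \<subseteq> bar_tuples G n e) \<Longrightarrow>
    f (lin_ext b c) = lin_ext (\<lambda>x. f (b x)) c"
  using lin_on_lin_ext[OF std_lin_on subspace_bar, of f n e c b] by simp

lemma std_memI:
  assumes "e \<in> Ob G" "lin_on (car (bar_module G n) e) f"
    and "\<And>c. Poly_Mapping.keys c \<subseteq> bar_tuples G n e \<Longrightarrow> f c \<in> car V e"
    and "\<And>c. Poly_Mapping.keys c \<subseteq> bar_tuples G n e \<Longrightarrow> nrm V e (f c) \<le> K * norm c"
    and "\<And>c. \<not> Poly_Mapping.keys c \<subseteq> bar_tuples G n e \<Longrightarrow> f c = 0"
  shows "f \<in> car (std_module G V n) e"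
  unfolding std_module_def using assms
  by (intro hom_memI[OF normed_bar_module V]) auto

lemma std_bound:
  assumes "f \<in> car (std_module G V n) e" "e \<in> Ob G" "Poly_Mapping.keys c \<subseteq> bar_tuples G n e"
  shows "nrm V e (f c) \<le> nrm (std_module G V n) e f * norm c"
  using hom_bound[OF normed_bar_module V, of f n e c] assms by (simp add: std_module_def)

lemma std_nrm_le:
  assumes "e \<in> Ob G" "0 \<le> K"
    and "\<And>c. Poly_Mapping.keys c \<subseteq> bar_tuples G n e \<Longrightarrow> nrm V e (f c) \<le> K * norm c"
  shows "nrm (std_module G V n) e f \<le> K"
  using hom_nrm_le[OF normed_bar_module V, of e K n f] assms by (simp add: std_module_def)

lemma std_nrm_nonneg:
  "f \<in> car (std_module G V n) e \<Longrightarrow> e \<in> Ob G \<Longrightarrow> 0 \<le> nrm (std_module G V n) e f"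
  using normed_space_nonneg[OF gmodule_normed_space[OF normed_std_module]] .

lemma std_eqI:
  assumes "f \<in> car (std_module G V n) e" "h \<in> car (std_module G V n) e"
    and "\<And>xs. xs \<in> bar_tuples G n e \<Longrightarrow> f (basis_vec xs) = h (basis_vec xs)"
  shows "f = h"
proof (rule hom_eqI[OF assms(1,2)[unfolded std_module_def]])
  fix c assume c: "c \<in> car (bar_module G n) e"
  have "f c = lin_ext (\<lambda>xs. f (basis_vec xs)) c"
    by (rule lin_on_bar_expand[OF std_lin_on[OF assms(1)] c])
  also have "\<dots> = lin_ext (\<lambda>xs. h (basis_vec xs)) c"
    using c assms(3) by (intro lin_ext_cong) auto
  also have "\<dots> = h c"
    by (rule lin_on_bar_expand[OF std_lin_on[OF assms(2)] c, symmetric])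
  finally show "f c = h c" .
qed

lemma std_act: "act (std_module G V n) g f c =
    (if Poly_Mapping.keys c \<subseteq> bar_tuples G n (tgt G g) then act V g (f (act (bar_module G n) (ginv G g) c)) else 0)"
  by (simp add: std_module_def hom_act)

lemma std_act_basis_vec:
  assumes "g \<in> Mor G" "h # t \<in> bar_tuples G n (tgt G g)"
  shows "act (std_module G V n) g f (basis_vec (h # t)) = act V g (f (basis_vec (comp G (ginv G g) h # t)))"
  using assms by (simp add: std_act)

text \<open>Uniqueness of equivariant maps into the bar cochains: the value at \<open>g # t\<close>
  on \<open>y\<close> is the translate by \<open>g\<close> of the value at
  \<open>ident G (src G g) # t\<close> on \<open>ginv G g\<close> applied to
  \<open>y\<close>.\<close>

lemma g_map_std_eqI:
  assumes Y: "normed_gmodule G Y"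
    and F: "g_map G Y (std_module G V n) F" and F': "g_map G Y (std_module G V n) F'"
    and eq: "\<And>e y t. e \<in> Ob G \<Longrightarrow> y \<in> car Y e \<Longrightarrow> t \<in> bar_tails G n e \<Longrightarrow>
      F e y (basis_vec (ident G e # t)) = F' e y (basis_vec (ident G e # t))"
    and e: "e \<in> Ob G" and y: "y \<in> car Y e"
  shows "F e y = F' e y"
proof (rule std_eqI[OF g_map_in[OF F e y] g_map_in[OF F' e y]])
  fix xs assume xs: "xs \<in> bar_tuples G n e"
  then obtain g t where gt: "xs = g # t" "g \<in> Mor G" "tgt G g = e" "t \<in> bar_tails G n (src G g)"
    by (rule bar_tuplesE)
  let ?y = "act Y (ginv G g) y"
  have y': "?y \<in> car Y (src G g)"
    using act_ginv_in_car[OF Y gt(2)] gt(3) y by simp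
  have *: "H e y (basis_vec xs) = act V g (H (src G g) ?y (basis_vec (ident G (src G g) # t)))"
    if H: "g_map G Y (std_module G V n) H" for H
  proof -
    have "H e y = act (std_module G V n) g (H (src G g) ?y)"
      using g_map_equivariant[OF H gt(2) y'] act_act_ginv[OF Y gt(2)] gt(3) y by simp
    then show ?thesis
      using std_act_basis_vec[OF gt(2)] xs gt(1,3) comp_ginv_left[OF gt(2)] by simp
  qed
  show "F e y (basis_vec xs) = F' e y (basis_vec xs)"
    using *[OF F] *[OF F'] eq[OF src_in_Ob[OF gt(2)] y' gt(4)] by simp
qed

context
  fixes Y :: "('o, 'g, 'y::real_vector) gmodule" and k :: "'o \<Rightarrow> 'y \<Rightarrow> 'g list \<Rightarrow> 'v" and n :: nat and M :: real
  assumes Y: "normed_gmodule G Y"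
    and k_lin: "\<And>e t. e \<in> Ob G \<Longrightarrow> t \<in> bar_tails G n e \<Longrightarrow> lin_on (car Y e) (\<lambda>y. k e y t)"
    and k_in: "\<And>e y t. e \<in> Ob G \<Longrightarrow> y \<in> car Y e \<Longrightarrow> t \<in> bar_tails G n e \<Longrightarrow> k e y t \<in> car V e"
    and k_bound: "\<And>e y t. e \<in> Ob G \<Longrightarrow> y \<in> car Y e \<Longrightarrow> t \<in> bar_tails G n e \<Longrightarrow>
      nrm V e (k e y t) \<le> M * nrm Y e y"
    and M: "0 \<le> M"
begin

text \<open>The only value at \<open>xs\<close> that equivariance permits, given \<open>k\<close> on
  the tuples with leading identity.\<close>

abbreviation (input) translate :: "'y \<Rightarrow> 'g list \<Rightarrow> 'v" where
  "translate y xs \<equiv> act V (hd xs) (k (src G (hd xs)) (act Y (ginv G (hd xs)) y) (tl xs))"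

lemma std_extension_basis_vec:
  "xs \<in> bar_tuples G n e \<Longrightarrow> std_extension Y V n k e y (basis_vec xs) = translate y xs"
  by (simp add: std_extension_def)

lemma translate_in:
  assumes "y \<in> car Y e" "xs \<in> bar_tuples G n e"
  shows "translate y xs \<in> car V e" "nrm V e (translate y xs) \<le> M * nrm Y e y"
proof -
  obtain g t where gt: "xs = g # t" "g \<in> Mor G" "tgt G g = e" "t \<in> bar_tails G n (src G g)"
    using bar_tuplesE[OF assms(2)] .
  have y: "act Y (ginv G g) y \<in> car Y (src G g)" "nrm Y (src G g) (act Y (ginv G g) y) = nrm Y e y"
    using act_ginv_in_car[OF Y gt(2)] nrm_act_ginv[OF Y gt(2)] gt(3) assms(1) by simp_all
  note k = k_in[OF src_in_Ob[OF gt(2)] y(1) gt(4)]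
  show "translate y xs \<in> car V e"
    using act_in_car[OF V gt(2) k] gt(1,3) by simp
  show "nrm V e (translate y xs) \<le> M * nrm Y e y"
    using nrm_act[OF V gt(2) k] k_bound[OF src_in_Ob[OF gt(2)] y(1) gt(4)] gt(1,3) y(2) by simp
qed

lemma lin_on_translate:
  assumes "xs \<in> bar_tuples G n e"
  shows "lin_on (car Y e) (\<lambda>y. translate y xs)"
proof -
  obtain g t where gt: "xs = g # t" "g \<in> Mor G" "tgt G g = e" "t \<in> bar_tails G n (src G g)"
    using bar_tuplesE[OF assms] .
  note y = act_ginv_in_car[OF Y gt(2), unfolded gt(3)]
  have "lin_on (car Y e) (act Y (ginv G g))"
    using act_lin_on[OF Y ginv_in_Mor[OF gt(2)]] gt(2,3) by (simp add: groupoid_simps)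
  then have "lin_on (car Y e) (\<lambda>y. k (src G g) (act Y (ginv G g) y) t)"
    using y by (rule lin_on_compose[OF _ _ k_lin[OF src_in_Ob[OF gt(2)] gt(4)]])
  then have "lin_on (car Y e) (\<lambda>y. act V g (k (src G g) (act Y (ginv G g) y) t))"
    using k_in[OF src_in_Ob[OF gt(2)] y gt(4)] by (rule lin_on_compose[OF _ _ act_lin_on[OF V gt(2)]])
  then show ?thesis
    by (simp add: gt(1))
qed

lemma std_extension_apply_bound:
  assumes "e \<in> Ob G" "y \<in> car Y e" "Poly_Mapping.keys c \<subseteq> bar_tuples G n e"
  shows "nrm V e (std_extension Y V n k e y c) \<le> M * nrm Y e y * norm c"
  using assms translate_in[OF assms(2)]
  by (auto simp: std_extension_def intro!: lin_ext_bound[OF gmodule_normed_space[OF V]])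

lemma std_extension_in:
  assumes e: "e \<in> Ob G" and y: "y \<in> car Y e"
  shows "std_extension Y V n k e y \<in> car (std_module G V n) e"
proof (rule std_memI[OF e])
  show "lin_on (car (bar_module G n) e) (std_extension Y V n k e y)"
    using linear_lin_ext[of "translate y"] subspace_add[OF subspace_bar] subspace_scale[OF subspace_bar]
    by (simp add: lin_on_def std_extension_def linear_add linear_scale del: bar_module_simps)
  show "std_extension Y V n k e y c \<in> car V e" if "Poly_Mapping.keys c \<subseteq> bar_tuples G n e" for c
    using that translate_in(1)[OF y]
    by (auto simp: std_extension_def intro!: lin_ext_in_subspace[OF gmodule_subspace[OF V e]])
qed (use std_extension_apply_bound[OF e y] in \<open>auto simp: std_extension_def\<close>)

lemma std_extension_nrm_le:
  assumes e: "e \<in> Ob G" and y: "y \<in> car Y e"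
  shows "nrm (std_module G V n) e (std_extension Y V n k e y) \<le> M * nrm Y e y"
  using std_extension_apply_bound[OF e y] M normed_space_nonneg[OF gmodule_normed_space[OF Y e] y]
  by (intro std_nrm_le[OF e]) simp_all

lemma g_map_std_extension: "g_map G Y (std_module G V n) (std_extension Y V n k)"
  unfolding g_map_def
proof (intro conjI ballI)
  let ?F = "std_extension Y V n k"
  show "r_morphism G Y (std_module G V n) ?F"
  proof (rule r_morphismI[OF Y M])
    fix e assume e: "e \<in> Ob G"
    note sub = gmodule_subspace[OF Y e] and subS = gmodule_subspace[OF normed_std_module e, of n]
    show "lin_on (car Y e) (?F e)"
      unfolding lin_on_def
    proof (intro conjI ballI allI)
      fix x y assume xy: "x \<in> car Y e" "y \<in> car Y e"
      show "?F e (x + y) = ?F e x + ?F e y"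
        using xy subspace_add[OF sub xy] lin_on_add[OF lin_on_translate xy]
        by (intro std_eqI[of _ n e] std_extension_in e subspace_add[OF subS])
          (simp_all add: std_extension_basis_vec)
    next
      fix c x assume x: "x \<in> car Y e"
      show "?F e (c *\<^sub>R x) = c *\<^sub>R ?F e x"
        using x subspace_scale[OF sub x] lin_on_scale[OF lin_on_translate x]
        by (intro std_eqI[of _ n e] std_extension_in e subspace_scale[OF subS])
          (simp_all add: std_extension_basis_vec scaleR_fun_def)
    qed
  qed (use std_extension_in std_extension_nrm_le in auto)
  fix g y assume g: "g \<in> Mor G" and y: "y \<in> car Y (src G g)"
  note gy = act_in_car[OF Y g y]
  show "act (std_module G V n) g (?F (src G g) y) = ?F (tgt G g) (act Y g y)"
  proof (rule std_eqI[of _ n "tgt G g"])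
    fix xs assume xs: "xs \<in> bar_tuples G n (tgt G g)"
    then obtain h t where ht: "xs = h # t" "h \<in> Mor G" "tgt G h = tgt G g" "t \<in> bar_tails G n (src G h)"
      by (rule bar_tuplesE)
    \<comment> \<open>Acting by \<open>g\<close> on a cochain replaces the leading entry
      \<open>h\<close> by \<open>?l\<close>. Equivariance then amounts to \<open>g ?l = h\<close>
      and to the fact that undoing \<open>?l\<close> on \<open>y\<close> is the same as undoing
      \<open>h\<close> on \<open>g y\<close>.\<close>
    let ?l = "comp G (ginv G g) h"
    have l: "?l \<in> Mor G" "src G ?l = src G h" "tgt G ?l = src G g"
      using g ht by (simp_all add: groupoid_simps)
    have gl: "comp G g ?l = h"
      using comp_assoc[of g "ginv G g" h] g ht comp_ident_left[of h]
      by (simp add: groupoid_simps comp_ginv_right)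
    let ?y = "act Y (ginv G ?l) y"
    have y': "?y \<in> car Y (src G h)"
      using act_ginv_in_car[OF Y l(1), of y] y l by simp
    have "act Y h ?y = act Y g (act Y ?l ?y)"
      using act_act[OF Y g l(1) _, of ?y] l y' gl by simp
    also have "\<dots> = act Y g y"
      using act_act_ginv[OF Y l(1), of y] y l by simp
    finally have inv: "act Y (ginv G h) (act Y g y) = ?y"
      using act_ginv_act[OF Y ht(2), of ?y] y' by simp
    have "act (std_module G V n) g (?F (src G g) y) (basis_vec xs)
        = act V g (?F (src G g) y (basis_vec (?l # t)))"
      using xs unfolding ht(1) by (rule std_act_basis_vec[OF g])
    also have "\<dots> = act V g (act V ?l (k (src G h) ?y t))"
      using l ht(4) by (simp add: std_extension_basis_vec bar_tuples_Cons)
    also have "\<dots> = act V h (k (src G h) ?y t)"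
      using act_act[OF V g l(1), of "k (src G h) ?y t"] l gl k_in[OF src_in_Ob[OF ht(2)] y' ht(4)] by simp
    also have "\<dots> = ?F (tgt G g) (act Y g y) (basis_vec xs)"
      using xs by (simp add: std_extension_basis_vec ht(1) inv)
    finally show "act (std_module G V n) g (?F (src G g) y) (basis_vec xs)
        = ?F (tgt G g) (act Y g y) (basis_vec xs)" .
  qed (use act_in_car[OF normed_std_module g std_extension_in] std_extension_in gy g y
      in \<open>simp_all add: groupoid_simps\<close>)
qed

lemma std_extension_ident:
  assumes "e \<in> Ob G" "y \<in> car Y e" "t \<in> bar_tails G n e"
  shows "std_extension Y V n k e y (basis_vec (ident G e # t)) = k e y t"
proof -
  have "act Y (ginv G (ident G e)) y = y"
    using act_ginv_act[OF Y ident_in_Mor[OF assms(1)], of y] act_ident[OF Y] assms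
    by (simp add: groupoid_simps)
  then show ?thesis
    using assms act_ident[OF V assms(1) k_in[OF assms]]
    by (simp add: std_extension_basis_vec bar_tuples_Cons groupoid_simps)
qed

end


text \<open>The values of the extension on tuples with leading identity are prescribed as those of
  \<open>A (s y)\<close>. As such values are free, the missing equivariance of \<open>s\<close> does
  no harm, and it suffices that \<open>d s d = d\<close>.\<close>

lemma extends_over_std:
  assumes X: "normed_gmodule G X" and Y: "normed_gmodule G Y"
    and d: "g_map G X Y d" and s: "r_morphism G Y X s"
    and dsd: "\<And>e x. e \<in> Ob G \<Longrightarrow> x \<in> car X e \<Longrightarrow> d e (s e (d e x)) = d e x"
  shows "extends_over X Y d (std_module G V n)"
  unfolding extends_over_def
proof (intro allI impI)
  fix A assume A: "g_map G X (std_module G V n) A"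
    and A0: "\<forall>e\<in>Ob G. \<forall>x\<in>car X e. d e x = 0 \<longrightarrow> A e x = 0"
  let ?M = "mor_norm G Y (std_module G V n) (\<lambda>e y. A e (s e y))"
  let ?k = "\<lambda>e y t. A e (s e y) (basis_vec (ident G e # t))"
  have As: "r_morphism G Y (std_module G V n) (\<lambda>e y. A e (s e y))"
    by (rule r_morphism_compose[OF Y X normed_std_module s g_map_r_morphism[OF A]])
  have it: "ident G e # t \<in> bar_tuples G n e" if "e \<in> Ob G" "t \<in> bar_tails G n e" for e t
    using that by (simp add: bar_tuples_Cons groupoid_simps)
  have lin: "lin_on (car Y e) (\<lambda>y. ?k e y t)" if "e \<in> Ob G" "t \<in> bar_tails G n e" for e t
    using r_morphism_lin[OF As that(1)] by (simp add: lin_on_def scaleR_fun_def)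
  have "in": "?k e y t \<in> car V e" if "e \<in> Ob G" "y \<in> car Y e" "t \<in> bar_tails G n e" for e y t
    using std_in[OF r_morphism_in[OF As that(1,2)], of "basis_vec (ident G e # t)"] it that by simp
  have bound: "nrm V e (?k e y t) \<le> ?M * nrm Y e y"
    if "e \<in> Ob G" "y \<in> car Y e" "t \<in> bar_tails G n e" for e y t
    using std_bound[OF r_morphism_in[OF As that(1,2)] that(1), of "basis_vec (ident G e # t)"] it that
      r_morphism_bound[OF Y normed_std_module As that(1,2)] by simp
  let ?\<beta> = "std_extension Y V n ?k"
  note ext = Y lin "in" bound mor_norm_nonneg[OF As]
  have \<beta>: "g_map G Y (std_module G V n) ?\<beta>"
    by (rule g_map_std_extension[OF ext])
  have "?\<beta> e (d e x) = A e x" if "e \<in> Ob G" "x \<in> car X e" for e x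
  proof (rule g_map_std_eqI[OF X g_map_compose[OF X Y normed_std_module d \<beta>] A _ that])
    fix e x t assume e: "e \<in> Ob G" and x: "x \<in> car X e" and t: "t \<in> bar_tails G n e"
    note dx = g_map_in[OF d e x]
    note sdx = r_morphism_in[OF s e dx]
    \<comment> \<open>The vectors \<open>s (d x)\<close> and \<open>x\<close> may differ, but only
      by an element of the kernel of \<open>d\<close>, on which \<open>A\<close> vanishes.\<close>
    have "d e (s e (d e x) - x) = 0"
      using lin_on_diff[OF g_map_lin[OF d e] gmodule_subspace[OF X e] sdx x] dsd[OF e x] by simp
    then have "A e (s e (d e x) - x) = 0"
      using A0 e subspace_diff[OF gmodule_subspace[OF X e] sdx x] by blast
    then have "A e (s e (d e x)) = A e x"
      using lin_on_diff[OF g_map_lin[OF A e] gmodule_subspace[OF X e] sdx x] by simp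
    then show "?\<beta> e (d e x) (basis_vec (ident G e # t)) = A e x (basis_vec (ident G e # t))"
      using std_extension_ident[OF ext e dx t] by simp
  qed
  then show "\<exists>\<beta>. g_map G Y (std_module G V n) \<beta> \<and> (\<forall>e\<in>Ob G. \<forall>x\<in>car X e. \<beta> e (d e x) = A e x)"
    using \<beta> by blast
qed

end


section \<open>The bar cochains as a strong resolution of the coefficient module\<close>

context
  fixes V :: "('o, 'g, 'v::real_vector) gmodule"
  assumes V: "normed_gmodule G V"
begin

lemma cons_ident_in_car:
  "e \<in> Ob G \<Longrightarrow> Poly_Mapping.keys c \<subseteq> bar_tails G n e \<Longrightarrow>
    Poly_Mapping.keys (bar_cons (ident G e) c) \<subseteq> bar_tuples G n e"
  using keys_bar_cons[OF ident_in_Mor, of e c n] by (simp add: groupoid_simps)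

lemma std_coboundary_apply:
  "std_coboundary G n e f c = (if Poly_Mapping.keys c \<subseteq> bar_tuples G (Suc n) e then f (bar_boundary G c) else 0)"
  by (simp add: std_coboundary_def)

lemma g_map_std_coboundary: "g_map G (std_module G V n) (std_module G V (Suc n)) (std_coboundary G n)"
  unfolding g_map_def
proof (intro conjI ballI)
  \<comment> \<open>The factor is that of \<open>norm_bar_boundary_le\<close> in degree
    \<open>Suc n\<close>, that is \<open>real (Suc n) + 2\<close>.\<close>
  have bound: "nrm V e (std_coboundary G n e f c) \<le> (real n + 3) * nrm (std_module G V n) e f * norm c"
    if e: "e \<in> Ob G" and f: "f \<in> car (std_module G V n) e" and c: "Poly_Mapping.keys c \<subseteq> bar_tuples G (Suc n) e"
    for e f c
  proof -
    have "nrm V e (f (bar_boundary G c)) \<le> nrm (std_module G V n) e f * norm (bar_boundary G c)"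
      using bar_boundary_in_car[OF c] by (intro std_bound[OF V f e]) simp
    also have "\<dots> \<le> nrm (std_module G V n) e f * ((real n + 3) * norm c)"
      using norm_bar_boundary_le[OF c] std_nrm_nonneg[OF V f e]
      by (intro mult_left_mono) (simp_all add: add.commute)
    finally show ?thesis
      using c by (simp add: std_coboundary_apply mult_ac)
  qed
  show "r_morphism G (std_module G V n) (std_module G V (Suc n)) (std_coboundary G n)"
  proof (rule r_morphismI[OF normed_std_module[OF V], where K = "real n + 3"])
    fix e assume e: "e \<in> Ob G"
    show "lin_on (car (std_module G V n) e) (std_coboundary G n e)"
      by (simp add: lin_on_def fun_eq_iff std_coboundary_apply scaleR_fun_def)
    fix f assume f: "f \<in> car (std_module G V n) e"
    show "nrm (std_module G V (Suc n)) e (std_coboundary G n e f) \<le> (real n + 3) * nrm (std_module G V n) e f"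
      using std_nrm_nonneg[OF V f e] bound[OF e f] by (intro std_nrm_le[OF V e]) simp_all
    show "std_coboundary G n e f \<in> car (std_module G V (Suc n)) e"
    proof (rule std_memI[OF V e])
      have "lin_on (car (bar_module G (Suc n)) e) (\<lambda>c. f (bar_boundary G c))"
        using bar_boundary_in_car[of _ "Suc n" e]
        by (intro lin_on_compose[OF linear_lin_on[OF linear_bar_boundary] _ std_lin_on[OF V f]]) simp
      then show "lin_on (car (bar_module G (Suc n)) e) (std_coboundary G n e f)"
        using subspace_add[OF subspace_bar[OF V]] subspace_scale[OF subspace_bar[OF V]]
        by (simp add: lin_on_def std_coboundary_def del: bar_module_simps)
    qed (use bound[OF e f] std_in[OF V f] bar_boundary_in_car[of _ "Suc n" e] in
        \<open>auto simp: std_coboundary_apply\<close>)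
  qed simp
  fix g f assume g: "g \<in> Mor G" and f: "f \<in> car (std_module G V n) (src G g)"
  show "act (std_module G V (Suc n)) g (std_coboundary G n (src G g) f)
      = std_coboundary G n (tgt G g) (act (std_module G V n) g f)"
  proof
    fix c
    show "act (std_module G V (Suc n)) g (std_coboundary G n (src G g) f) c
      = std_coboundary G n (tgt G g) (act (std_module G V n) g f) c"
    proof (cases "Poly_Mapping.keys c \<subseteq> bar_tuples G (Suc n) (tgt G g)")
      case True
      then have "Poly_Mapping.keys (act (bar_module G (Suc n)) (ginv G g) c) \<subseteq> bar_tuples G (Suc n) (src G g)"
        using act_ginv_in_car[OF normed_bar_module g, of c "Suc n"] by simp
      then show ?thesis
        using True bar_boundary_act[OF ginv_in_Mor[OF g], of c n] bar_boundary_in_car[OF True] g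
        by (simp add: std_act[OF V] std_coboundary_apply groupoid_simps)
    qed (simp add: std_act[OF V] std_coboundary_apply)
  qed
qed

text \<open>Prescribing the value \<open>v\<close> at the identity gives the constant cochain, since
  \<open>g\<close> applied to \<open>ginv G g\<close> applied to \<open>v\<close> is
  \<open>v\<close>. Thus boundedness and equivariance of the augmentation follow from the general
  extension.\<close>

lemma std_augmentation_eq:
  "std_augmentation G e v = std_extension V V 0 (\<lambda>e v t. v) e v" if "v \<in> car V e"
proof
  fix c
  have "act V (hd xs) (act V (ginv G (hd xs)) v) = v" if xs: "xs \<in> bar_tuples G 0 e" for xs
  proof -
    obtain g t where "xs = g # t" "g \<in> Mor G" "tgt G g = e"
      using xs by (rule bar_tuplesE)
    then show ?thesis
      using act_act_ginv[OF V, of g v] \<open>v \<in> car V e\<close> by simp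
  qed
  then show "std_augmentation G e v c = std_extension V V 0 (\<lambda>e v t. v) e v c"
    by (auto simp: std_augmentation_def std_extension_def intro!: lin_ext_cong)
qed

lemma g_map_std_augmentation: "g_map G V (std_module G V 0) (std_augmentation G)"
proof -
  have ext: "g_map G V (std_module G V 0) (std_extension V V 0 (\<lambda>e v t. v))"
    by (rule g_map_std_extension[OF V V, where M = 1]) (auto simp: lin_on_def)
  have "r_morphism G V (std_module G V 0) (std_augmentation G)"
  proof (rule r_morphismI[OF V, where K = "mor_norm G V (std_module G V 0) (std_extension V V 0 (\<lambda>e v t. v))"])
    fix e assume e: "e \<in> Ob G"
    show "lin_on (car V e) (std_augmentation G e)"
      using g_map_lin[OF ext e] subspace_add[OF gmodule_subspace[OF V e]]
        subspace_scale[OF gmodule_subspace[OF V e]]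
      by (simp add: lin_on_def std_augmentation_eq)
  qed (use g_map_in[OF ext] mor_norm_nonneg[OF g_map_r_morphism[OF ext]]
      r_morphism_bound[OF V normed_std_module[OF V] g_map_r_morphism[OF ext]] in
      \<open>simp_all add: std_augmentation_eq\<close>)
  then show ?thesis
    using g_map_equivariant[OF ext] act_in_car[OF V] by (simp add: g_map_def std_augmentation_eq)
qed

lemma std_augmentation_basis_vec:
  "xs \<in> bar_tuples G 0 e \<Longrightarrow> std_augmentation G e v (basis_vec xs) = v"
  by (simp add: std_augmentation_def)

lemma std_augmentation_in: "e \<in> Ob G \<Longrightarrow> v \<in> car V e \<Longrightarrow> std_augmentation G e v \<in> car (std_module G V 0) e"
  using g_map_in[OF g_map_std_augmentation] .

lemma std_coboundary_in:
  "e \<in> Ob G \<Longrightarrow> f \<in> car (std_module G V n) e \<Longrightarrow> std_coboundary G n e f \<in> car (std_module G V (Suc n)) e"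
  using g_map_in[OF g_map_std_coboundary] .

lemma std_coboundary_augmentation:
  assumes e: "e \<in> Ob G" and v: "v \<in> car V e"
  shows "std_coboundary G 0 e (std_augmentation G e v) = 0"
proof (rule std_eqI[OF V std_coboundary_in[OF e std_augmentation_in[OF e v]]])
  show "0 \<in> car (std_module G V (Suc 0)) e"
    by (rule subspace_0[OF gmodule_subspace[OF normed_std_module[OF V] e]])
  fix xs assume xs: "xs \<in> bar_tuples G (Suc 0) e"
  then obtain g h where gh: "xs = [g, h]" "g \<in> Mor G" "tgt G g = e" "h \<in> Mor G" "tgt G h = src G g"
    by (auto elim!: bar_tuplesE)
  then have "[comp G g h] \<in> bar_tuples G 0 e" "[g] \<in> bar_tuples G 0 e"
    by (simp_all add: bar_tuples_Cons groupoid_simps)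
  then show "std_coboundary G 0 e (std_augmentation G e v) (basis_vec xs) = 0 (basis_vec xs)"
    using xs std_diff[OF V std_augmentation_in[OF e v]]
    by (simp add: std_coboundary_apply gh(1) bar_boundary_basis_Cons bar_boundary_basis_single
        std_augmentation_basis_vec)
qed

lemma std_coboundary_coboundary:
  assumes "e \<in> Ob G" "f \<in> car (std_module G V n) e"
  shows "std_coboundary G (Suc n) e (std_coboundary G n e f) = 0"
  using bar_boundary_boundary std_zero[OF V assms(2)] bar_boundary_in_car[of _ "Suc (Suc n)" e]
  by (auto simp: fun_eq_iff std_coboundary_apply)

definition std_contraction0 :: "'o \<Rightarrow> (('g list \<Rightarrow>\<^sub>0 real) \<Rightarrow> 'v) \<Rightarrow> 'v" where
  "std_contraction0 e f = f (basis_vec [ident G e])"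

text \<open>The dual of the homotopy \<open>bar_cons (ident G e)\<close>. It is not equivariant in
  general: a morphism \<open>g\<close> moves the leading identity to \<open>g\<close>, not to the
  identity at the target.\<close>

definition std_contraction :: "nat \<Rightarrow> 'o \<Rightarrow> (('g list \<Rightarrow>\<^sub>0 real) \<Rightarrow> 'v) \<Rightarrow> (('g list \<Rightarrow>\<^sub>0 real) \<Rightarrow> 'v)" where
  "std_contraction n e f = (\<lambda>c. if Poly_Mapping.keys c \<subseteq> bar_tuples G n e then f (bar_cons (ident G e) c) else 0)"

lemma ident_tuple: "e \<in> Ob G \<Longrightarrow> [ident G e] \<in> bar_tuples G 0 e"
  by (simp add: bar_tuples_Cons groupoid_simps)

lemma r_morphism_std_contraction0:
  "r_morphism G (std_module G V 0) V std_contraction0" "mor_norm G (std_module G V 0) V std_contraction0 \<le> 1"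
proof -
  have bound: "nrm V e (std_contraction0 e f) \<le> 1 * nrm (std_module G V 0) e f"
    if "e \<in> Ob G" "f \<in> car (std_module G V 0) e" for e f
    using std_bound[OF V that(2,1), of "basis_vec [ident G e]"] ident_tuple[OF that(1)]
    by (simp add: std_contraction0_def)
  then show "mor_norm G (std_module G V 0) V std_contraction0 \<le> 1"
    by (intro mor_norm_le[OF normed_std_module[OF V]]) auto
  show "r_morphism G (std_module G V 0) V std_contraction0"
    using ident_tuple by (intro r_morphismI[OF normed_std_module[OF V] _ _ _ bound])
      (auto simp: std_contraction0_def lin_on_def scaleR_fun_def intro: std_in[OF V])
qed

lemma r_morphism_std_contraction:
  "r_morphism G (std_module G V (Suc n)) (std_module G V n) (std_contraction n)"
  "mor_norm G (std_module G V (Suc n)) (std_module G V n) (std_contraction n) \<le> 1"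
proof -
  have bound: "nrm V e (std_contraction n e f c) \<le> nrm (std_module G V (Suc n)) e f * norm c"
    if e: "e \<in> Ob G" and f: "f \<in> car (std_module G V (Suc n)) e" and c: "Poly_Mapping.keys c \<subseteq> bar_tuples G n e"
    for e f c
  proof -
    have "nrm V e (f (bar_cons (ident G e) c)) \<le> nrm (std_module G V (Suc n)) e f * norm (bar_cons (ident G e) c)"
      using cons_ident_in_car[OF e, of c "Suc n"] c by (intro std_bound[OF V f e]) simp
    also have "\<dots> \<le> nrm (std_module G V (Suc n)) e f * norm c"
      by (intro mult_left_mono norm_bar_cons_le std_nrm_nonneg[OF V f e])
    finally show ?thesis
      using c by (simp add: std_contraction_def)
  qed
  have nrm: "nrm (std_module G V n) e (std_contraction n e f) \<le> 1 * nrm (std_module G V (Suc n)) e f"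
    if "e \<in> Ob G" "f \<in> car (std_module G V (Suc n)) e" for e f
    using std_nrm_nonneg[OF V that(2,1)] bound[OF that] by (intro std_nrm_le[OF V that(1)]) simp_all
  have "in": "std_contraction n e f \<in> car (std_module G V n) e"
    if e: "e \<in> Ob G" and f: "f \<in> car (std_module G V (Suc n)) e" for e f
  proof (rule std_memI[OF V e])
    have "lin_on (car (bar_module G n) e) (\<lambda>c. f (bar_cons (ident G e) c))"
      using cons_ident_in_car[OF e, of _ "Suc n"]
      by (intro lin_on_compose[OF linear_lin_on[OF linear_bar_cons] _ std_lin_on[OF V f]]) simp
    then show "lin_on (car (bar_module G n) e) (std_contraction n e f)"
      using subspace_add[OF subspace_bar[OF V, of n e]] subspace_scale[OF subspace_bar[OF V, of n e]]
      by (simp add: lin_on_def std_contraction_def)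
  qed (use bound[OF e f] std_in[OF V f] cons_ident_in_car[OF e, of _ "Suc n"] in
      \<open>auto simp: std_contraction_def\<close>)
  show "r_morphism G (std_module G V (Suc n)) (std_module G V n) (std_contraction n)"
    using "in" nrm by (intro r_morphismI[OF normed_std_module[OF V], where K = 1])
      (auto simp: std_contraction_def lin_on_def fun_eq_iff scaleR_fun_def)
  show "mor_norm G (std_module G V (Suc n)) (std_module G V n) (std_contraction n) \<le> 1"
    using nrm by (intro mor_norm_le[OF normed_std_module[OF V]]) auto
qed

text \<open>In degree 0 the homotopy sends the empty tail to \<open>[ident G e]\<close>, so the dual
  of \<open>h \<partial>\<close> is evaluation there followed by the augmentation.\<close>

lemma std_contraction_coboundary_0:
  assumes e: "e \<in> Ob G" and f: "f \<in> car (std_module G V 0) e"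
  shows "std_contraction 0 e (std_coboundary G 0 e f) + std_augmentation G e (std_contraction0 e f) = f"
proof (rule std_eqI[OF V _ f])
  show "std_contraction 0 e (std_coboundary G 0 e f) + std_augmentation G e (std_contraction0 e f)
      \<in> car (std_module G V 0) e"
    using e f by (intro subspace_add[OF gmodule_subspace[OF normed_std_module[OF V] e]] std_augmentation_in
      r_morphism_in[OF r_morphism_std_contraction(1)] std_coboundary_in
      r_morphism_in[OF r_morphism_std_contraction0(1)])
  fix xs assume xs: "xs \<in> bar_tuples G 0 e"
  then obtain g where g: "xs = [g]"
    by (auto elim!: bar_tuplesE)
  have "bar_boundary_basis G (ident G e # xs) = basis_vec xs - basis_vec [ident G e]"
    using bar_boundary_cons_ident[OF e, of "basis_vec xs" 0] xs by (simp add: g bar_boundary_basis_single)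
  then show "(std_contraction 0 e (std_coboundary G 0 e f) + std_augmentation G e (std_contraction0 e f)) (basis_vec xs)
      = f (basis_vec xs)"
    using xs cons_ident_in_car[OF e, of "basis_vec xs" "Suc 0"] ident_tuple[OF e]
      std_diff[OF V f, of "basis_vec xs" "basis_vec [ident G e]"]
    by (simp add: std_contraction_def std_coboundary_apply std_augmentation_basis_vec std_contraction0_def)
qed

text \<open>Evaluating \<open>f\<close> on the homotopy formula of
  \<open>bar_boundary_cons_ident\<close> gives
  \<open>f (\<partial> (h c)) + f (h (\<partial> c)) = f c\<close>.\<close>

lemma std_contraction_coboundary_Suc:
  assumes e: "e \<in> Ob G" and f: "f \<in> car (std_module G V (Suc n)) e"
  shows "std_contraction (Suc n) e (std_coboundary G (Suc n) e f) + std_coboundary G n e (std_contraction n e f) = f"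
proof
  fix c
  show "(std_contraction (Suc n) e (std_coboundary G (Suc n) e f)
      + std_coboundary G n e (std_contraction n e f)) c = f c"
  proof (cases "Poly_Mapping.keys c \<subseteq> bar_tuples G (Suc n) e")
    case True
    then have d: "Poly_Mapping.keys (bar_boundary G c) \<subseteq> bar_tuples G n e"
      using bar_boundary_in_car by fastforce
    show ?thesis
      using True cons_ident_in_car[OF e, of c "Suc (Suc n)"] d cons_ident_in_car[OF e, of _ "Suc n", simplified, OF d]
        std_diff[OF V f True, of "bar_cons (ident G e) (bar_boundary G c)"] bar_boundary_cons_ident[OF e True]
      by (simp add: std_contraction_def std_coboundary_apply)
  next
    case False
    then show ?thesis
      using std_outside[OF V f] by (simp add: std_contraction_def std_coboundary_apply)
  qed
qed

text \<open>Allows the results on contracted resolutions to be used with the bar cochains as source,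
  which yields the map back to \<open>D\<close> and the homotopy on the bar side.\<close>

lemma strong_resolution_std:
  assumes "banach_gmodule G V"
  shows "strong_resolution G V (std_module G V) (std_coboundary G) (std_augmentation G)"
  unfolding strong_resolution_def
proof (intro conjI exI[of _ std_contraction0] exI[of _ std_contraction])
  show "banach_cochain_complex G (std_module G V) (std_coboundary G)"
    unfolding banach_cochain_complex_def
    using banach_std_module[OF assms] g_map_std_coboundary std_coboundary_coboundary by blast
  show "augmentation G V (std_module G V) (std_coboundary G) (std_augmentation G)"
    unfolding augmentation_def using g_map_std_augmentation std_coboundary_augmentation by blast
qed (use r_morphism_std_contraction0 r_morphism_std_contraction std_contraction_coboundary_0
    std_contraction_coboundary_Suc ident_tuple in
    \<open>auto simp: std_contraction0_def std_augmentation_basis_vec\<close>)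

end

end

section \<open>Comparison maps and homotopies\<close>

text \<open>The contraction is fixed as data, not merely asserted to exist, because the explicit
  comparison map is defined by recursion from it. The locale is interpreted both for the given
  resolution and for the bar cochains.\<close>

locale contracted_resolution = groupoid_on G
  for G :: "('o, 'g) groupoid_data" +
  fixes V :: "('o, 'g, 'v::real_vector) gmodule"
    and D :: "nat \<Rightarrow> ('o, 'g, 'd::real_vector) gmodule"
    and \<delta> :: "nat \<Rightarrow> 'o \<Rightarrow> 'd \<Rightarrow> 'd"
    and \<epsilon> :: "'o \<Rightarrow> 'v \<Rightarrow> 'd"
    and s0 :: "'o \<Rightarrow> 'd \<Rightarrow> 'v"
    and s :: "nat \<Rightarrow> 'o \<Rightarrow> 'd \<Rightarrow> 'd"
  assumes banach_V: "banach_gmodule G V"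
    and banach_D: "banach_gmodule G (D n)"
    and g_map_\<delta>: "g_map G (D n) (D (Suc n)) (\<delta> n)"
    and \<delta>_\<delta>: "e \<in> Ob G \<Longrightarrow> x \<in> car (D n) e \<Longrightarrow> \<delta> (Suc n) e (\<delta> n e x) = 0"
    and g_map_\<epsilon>: "g_map G V (D 0) \<epsilon>"
    and \<delta>_\<epsilon>: "e \<in> Ob G \<Longrightarrow> v \<in> car V e \<Longrightarrow> \<delta> 0 e (\<epsilon> e v) = 0"
    and r_morphism_s0: "r_morphism G (D 0) V s0" and mor_norm_s0: "mor_norm G (D 0) V s0 \<le> 1"
    and r_morphism_s: "r_morphism G (D (Suc n)) (D n) (s n)"
    and mor_norm_s: "mor_norm G (D (Suc n)) (D n) (s n) \<le> 1"
    and s0_\<epsilon>: "e \<in> Ob G \<Longrightarrow> v \<in> car V e \<Longrightarrow> s0 e (\<epsilon> e v) = v"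
    and contraction_0: "e \<in> Ob G \<Longrightarrow> x \<in> car (D 0) e \<Longrightarrow> s 0 e (\<delta> 0 e x) + \<epsilon> e (s0 e x) = x"
    and contraction_Suc: "e \<in> Ob G \<Longrightarrow> x \<in> car (D (Suc n)) e \<Longrightarrow>
      s (Suc n) e (\<delta> (Suc n) e x) + \<delta> n e (s n e x) = x"

lemma strong_resolutionE:
  assumes "groupoid G" "banach_gmodule G V" "strong_resolution G V D \<delta> \<epsilon>"
  obtains s0 s where "contracted_resolution G V D \<delta> \<epsilon> s0 s"
proof -
  obtain s0 s where "banach_cochain_complex G D \<delta>" "augmentation G V D \<delta> \<epsilon>"
    "r_morphism G (D 0) V s0" "mor_norm G (D 0) V s0 \<le> 1"
    "\<forall>n. r_morphism G (D (Suc n)) (D n) (s n) \<and> mor_norm G (D (Suc n)) (D n) (s n) \<le> 1"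
    "\<forall>e\<in>Ob G. \<forall>v\<in>car V e. s0 e (\<epsilon> e v) = v"
    "\<forall>e\<in>Ob G. \<forall>x\<in>car (D 0) e. s 0 e (\<delta> 0 e x) + \<epsilon> e (s0 e x) = x"
    "\<forall>n. \<forall>e\<in>Ob G. \<forall>x\<in>car (D (Suc n)) e. s (Suc n) e (\<delta> (Suc n) e x) + \<delta> n e (s n e x) = x"
    using assms(3) unfolding strong_resolution_def by (elim conjE exE) rule
  then have "contracted_resolution G V D \<delta> \<epsilon> s0 s"
    using assms(1,2) by unfold_locales (simp_all add: banach_cochain_complex_def augmentation_def)
  then show ?thesis
    by (rule that)
qed

context contracted_resolution
begin

lemmas normed_V = banach_imp_normed[OF banach_V]
  and normed_D = banach_imp_normed[OF banach_D]
  and \<delta>_in = g_map_in[OF g_map_\<delta>]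
  and \<epsilon>_in = g_map_in[OF g_map_\<epsilon>]
  and s_in = r_morphism_in[OF r_morphism_s]
  and s0_in = r_morphism_in[OF r_morphism_s0]

text \<open>The contraction gives exactness with a bounded choice of preimages: when the
  differential of \<open>x\<close> vanishes, one term of the contraction identity drops out.\<close>

lemma exact_0: "e \<in> Ob G \<Longrightarrow> x \<in> car (D 0) e \<Longrightarrow> \<delta> 0 e x = 0 \<Longrightarrow> \<epsilon> e (s0 e x) = x"
  using contraction_0[of e x] lin_on_zero[OF r_morphism_lin[OF r_morphism_s] gmodule_subspace[OF normed_D]]
  by simp

lemma exact_Suc: "e \<in> Ob G \<Longrightarrow> x \<in> car (D (Suc n)) e \<Longrightarrow> \<delta> (Suc n) e x = 0 \<Longrightarrow> \<delta> n e (s n e x) = x"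
  using contraction_Suc[of e x n] lin_on_zero[OF r_morphism_lin[OF r_morphism_s] gmodule_subspace[OF normed_D]]
  by simp

lemma
  fixes I :: "('o, 'g, 'i::real_vector) gmodule" and j :: "'d \<Rightarrow> 't::real_vector"
  assumes "rel_injective_module TYPE('t) G I" "normed_gmodule G I" "linear j" "\<And>y. p (j y) = y"
  shows augmentation_extends_over_rel_injective: "extends_over V (D 0) \<epsilon> I"
    and coboundary_extends_over_rel_injective: "extends_over (D n) (D (Suc n)) (\<delta> n) I"
  by (rule extends_over_rel_injective[OF assms normed_V banach_D normed_D g_map_\<epsilon> g_map_\<delta> r_morphism_s0 \<delta>_\<epsilon> exact_0];
      assumption)
    (rule extends_over_rel_injective[OF assms normed_D banach_D normed_D g_map_\<delta> g_map_\<delta> r_morphism_s \<delta>_\<delta> exact_Suc];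
      assumption)

lemma coboundary_extends_over_std:
  "normed_gmodule G W \<Longrightarrow> extends_over (D n) (D (Suc n)) (\<delta> n) (std_module G W m)"
  by (rule extends_over_std[OF _ normed_D normed_D g_map_\<delta> r_morphism_s exact_Suc[OF _ \<delta>_in \<delta>_\<delta>]])

section \<open>Existence of comparison maps and null homotopies\<close>

context
  fixes I :: "nat \<Rightarrow> ('o, 'g, 'i::real_vector) gmodule" and d :: "nat \<Rightarrow> 'o \<Rightarrow> 'i \<Rightarrow> 'i"
  assumes I: "\<And>n. normed_gmodule G (I n)" and d: "\<And>n. g_map G (I n) (I (Suc n)) (d n)"
    and dd: "\<And>n e x. e \<in> Ob G \<Longrightarrow> x \<in> car (I n) e \<Longrightarrow> d (Suc n) e (d n e x) = 0"
    and ext: "\<And>n m. extends_over (D n) (D (Suc n)) (\<delta> n) (I m)"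
begin

lemma comparison_map:
  assumes ext0: "extends_over V (D 0) \<epsilon> (I 0)"
    and \<iota>: "g_map G V (I 0) \<iota>" and d\<iota>: "\<And>e v. e \<in> Ob G \<Longrightarrow> v \<in> car V e \<Longrightarrow> d 0 e (\<iota> e v) = 0"
  obtains h where "\<And>n. g_map G (D n) (I n) (h n)"
    and "\<And>n e x. e \<in> Ob G \<Longrightarrow> x \<in> car (D n) e \<Longrightarrow> h (Suc n) e (\<delta> n e x) = d n e (h n e x)"
    and "\<And>e v. e \<in> Ob G \<Longrightarrow> v \<in> car V e \<Longrightarrow> h 0 e (\<epsilon> e v) = \<iota> e v"
proof -
  \<comment> \<open>Extensions merely exist, so the maps are chosen one after the other. The middle
    clause of \<open>P\<close> is exactly the hypothesis needed to extend \<open>d \<circ> h\<close>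
    one degree further; the clause for degree 0 records the choice made at the start.\<close>
  define P where "P n h \<longleftrightarrow> g_map G (D n) (I n) h \<and>
      (\<forall>e\<in>Ob G. \<forall>x\<in>car (D n) e. \<delta> n e x = 0 \<longrightarrow> d n e (h e x) = 0) \<and>
      (n = 0 \<longrightarrow> (\<forall>e\<in>Ob G. \<forall>v\<in>car V e. h e (\<epsilon> e v) = \<iota> e v))" for n h
  define Q where "Q n h h' \<longleftrightarrow> (\<forall>e\<in>Ob G. \<forall>x\<in>car (D n) e. h' e (\<delta> n e x) = d n e (h e x))" for n h h'
  have "\<exists>h. \<forall>n. P n (h n) \<and> Q n (h n) (h (Suc n))"
  proof (rule dependent_nat_choice)
    \<comment> \<open>\<open>\<epsilon>\<close> is injective on the carrier because
      \<open>s0\<close> is a left inverse, so the condition on its kernel is satisfied.\<close>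
    have "\<iota> e v = 0" if "e \<in> Ob G" "v \<in> car V e" "\<epsilon> e v = 0" for e v
      using s0_\<epsilon>[OF that(1,2)] that(1,3) lin_on_zero[OF g_map_lin[OF \<iota>] gmodule_subspace[OF normed_V]]
        lin_on_zero[OF r_morphism_lin[OF r_morphism_s0] gmodule_subspace[OF normed_D]] by simp
    then obtain h where h: "g_map G (D 0) (I 0) h" "\<forall>e\<in>Ob G. \<forall>v\<in>car V e. h e (\<epsilon> e v) = \<iota> e v"
      using ext0 \<iota> unfolding extends_over_def by blast
    have "d 0 e (h e x) = 0" if "e \<in> Ob G" "x \<in> car (D 0) e" "\<delta> 0 e x = 0" for e x
      using exact_0[OF that] h(2) d\<iota> s0_in[OF that(1,2)] that(1) by metis
    then show "\<exists>h. P 0 h"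
      using h by (auto simp: P_def)
  next
    fix h n assume "P n h"
    then have h: "g_map G (D n) (I n) h" "\<And>e x. e \<in> Ob G \<Longrightarrow> x \<in> car (D n) e \<Longrightarrow> \<delta> n e x = 0 \<Longrightarrow> d n e (h e x) = 0"
      by (auto simp: P_def)
    then obtain h' where h': "g_map G (D (Suc n)) (I (Suc n)) h'"
      "\<And>e x. e \<in> Ob G \<Longrightarrow> x \<in> car (D n) e \<Longrightarrow> h' e (\<delta> n e x) = d n e (h e x)"
      using ext[of n "Suc n", unfolded extends_over_def, rule_format, OF g_map_compose[OF normed_D I I h(1) d]]
      by blast
    \<comment> \<open>Exactness writes \<open>x\<close> as the differential of \<open>s x\<close>;
      then \<open>d (h' x) = d (d (h (s x))) = 0\<close>.\<close>
    have "d (Suc n) e (h' e x) = 0" if "e \<in> Ob G" "x \<in> car (D (Suc n)) e" "\<delta> (Suc n) e x = 0" for e x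
      using exact_Suc[OF that] h'(2)[OF that(1) s_in[OF that(1,2)]]
        dd[OF that(1) g_map_in[OF h(1) that(1) s_in[OF that(1,2)]]] by simp
    then show "\<exists>h'. P (Suc n) h' \<and> Q n h h'"
      using h' by (auto simp: P_def Q_def)
  qed
  then obtain h where "\<And>n. P n (h n)" "\<And>n. Q n (h n) (h (Suc n))"
    by blast
  then show ?thesis
    by (intro that[of h]) (simp_all add: P_def Q_def)
qed

text \<open>In each degree \<open>\<phi> - d T\<close> is extended along the differential of
  \<open>D\<close>. It vanishes on cocycles: these are differentials of some \<open>y\<close>, where
  it equals \<open>d (\<phi> y) - d (T (\<delta> y))\<close>. That this is 0 is the invariant
  carried along, and it reproduces itself because \<open>d \<circ> d = 0\<close>.\<close>

lemma null_homotopy: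
  assumes \<phi>: "\<And>n. g_map G (D n) (I n) (\<phi> n)"
    and \<phi>_\<delta>: "\<And>n e x. e \<in> Ob G \<Longrightarrow> x \<in> car (D n) e \<Longrightarrow> \<phi> (Suc n) e (\<delta> n e x) = d n e (\<phi> n e x)"
    and \<phi>_\<epsilon>: "\<And>e v. e \<in> Ob G \<Longrightarrow> v \<in> car V e \<Longrightarrow> \<phi> 0 e (\<epsilon> e v) = 0"
  obtains T where "\<And>n. g_map G (D (Suc n)) (I n) (T n)"
    and "\<And>e x. e \<in> Ob G \<Longrightarrow> x \<in> car (D 0) e \<Longrightarrow> T 0 e (\<delta> 0 e x) = \<phi> 0 e x"
    and "\<And>n e x. e \<in> Ob G \<Longrightarrow> x \<in> car (D (Suc n)) e \<Longrightarrow>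
      T (Suc n) e (\<delta> (Suc n) e x) = \<phi> (Suc n) e x - d n e (T n e x)"
proof -
  define P where "P n T \<longleftrightarrow> g_map G (D (Suc n)) (I n) T \<and>
      (\<forall>e\<in>Ob G. \<forall>x\<in>car (D n) e. d n e (T e (\<delta> n e x)) = d n e (\<phi> n e x)) \<and>
      (n = 0 \<longrightarrow> (\<forall>e\<in>Ob G. \<forall>x\<in>car (D 0) e. T e (\<delta> 0 e x) = \<phi> 0 e x))" for n T
  define Q where "Q n T T' \<longleftrightarrow> (\<forall>e\<in>Ob G. \<forall>x\<in>car (D (Suc n)) e.
      T' e (\<delta> (Suc n) e x) = \<phi> (Suc n) e x - d n e (T e x))" for n T T'
  have "\<exists>T. \<forall>n. P n (T n) \<and> Q n (T n) (T (Suc n))"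
  proof (rule dependent_nat_choice)
    have "\<phi> 0 e x = 0" if "e \<in> Ob G" "x \<in> car (D 0) e" "\<delta> 0 e x = 0" for e x
      using exact_0[OF that] \<phi>_\<epsilon>[OF that(1) s0_in[OF that(1,2)]] by simp
    then obtain T where "g_map G (D (Suc 0)) (I 0) T" "\<forall>e\<in>Ob G. \<forall>x\<in>car (D 0) e. T e (\<delta> 0 e x) = \<phi> 0 e x"
      using ext[of 0 0] \<phi>[of 0] unfolding extends_over_def by blast
    then show "\<exists>T. P 0 T"
      by (auto simp: P_def)
  next
    fix T n assume "P n T"
    then have T: "g_map G (D (Suc n)) (I n) T"
      and dT: "\<And>e x. e \<in> Ob G \<Longrightarrow> x \<in> car (D n) e \<Longrightarrow> d n e (T e (\<delta> n e x)) = d n e (\<phi> n e x)"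
      by (auto simp: P_def)
    let ?A = "\<lambda>e x. \<phi> (Suc n) e x - d n e (T e x)"
    have A: "g_map G (D (Suc n)) (I (Suc n)) ?A"
      by (rule g_map_difference[OF normed_D I \<phi> g_map_compose[OF normed_D I I T d]])
    have "?A e x = 0" if "e \<in> Ob G" "x \<in> car (D (Suc n)) e" "\<delta> (Suc n) e x = 0" for e x
      using exact_Suc[OF that] dT[OF that(1) s_in[OF that(1,2)]] \<phi>_\<delta>[OF that(1) s_in[OF that(1,2)]] by simp
    then obtain T' where T': "g_map G (D (Suc (Suc n))) (I (Suc n)) T'"
      "\<And>e x. e \<in> Ob G \<Longrightarrow> x \<in> car (D (Suc n)) e \<Longrightarrow> T' e (\<delta> (Suc n) e x) = ?A e x"
      using ext[of "Suc n" "Suc n", unfolded extends_over_def, rule_format, OF A] by blast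
    have "d (Suc n) e (T' e (\<delta> (Suc n) e x)) = d (Suc n) e (\<phi> (Suc n) e x)"
      if "e \<in> Ob G" "x \<in> car (D (Suc n)) e" for e x
      using T'(2)[OF that] dd[OF that(1) g_map_in[OF T that]]
        lin_on_diff[OF g_map_lin[OF d that(1)] gmodule_subspace[OF I that(1)] g_map_in[OF \<phi> that]
          g_map_in[OF d that(1) g_map_in[OF T that]]] by simp
    then show "\<exists>T'. P (Suc n) T' \<and> Q n T T'"
      using T' by (auto simp: P_def Q_def)
  qed
  then obtain T where "\<And>n. P n (T n)" "\<And>n. Q n (T n) (T (Suc n))"
    by blast
  then show ?thesis
    by (intro that[of T]) (simp_all add: P_def Q_def)
qed

end

text \<open>
  The recursion \<open>f\<^sup>n\<^sup>+\<^sup>1(x)(id, g\<^sub>1, \<dots>) = f\<^sup>n(s x)(g\<^sub>1, \<dots>)\<close> makes the comparison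
  map commute with the contractions of \<open>D\<close> and of the bar complex. As the contractions have norm at
  most \<open>1\<close>, so has the comparison map.
\<close>

primrec std_comparison :: "nat \<Rightarrow> 'o \<Rightarrow> 'd \<Rightarrow> ('g list \<Rightarrow>\<^sub>0 real) \<Rightarrow> 'v" where
  "std_comparison 0 = std_extension (D 0) V 0 (\<lambda>e x t. s0 e x)"
| "std_comparison (Suc n) =
     std_extension (D (Suc n)) V (Suc n) (\<lambda>e x t. std_comparison n e (s n e x) (basis_vec t))"

text \<open>The three claims need a joint induction: linearity and the norm bound in degree
  \<open>n\<close> are what makes the prescribed values in degree \<open>Suc n\<close> admissible.
  The constant stays 1 because a basis vector and the contraction both have norm at most 1.\<close>

lemma std_comparison_properties:
  "g_map G (D n) (std_module G V n) (std_comparison n) \<and>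
   (\<forall>e\<in>Ob G. \<forall>x\<in>car (D n) e. nrm (std_module G V n) e (std_comparison n e x) \<le> nrm (D n) e x \<and>
     (\<forall>t\<in>bar_tails G n e. std_comparison n e x (basis_vec (ident G e # t)) =
       (case n of 0 \<Rightarrow> s0 e x | Suc m \<Rightarrow> std_comparison m e (s m e x) (basis_vec t))))"
proof (induction n)
  case 0
  have lin: "lin_on (car (D 0) e) (\<lambda>x. s0 e x)" if "e \<in> Ob G" "t \<in> bar_tails G 0 e" for e and t :: "'g list"
    using r_morphism_lin[OF r_morphism_s0 that(1)] .
  have "in": "s0 e x \<in> car V e" if "e \<in> Ob G" "x \<in> car (D 0) e" "t \<in> bar_tails G 0 e" for e x and t :: "'g list"
    using s0_in that by blast
  have bound: "nrm V e (s0 e x) \<le> 1 * nrm (D 0) e x"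
    if "e \<in> Ob G" "x \<in> car (D 0) e" "t \<in> bar_tails G 0 e" for e x and t :: "'g list"
    using nrm_le_if_mor_norm_le_1[OF normed_D normed_V r_morphism_s0 mor_norm_s0 that(1,2)] by simp
  note ext = normed_V normed_D lin "in" bound zero_le_one
  show ?case
    using g_map_std_extension[OF ext] std_extension_nrm_le[OF ext] std_extension_ident[OF ext] by simp
next
  case (Suc n)
  let ?k = "\<lambda>e x t. std_comparison n e (s n e x) (basis_vec t)"
  have r: "r_morphism G (D (Suc n)) (std_module G V n) (\<lambda>e x. std_comparison n e (s n e x))"
    using Suc by (intro r_morphism_compose[OF normed_D normed_D normed_std_module[OF normed_V] r_morphism_s])
      (simp add: g_map_r_morphism)
  have lin: "lin_on (car (D (Suc n)) e) (\<lambda>x. std_comparison n e (s n e x) (basis_vec t))"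
    if "e \<in> Ob G" "t \<in> bar_tails G (Suc n) e" for e t
    using r_morphism_lin[OF r that(1)] by (simp add: lin_on_def scaleR_fun_def)
  have "in": "std_comparison n e (s n e x) (basis_vec t) \<in> car V e"
    if "e \<in> Ob G" "x \<in> car (D (Suc n)) e" "t \<in> bar_tails G (Suc n) e" for e x t
    using std_in[OF normed_V r_morphism_in[OF r that(1,2)], of "basis_vec t"] that(3) by simp
  have bound: "nrm V e (std_comparison n e (s n e x) (basis_vec t)) \<le> 1 * nrm (D (Suc n)) e x"
    if "e \<in> Ob G" "x \<in> car (D (Suc n)) e" "t \<in> bar_tails G (Suc n) e" for e x t
  proof -
    have "nrm V e (std_comparison n e (s n e x) (basis_vec t)) \<le> nrm (std_module G V n) e (std_comparison n e (s n e x))"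
      using std_bound[OF normed_V r_morphism_in[OF r that(1,2)] that(1), of "basis_vec t"] that(3) by simp
    also have "\<dots> \<le> nrm (D n) e (s n e x)"
      using Suc that(1) s_in[OF that(1,2)] by blast
    also have "\<dots> \<le> nrm (D (Suc n)) e x"
      by (rule nrm_le_if_mor_norm_le_1[OF normed_D normed_D r_morphism_s mor_norm_s that(1,2)])
    finally show ?thesis
      by simp
  qed
  note ext = normed_V normed_D lin "in" bound zero_le_one
  show ?case
    using g_map_std_extension[where k = ?k and n = "Suc n", OF ext]
      std_extension_nrm_le[where k = ?k and n = "Suc n", OF ext]
      std_extension_ident[where k = ?k and n = "Suc n", OF ext] by simp
qed

lemma g_map_std_comparison: "g_map G (D n) (std_module G V n) (std_comparison n)"
  using std_comparison_properties[of n] by blast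

lemma std_comparison_nrm_le:
  "e \<in> Ob G \<Longrightarrow> x \<in> car (D n) e \<Longrightarrow> nrm (std_module G V n) e (std_comparison n e x) \<le> nrm (D n) e x"
  using std_comparison_properties[of n] by blast

lemma std_comparison_0_ident:
  "e \<in> Ob G \<Longrightarrow> x \<in> car (D 0) e \<Longrightarrow> std_comparison 0 e x (basis_vec [ident G e]) = s0 e x"
  using std_comparison_properties[of 0] by (simp del: std_comparison.simps)

lemma std_comparison_Suc_ident:
  "e \<in> Ob G \<Longrightarrow> x \<in> car (D (Suc n)) e \<Longrightarrow> t \<in> bar_tuples G n e \<Longrightarrow>
    std_comparison (Suc n) e x (basis_vec (ident G e # t)) = std_comparison n e (s n e x) (basis_vec t)"
  using std_comparison_properties[of "Suc n"] by (simp del: std_comparison.simps)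

declare std_comparison.simps [simp del]

lemmas std_comparison_in = g_map_in[OF g_map_std_comparison]

lemma std_comparison_\<epsilon>:
  assumes "e \<in> Ob G" "v \<in> car V e"
  shows "std_comparison 0 e (\<epsilon> e v) = std_augmentation G e v"
proof (rule g_map_std_eqI[OF normed_V normed_V
      g_map_compose[OF normed_V normed_D normed_std_module[OF normed_V] g_map_\<epsilon> g_map_std_comparison]
      g_map_std_augmentation[OF normed_V] _ assms])
  fix e v t assume e: "e \<in> Ob G" and v: "v \<in> car V e" and t: "t \<in> bar_tails G 0 e"
  show "std_comparison 0 e (\<epsilon> e v) (basis_vec (ident G e # t)) = std_augmentation G e v (basis_vec (ident G e # t))"
    using std_comparison_0_ident[OF e \<epsilon>_in[OF e v]] s0_\<epsilon>[OF e v] ident_tuple[OF normed_V e] t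
    by (simp add: std_augmentation_basis_vec[OF normed_V])
qed

text \<open>The recursion, extended linearly from single tuples to chains: the comparison map
  intertwines the contraction of \<open>D\<close> with the dual of the bar homotopy.\<close>

lemma std_comparison_bar_cons:
  assumes e: "e \<in> Ob G" and x: "x \<in> car (D (Suc n)) e" and c: "Poly_Mapping.keys c \<subseteq> bar_tuples G n e"
  shows "std_comparison (Suc n) e x (bar_cons (ident G e) c) = std_comparison n e (s n e x) c"
proof -
  have "std_comparison (Suc n) e x (bar_cons (ident G e) c)
      = lin_ext (\<lambda>t. std_comparison (Suc n) e x (basis_vec (ident G e # t))) c"
    unfolding bar_cons_def
    by (rule std_lin_ext[OF normed_V std_comparison_in[OF e x]])
      (use c e in \<open>auto simp: bar_tuples_Cons groupoid_simps\<close>)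
  also have "\<dots> = lin_ext (\<lambda>t. std_comparison n e (s n e x) (basis_vec t)) c"
    using c std_comparison_Suc_ident[OF e x] by (intro lin_ext_cong) blast
  also have "\<dots> = std_comparison n e (s n e x) c"
    using lin_on_bar_expand[OF std_lin_on[OF normed_V std_comparison_in[OF e s_in[OF e x]]], of c] c by simp
  finally show ?thesis .
qed

text \<open>Both sides are equivariant, so tuples with leading identity suffice. There the recursion
  gives \<open>f (s (\<delta> x)) t\<close>, the contraction identity replaces
  \<open>s (\<delta> x)\<close> by \<open>x - \<delta> (s x)\<close>, and induction turns this into
  \<open>f x\<close> on \<open>t - h (\<partial> t)\<close>, which is the boundary of
  \<open>h t\<close>. In degree 0 the augmentation plays the role of
  \<open>\<delta> \<circ> s\<close>.\<close>

lemma std_comparison_\<delta>: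
  assumes "e \<in> Ob G" "x \<in> car (D n) e"
  shows "std_comparison (Suc n) e (\<delta> n e x) = std_coboundary G n e (std_comparison n e x)"
  using assms
proof (induction n arbitrary: e x)
  case 0
  show ?case
  proof (rule g_map_std_eqI[OF normed_V normed_D
      g_map_compose[OF normed_D normed_D normed_std_module[OF normed_V] g_map_\<delta> g_map_std_comparison]
      g_map_compose[OF normed_D normed_std_module[OF normed_V] normed_std_module[OF normed_V]
        g_map_std_comparison g_map_std_coboundary[OF normed_V]] _ 0])
    fix e x t assume e: "e \<in> Ob G" and x: "x \<in> car (D 0) e" and t: "t \<in> bar_tails G (Suc 0) e"
    then have t': "t \<in> bar_tuples G 0 e"
      by simp
    then obtain g where g: "t = [g]"
      by (auto elim!: bar_tuplesE)
    let ?i = "ident G e"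
    have it: "?i # t \<in> bar_tuples G (Suc 0) e"
      using e t by (simp add: bar_tuples_Cons groupoid_simps)
    have bd: "bar_boundary_basis G (?i # t) = basis_vec t - basis_vec [?i]"
      using bar_boundary_cons_ident[OF e, of "basis_vec t" 0] t' by (simp add: g bar_boundary_basis_single)
    have "std_comparison (Suc 0) e (\<delta> 0 e x) (basis_vec (?i # t)) = std_comparison 0 e (s 0 e (\<delta> 0 e x)) (basis_vec t)"
      by (rule std_comparison_Suc_ident[OF e \<delta>_in[OF e x] t'])
    also have "s 0 e (\<delta> 0 e x) = x - \<epsilon> e (s0 e x)"
      using contraction_0[OF e x] by (simp add: algebra_simps)
    also have "std_comparison 0 e \<dots> = std_comparison 0 e x - std_augmentation G e (s0 e x)"
      using lin_on_diff[OF g_map_lin[OF g_map_std_comparison e] gmodule_subspace[OF normed_D e] x \<epsilon>_in[OF e s0_in[OF e x]]]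
        std_comparison_\<epsilon>[OF e s0_in[OF e x]] by simp
    also have "\<dots> (basis_vec t) = std_comparison 0 e x (basis_vec t) - s0 e x"
      using t' by (simp add: std_augmentation_basis_vec[OF normed_V])
    also have "\<dots> = std_comparison 0 e x (bar_boundary_basis G (?i # t))"
      using std_diff[OF normed_V std_comparison_in[OF e x], of "basis_vec t" "basis_vec [?i]"]
        ident_tuple[OF normed_V e] std_comparison_0_ident[OF e x] t' by (simp add: bd)
    finally show "std_comparison (Suc 0) e (\<delta> 0 e x) (basis_vec (?i # t))
        = std_coboundary G 0 e (std_comparison 0 e x) (basis_vec (?i # t))"
      using it by (simp add: std_coboundary_apply[OF normed_V])
  qed
next
  case (Suc n)
  show ?case
  proof (rule g_map_std_eqI[OF normed_V normed_D
      g_map_compose[OF normed_D normed_D normed_std_module[OF normed_V] g_map_\<delta> g_map_std_comparison]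
      g_map_compose[OF normed_D normed_std_module[OF normed_V] normed_std_module[OF normed_V]
        g_map_std_comparison g_map_std_coboundary[OF normed_V]] _ Suc.prems])
    fix e x t assume e: "e \<in> Ob G" and x: "x \<in> car (D (Suc n)) e" and t: "t \<in> bar_tails G (Suc (Suc n)) e"
    then have t': "t \<in> bar_tuples G (Suc n) e"
      by simp
    let ?i = "ident G e" and ?f = "std_comparison (Suc n) e"
    let ?b = "bar_boundary_basis G t"
    have it: "?i # t \<in> bar_tuples G (Suc (Suc n)) e"
      using e t by (simp add: bar_tuples_Cons groupoid_simps)
    have b: "Poly_Mapping.keys ?b \<subseteq> bar_tuples G n e"
      using keys_bar_boundary_basis[OF t'] by simp
    have ib: "Poly_Mapping.keys (bar_cons ?i ?b) \<subseteq> bar_tuples G (Suc n) e"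
      using cons_ident_in_car[OF normed_V e, of ?b "Suc n"] b by simp
    have bd: "bar_boundary_basis G (?i # t) = basis_vec t - bar_cons ?i ?b"
      using bar_boundary_cons_ident[OF e, of "basis_vec t" "Suc n"] t' by simp
    have sx: "s n e x \<in> car (D n) e"
      by (rule s_in[OF e x])
    have "std_comparison (Suc (Suc n)) e (\<delta> (Suc n) e x) (basis_vec (?i # t))
        = ?f (s (Suc n) e (\<delta> (Suc n) e x)) (basis_vec t)"
      by (rule std_comparison_Suc_ident[OF e \<delta>_in[OF e x] t'])
    also have "s (Suc n) e (\<delta> (Suc n) e x) = x - \<delta> n e (s n e x)"
      using contraction_Suc[OF e x] by (simp add: algebra_simps)
    also have "?f \<dots> = ?f x - std_coboundary G n e (std_comparison n e (s n e x))"
      using lin_on_diff[OF g_map_lin[OF g_map_std_comparison e] gmodule_subspace[OF normed_D e] x \<delta>_in[OF e sx]]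
        Suc.IH[OF e sx] by simp
    also have "\<dots> (basis_vec t) = ?f x (basis_vec t) - std_comparison n e (s n e x) ?b"
      using t' by (simp add: std_coboundary_apply[OF normed_V])
    also have "\<dots> = ?f x (basis_vec t) - ?f x (bar_cons ?i ?b)"
      by (simp add: std_comparison_bar_cons[OF e x b])
    also have "\<dots> = ?f x (bar_boundary_basis G (?i # t))"
      using std_diff[OF normed_V std_comparison_in[OF e x] _ ib, of "basis_vec t"] t' by (simp add: bd)
    finally show "std_comparison (Suc (Suc n)) e (\<delta> (Suc n) e x) (basis_vec (?i # t))
        = std_coboundary G (Suc n) e (?f x) (basis_vec (?i # t))"
      using it by (simp add: std_coboundary_apply[OF normed_V])
  qed
qed

end

section \<open>Cohomology\<close>

definition cochain_complex :: "'a::real_vector normed_complex \<Rightarrow> bool" where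
  "cochain_complex K \<longleftrightarrow> (\<forall>n. subspace (sp K n) \<and> lin_on (sp K n) (dif K n) \<and>
     (\<forall>z\<in>sp K n. dif K n z \<in> sp K (Suc n) \<and> dif K (Suc n) (dif K n z) = 0))"

definition cochain_map ::
  "'a::real_vector normed_complex \<Rightarrow> 'b::real_vector normed_complex \<Rightarrow> (nat \<Rightarrow> 'a \<Rightarrow> 'b) \<Rightarrow> bool" where
  "cochain_map K L F \<longleftrightarrow> (\<forall>n. lin_on (sp K n) (F n) \<and>
     (\<forall>z\<in>sp K n. F n z \<in> sp L n \<and> F (Suc n) (dif K n z) = dif L n (F n z)))"

context
  fixes K :: "'a::real_vector normed_complex"
  assumes K: "cochain_complex K"
begin

lemma subspace_sp: "subspace (sp K n)"
  and lin_on_dif: "lin_on (sp K n) (dif K n)"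
  and dif_in: "z \<in> sp K n \<Longrightarrow> dif K n z \<in> sp K (Suc n)"
  and dif_dif: "z \<in> sp K n \<Longrightarrow> dif K (Suc n) (dif K n z) = 0"
  using K by (simp_all add: cochain_complex_def)

lemma subspace_cocycles: "subspace (cocycles K n)"
  unfolding cocycles_def by (rule subspace_kernel[OF subspace_sp lin_on_dif])

lemma cocycles_subset: "z \<in> cocycles K n \<Longrightarrow> z \<in> sp K n"
  by (simp add: cocycles_def)

lemma subspace_coboundaries: "subspace (coboundaries K n)"
proof (cases n)
  case (Suc m)
  have "subspace (dif K m ` sp K m)"
    unfolding subspace_def
  proof (intro conjI ballI allI)
    show "0 \<in> dif K m ` sp K m"
      using lin_on_zero[OF lin_on_dif subspace_sp] subspace_0[OF subspace_sp] by (metis imageI)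
    show "x + y \<in> dif K m ` sp K m" if "x \<in> dif K m ` sp K m" "y \<in> dif K m ` sp K m" for x y
      using that lin_on_add[OF lin_on_dif] subspace_add[OF subspace_sp]
      by (auto simp: image_iff) metis
    show "c *\<^sub>R x \<in> dif K m ` sp K m" if "x \<in> dif K m ` sp K m" for c x
      using that lin_on_scale[OF lin_on_dif] subspace_scale[OF subspace_sp]
      by (auto simp: image_iff) metis
  qed
  then show ?thesis
    by (simp add: Suc coboundaries_def)
qed (simp add: coboundaries_def subspace_single_0)

lemma coboundaries_subset: "b \<in> coboundaries K n \<Longrightarrow> b \<in> cocycles K n"
  using subspace_0[OF subspace_cocycles, of n] dif_in dif_dif
  by (cases n) (auto simp: coboundaries_def cocycles_def)

lemma coh_class_mem: "w \<in> coh_class K n z \<longleftrightarrow> w - z \<in> coboundaries K n"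
  by (auto simp: coh_class_def image_iff algebra_simps) (metis add_diff_cancel_left' diff_add_cancel)

lemma coh_class_eq_iff: "coh_class K n z = coh_class K n w \<longleftrightarrow> z - w \<in> coboundaries K n"
proof
  assume "coh_class K n z = coh_class K n w"
  then show "z - w \<in> coboundaries K n"
    using coh_class_mem[of z n z] coh_class_mem[of z n w] subspace_0[OF subspace_coboundaries] by simp
next
  assume zw: "z - w \<in> coboundaries K n"
  have "x - z \<in> coboundaries K n \<longleftrightarrow> x - w \<in> coboundaries K n" for x
    using subspace_add[OF subspace_coboundaries zw, of "x - z"]
      subspace_diff[OF subspace_coboundaries _ zw, of "x - w"] by auto
  then show "coh_class K n z = coh_class K n w"
    by (auto simp: coh_class_mem)
qed

lemma coh_add_class: "coh_add (coh_class K n z) (coh_class K n w) = coh_class K n (z + w)"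
proof (intro set_eqI iffI)
  fix x assume "x \<in> coh_add (coh_class K n z) (coh_class K n w)"
  then obtain a b where "a - z \<in> coboundaries K n" "b - w \<in> coboundaries K n" "x = a + b"
    by (auto simp: coh_add_def coh_class_mem)
  then show "x \<in> coh_class K n (z + w)"
    using subspace_add[OF subspace_coboundaries, of "a - z" n "b - w"]
    by (simp add: coh_class_mem algebra_simps)
next
  fix x assume "x \<in> coh_class K n (z + w)"
  then have "x = z + (x - z)" "z \<in> coh_class K n z" "x - z \<in> coh_class K n w"
    using subspace_0[OF subspace_coboundaries] by (simp_all add: coh_class_mem algebra_simps)
  then show "x \<in> coh_add (coh_class K n z) (coh_class K n w)"
    unfolding coh_add_def by blast
qed

lemma coh_scale_class: "coh_scale K n c (coh_class K n z) = coh_class K n (c *\<^sub>R z)"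
proof (intro set_eqI iffI)
  fix x assume "x \<in> coh_scale K n c (coh_class K n z)"
  then obtain a b where "a - z \<in> coboundaries K n" "b \<in> coboundaries K n" "x = c *\<^sub>R a + b"
    by (auto simp: coh_scale_def coh_class_mem)
  then show "x \<in> coh_class K n (c *\<^sub>R z)"
    using subspace_add[OF subspace_coboundaries subspace_scale[OF subspace_coboundaries], of "a - z" n b c]
    by (simp add: coh_class_mem algebra_simps)
next
  fix x assume "x \<in> coh_class K n (c *\<^sub>R z)"
  then have "x = c *\<^sub>R z + (x - c *\<^sub>R z)" "z \<in> coh_class K n z" "x - c *\<^sub>R z \<in> coboundaries K n"
    using subspace_0[OF subspace_coboundaries] by (simp_all add: coh_class_mem)
  then show "x \<in> coh_scale K n c (coh_class K n z)"
    unfolding coh_scale_def by blast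
qed

lemma cohomologyE:
  assumes "X \<in> cohomology K n"
  obtains z where "z \<in> cocycles K n" "X = coh_class K n z"
  using assms by (auto simp: cohomology_def)

end

lemma cochain_map_cocycles:
  assumes K: "cochain_complex K" and F: "cochain_map K L F"
    and z: "z \<in> cocycles K n"
  shows "F n z \<in> cocycles L n"
proof -
  have "lin_on (sp K (Suc n)) (F (Suc n))" "F n z \<in> sp L n" "F (Suc n) (dif K n z) = dif L n (F n z)"
    using F cocycles_subset[OF K z] unfolding cochain_map_def by blast+
  moreover have "F (Suc n) 0 = 0"
    using lin_on_zero[OF calculation(1) subspace_sp[OF K]] .
  ultimately show ?thesis
    using z by (simp add: cocycles_def)
qed

lemma cochain_map_coboundaries:
  assumes K: "cochain_complex K" and F: "cochain_map K L F" and b: "b \<in> coboundaries K n"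
  shows "F n b \<in> coboundaries L n"
proof (cases n)
  case 0
  have "F 0 0 = 0"
    using F lin_on_zero[OF _ subspace_sp[OF K]] by (auto simp: cochain_map_def)
  then show ?thesis
    using b by (simp add: 0 coboundaries_def)
next
  case (Suc m)
  then show ?thesis
    using F b by (auto simp: coboundaries_def cochain_map_def)
qed

lemma cochain_map_diff_coboundary:
  assumes K: "cochain_complex K" and F: "cochain_map K L F"
    and z: "z \<in> sp K n" "w \<in> sp K n" and zw: "z - w \<in> coboundaries K n"
  shows "F n z - F n w \<in> coboundaries L n"
  using cochain_map_coboundaries[OF K F zw] lin_on_diff[OF _ subspace_sp[OF K] z, of "F n"] F
  by (simp add: cochain_map_def)

text \<open>\<open>H\<close> serves only to invert \<open>F\<close> on cohomology. The semi-norm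
  estimate needs the bound for \<open>F\<close> alone: every cocycle \<open>x\<close> in a class
  yields the representative \<open>F n x\<close> of the image class, of no larger norm.\<close>

lemma homotopy_equivalence_graded_iso:
  fixes K :: "'a::real_vector normed_complex" and L :: "'b::real_vector normed_complex"
  assumes K: "cochain_complex K" and L: "cochain_complex L"
    and F: "cochain_map K L F" and H: "cochain_map L K H"
    and HF: "\<And>n z. z \<in> cocycles K n \<Longrightarrow> H n (F n z) - z \<in> coboundaries K n"
    and FH: "\<And>n w. w \<in> cocycles L n \<Longrightarrow> F n (H n w) - w \<in> coboundaries L n"
    and nonneg: "\<And>n w. w \<in> sp L n \<Longrightarrow> 0 \<le> cnrm L n w"
    and le: "\<And>n z. z \<in> sp K n \<Longrightarrow> cnrm L n (F n z) \<le> cnrm K n z"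
  obtains \<phi> where "\<And>n z. z \<in> cocycles K n \<Longrightarrow> \<phi> n (coh_class K n z) = coh_class L n (F n z)"
    and "graded_iso K L \<phi>" and "seminorm_nonincreasing K L \<phi>"
proof
  \<comment> \<open>A union over all representatives avoids choosing one; the classes united
    coincide, as \<open>F\<close> maps coboundaries to coboundaries.\<close>
  define \<phi> where "\<phi> n X = (\<Union>z\<in>X. coh_class L n (F n z))" for n X
  have class_cocycles: "x \<in> cocycles K n" if z: "z \<in> cocycles K n" and x: "x \<in> coh_class K n z" for n x z
    using subspace_add[OF subspace_cocycles[OF K] z, of "x - z"] x coboundaries_subset[OF K]
    by (auto simp: coh_class_mem[OF K])
  show \<phi>: "\<phi> n (coh_class K n z) = coh_class L n (F n z)" if z: "z \<in> cocycles K n" for n z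
  proof -
    have "coh_class L n (F n x) = coh_class L n (F n z)" if x: "x \<in> coh_class K n z" for x
      unfolding coh_class_eq_iff[OF L]
      using x cocycles_subset[OF K z] cocycles_subset[OF K class_cocycles[OF z x]]
      by (intro cochain_map_diff_coboundary[OF K F]) (simp_all add: coh_class_mem[OF K])
    moreover have "z \<in> coh_class K n z"
      by (simp add: coh_class_mem[OF K] subspace_0[OF subspace_coboundaries[OF K]])
    ultimately show ?thesis
      unfolding \<phi>_def by blast
  qed
  have bij: "bij_betw (\<phi> n) (cohomology K n) (cohomology L n)" for n
    unfolding bij_betw_def
  proof (intro conjI inj_onI)
    fix X Y assume "X \<in> cohomology K n" "Y \<in> cohomology K n" and eq: "\<phi> n X = \<phi> n Y"
    then obtain z w where z: "z \<in> cocycles K n" "X = coh_class K n z"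
      and w: "w \<in> cocycles K n" "Y = coh_class K n w"
      by (auto elim!: cohomologyE[OF K])
    have "F n z - F n w \<in> coboundaries L n"
      using eq by (simp add: z w \<phi> coh_class_eq_iff[OF L])
    then have "H n (F n z) - H n (F n w) \<in> coboundaries K n"
      using cochain_map_cocycles[OF K F z(1)] cochain_map_cocycles[OF K F w(1)]
      by (intro cochain_map_diff_coboundary[OF L H]) (simp_all add: cocycles_subset[OF L])
    \<comment> \<open>\<open>z - w\<close> is the difference of the values of
      \<open>H \<circ> F\<close>, corrected by the two deviations of \<open>H \<circ> F\<close> from
      the identity.\<close>
    from subspace_add[OF subspace_coboundaries[OF K]
        subspace_diff[OF subspace_coboundaries[OF K] this HF[OF z(1)]] HF[OF w(1)]]
    have "z - w \<in> coboundaries K n"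
      by simp
    then show "X = Y"
      by (simp add: z(2) w(2) coh_class_eq_iff[OF K])
  next
    have "Y \<in> \<phi> n ` cohomology K n" if Y: "Y \<in> cohomology L n" for Y
    proof -
      obtain w where w: "w \<in> cocycles L n" "Y = coh_class L n w"
        using Y by (rule cohomologyE[OF L])
      have Hw: "H n w \<in> cocycles K n"
        by (rule cochain_map_cocycles[OF L H w(1)])
      then have "Y = \<phi> n (coh_class K n (H n w))"
        using FH[OF w(1)] w(2) by (metis \<phi> coh_class_eq_iff[OF L])
      then show ?thesis
        using Hw by (auto simp: cohomology_def)
    qed
    moreover have "\<phi> n X \<in> cohomology L n" if "X \<in> cohomology K n" for X
      using that cochain_map_cocycles[OF K F] by (auto simp: cohomology_def \<phi>)
    ultimately show "\<phi> n ` cohomology K n = cohomology L n"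
      by blast
  qed
  have lin: "lin_on (sp K n) (F n)" for n
    using F by (simp add: cochain_map_def)
  have add: "\<phi> n (coh_add X Y) = coh_add (\<phi> n X) (\<phi> n Y)"
    if X: "X \<in> cohomology K n" and Y: "Y \<in> cohomology K n" for n X Y
  proof -
    obtain z w where z: "z \<in> cocycles K n" "X = coh_class K n z" and w: "w \<in> cocycles K n" "Y = coh_class K n w"
      using X Y by (auto elim!: cohomologyE[OF K])
    then show ?thesis
      using subspace_add[OF subspace_cocycles[OF K] z(1) w(1)] lin_on_add[OF lin, of z n w]
      by (simp add: coh_add_class[OF K] coh_add_class[OF L] \<phi> cocycles_subset[OF K])
  qed
  have scale: "\<phi> n (coh_scale K n c X) = coh_scale L n c (\<phi> n X)" if X: "X \<in> cohomology K n" for n c X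
  proof -
    obtain z where z: "z \<in> cocycles K n" "X = coh_class K n z"
      using X by (rule cohomologyE[OF K])
    then show ?thesis
      using subspace_scale[OF subspace_cocycles[OF K] z(1)] lin_on_scale[OF lin, of z n]
      by (simp add: coh_scale_class[OF K] coh_scale_class[OF L] \<phi> cocycles_subset[OF K])
  qed
  show "graded_iso K L \<phi>"
    unfolding graded_iso_def using bij add scale by blast
  show "seminorm_nonincreasing K L \<phi>"
    unfolding seminorm_nonincreasing_def
  proof (intro allI ballI)
    fix n X assume "X \<in> cohomology K n"
    then obtain z where z: "z \<in> cocycles K n" "X = coh_class K n z"
      by (rule cohomologyE[OF K])
    have Fz: "F n z \<in> cocycles L n"
      by (rule cochain_map_cocycles[OF K F z(1)])
    show "coh_seminorm L n (\<phi> n X) \<le> coh_seminorm K n X"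
      unfolding coh_seminorm_def
    proof (rule cINF_greatest)
      show "X \<noteq> {}"
        using subspace_0[OF subspace_coboundaries[OF K]] by (auto simp: z(2) coh_class_def)
      fix x assume x: "x \<in> X"
      then have xc: "x \<in> cocycles K n"
        using class_cocycles[OF z(1)] z(2) by blast
      \<comment> \<open>Nonnegativity is known on cochains only, so the infimum is bounded below
        once all representatives are seen to be cochains.\<close>
      have "w \<in> sp L n" if "w \<in> \<phi> n X" for w
      proof -
        have "w - F n z \<in> coboundaries L n"
          using that by (simp add: z \<phi> coh_class_mem[OF L])
        then have "F n z + (w - F n z) \<in> cocycles L n"
          by (intro subspace_add[OF subspace_cocycles[OF L] Fz] coboundaries_subset[OF L])
        then show ?thesis
          using cocycles_subset[OF L] by simp
      qed
      then have "bdd_below (cnrm L n ` \<phi> n X)"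
        using nonneg by (intro bdd_belowI2[where m = 0]) blast
      moreover have "F n x \<in> \<phi> n X"
        using x subspace_0[OF subspace_coboundaries[OF L]] by (auto simp: \<phi>_def coh_class_mem[OF L] intro!: bexI[of _ x])
      ultimately have "(INF w\<in>\<phi> n X. cnrm L n w) \<le> cnrm L n (F n x)"
        by (rule cINF_lower)
      also have "\<dots> \<le> cnrm K n x"
        by (rule le[OF cocycles_subset[OF K xc]])
      finally show "(INF w\<in>\<phi> n X. cnrm L n w) \<le> cnrm K n x" .
    qed
  qed
qed

section \<open>Invariants of modules and the complexes they form\<close>

context groupoid_on
begin

lemma invariants_car: "v \<in> invariants G V \<Longrightarrow> e \<in> Ob G \<Longrightarrow> v e \<in> car V e"
  and invariants_bounded: "v \<in> invariants G V \<Longrightarrow> \<exists>B. \<forall>e\<in>Ob G. nrm V e (v e) \<le> B"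
  by (auto simp: invariants_def bdd_above_def)

lemma apply_family_in:
  assumes V: "normed_gmodule G V" and W: "normed_gmodule G W" and f: "g_map G V W f"
    and v: "v \<in> invariants G V"
  shows "apply_family G f v \<in> invariants G W"
proof -
  obtain B where B: "\<And>e. e \<in> Ob G \<Longrightarrow> nrm V e (v e) \<le> B"
    using invariants_bounded[OF v] by blast
  have vin: "\<And>e. e \<in> Ob G \<Longrightarrow> v e \<in> car V e"
    using v by (simp add: invariants_def)
  have "nrm W e (f e (v e)) \<le> mor_norm G V W f * B" if e: "e \<in> Ob G" for e
    using r_morphism_bound[OF V W g_map_r_morphism[OF f] e vin[OF e]]
      mult_left_mono[OF B[OF e] mor_norm_nonneg[OF g_map_r_morphism[OF f]]] by linarith
  then have "bdd_above ((\<lambda>e. nrm W e (apply_family G f v e)) ` Ob G)"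
    by (intro bdd_aboveI2[where M = "mor_norm G V W f * B"]) (simp add: apply_family_def)
  moreover have "act W g (f (src G g) (v (src G g))) = f (tgt G g) (v (tgt G g))" if "g \<in> Mor G" for g
    using g_map_equivariant[OF f that vin[OF src_in_Ob[OF that]]] v that by (simp add: invariants_def)
  ultimately show ?thesis
    using g_map_in[OF f] vin by (simp add: invariants_def apply_family_def src_in_Ob tgt_in_Ob)
qed

lemma subspace_invariants:
  assumes V: "normed_gmodule G V"
  shows "subspace (invariants G V)"
  unfolding subspace_def
proof (intro conjI ballI allI)
  note ns = gmodule_normed_space[OF V] and sub = gmodule_subspace[OF V]
  show "0 \<in> invariants G V"
    using subspace_0[OF sub] normed_space_0(2)[OF ns] lin_on_zero[OF act_lin_on[OF V] sub]
    by (auto simp: invariants_def src_in_Ob bdd_above_def)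
next
  note ns = gmodule_normed_space[OF V] and sub = gmodule_subspace[OF V]
  fix v w assume v: "v \<in> invariants G V" and w: "w \<in> invariants G V"
  obtain A B where AB: "\<And>e. e \<in> Ob G \<Longrightarrow> nrm V e (v e) \<le> A" "\<And>e. e \<in> Ob G \<Longrightarrow> nrm V e (w e) \<le> B"
    using invariants_bounded[OF v] invariants_bounded[OF w] by blast
  have car: "\<And>e. e \<in> Ob G \<Longrightarrow> v e \<in> car V e" "\<And>e. e \<in> Ob G \<Longrightarrow> w e \<in> car V e"
    using v w by (simp_all add: invariants_def)
  have "nrm V e (v e + w e) \<le> A + B" if "e \<in> Ob G" for e
    using normed_space_triangle[OF ns[OF that] car[OF that]] AB[OF that] by simp
  then have "bdd_above ((\<lambda>e. nrm V e (v e + w e)) ` Ob G)"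
    by (intro bdd_aboveI2) auto
  then show "v + w \<in> invariants G V"
    using v w car subspace_add[OF sub] lin_on_add[OF act_lin_on[OF V]]
    by (simp add: invariants_def src_in_Ob)
next
  note ns = gmodule_normed_space[OF V] and sub = gmodule_subspace[OF V]
  fix c v assume v: "v \<in> invariants G V"
  obtain A where A: "\<And>e. e \<in> Ob G \<Longrightarrow> nrm V e (v e) \<le> A"
    using invariants_bounded[OF v] by blast
  have car: "\<And>e. e \<in> Ob G \<Longrightarrow> v e \<in> car V e"
    using v by (simp add: invariants_def)
  have "nrm V e (c *\<^sub>R v e) \<le> \<bar>c\<bar> * A" if "e \<in> Ob G" for e
    using normed_space_scale[OF ns[OF that] car[OF that]] mult_left_mono[OF A[OF that], of "\<bar>c\<bar>"] by simp
  then have "bdd_above ((\<lambda>e. nrm V e (c *\<^sub>R v e)) ` Ob G)"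
    by (intro bdd_aboveI2) auto
  then show "c *\<^sub>R v \<in> invariants G V"
    using v car subspace_scale[OF sub] lin_on_scale[OF act_lin_on[OF V]]
    by (simp add: invariants_def src_in_Ob scaleR_fun_def)
qed

lemma lin_on_apply_family:
  assumes f: "g_map G V W f"
  shows "lin_on (invariants G V) (apply_family G f)"
  using lin_on_add[OF g_map_lin[OF f]] lin_on_scale[OF g_map_lin[OF f]] invariants_car[of _ V]
  by (auto simp: lin_on_def apply_family_def fun_eq_iff scaleR_fun_def)

lemma inv_norm_nonneg: "v \<in> invariants G V \<Longrightarrow> 0 \<le> inv_norm G V v"
  unfolding inv_norm_def sup_over_Ob_def invariants_def by (intro cSup_upper) auto

lemma inv_norm_apply_family_le:
  assumes "v \<in> invariants G V" "\<And>e x. e \<in> Ob G \<Longrightarrow> x \<in> car V e \<Longrightarrow> nrm W e (f e x) \<le> nrm V e x"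
  shows "inv_norm G W (apply_family G f v) \<le> inv_norm G V v"
  unfolding inv_norm_def[of G W] sup_over_Ob_def
proof (rule cSup_least)
  fix r assume "r \<in> insert 0 ((\<lambda>e. nrm W e (apply_family G f v e)) ` Ob G)"
  then consider "r = 0" | e where "e \<in> Ob G" "r = nrm W e (f e (v e))"
    by (auto simp: apply_family_def)
  then show "r \<le> inv_norm G V v"
  proof cases
    case 1
    then show ?thesis
      using inv_norm_nonneg[OF assms(1)] by simp
  next
    case 2
    then have "r \<le> nrm V e (v e)"
      using assms(2)[OF 2(1) invariants_car[OF assms(1) 2(1)]] by simp
    also have "\<dots> \<le> inv_norm G V v"
      unfolding inv_norm_def sup_over_Ob_def
      using assms(1) 2(1) by (intro cSup_upper) (auto simp: invariants_def)
    finally show ?thesis .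
  qed
qed simp

lemma cochain_complex_invariant:
  assumes "banach_cochain_complex G D \<delta>"
  shows "cochain_complex (invariant_complex G D \<delta>)"
proof -
  have D: "normed_gmodule G (D n)" and d: "g_map G (D n) (D (Suc n)) (\<delta> n)" for n
    using assms by (auto simp: banach_cochain_complex_def banach_imp_normed)
  have "apply_family G (\<delta> (Suc n)) (apply_family G (\<delta> n) z) = 0" if "z \<in> invariants G (D n)" for n z
    using assms invariants_car[OF that]
    by (auto simp: apply_family_def fun_eq_iff banach_cochain_complex_def)
  then show ?thesis
    using subspace_invariants[OF D] lin_on_apply_family[OF d] apply_family_in[OF D D d]
    by (simp add: cochain_complex_def invariant_complex_def)
qed

lemma cochain_map_invariant:
  assumes D: "\<And>n. normed_gmodule G (D n)" and E: "\<And>n. normed_gmodule G (E n)"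
    and f: "\<And>n. g_map G (D n) (E n) (f n)"
    and comm: "\<And>n e x. e \<in> Ob G \<Longrightarrow> x \<in> car (D n) e \<Longrightarrow> f (Suc n) e (\<delta> n e x) = d n e (f n e x)"
  shows "cochain_map (invariant_complex G D \<delta>) (invariant_complex G E d) (\<lambda>n. apply_family G (f n))"
proof -
  have "apply_family G (f (Suc n)) (apply_family G (\<delta> n) z) = apply_family G (d n) (apply_family G (f n) z)"
    if "z \<in> invariants G (D n)" for n z
    using comm invariants_car[OF that] by (auto simp: apply_family_def fun_eq_iff)
  then show ?thesis
    using lin_on_apply_family[OF f] apply_family_in[OF D E f]
    by (simp add: cochain_map_def invariant_complex_def)
qed

end

text \<open>\<open>f - id\<close> vanishes on the augmentation, hence is null-homotopic through
  equivariant maps \<open>T\<close>. On an invariant cocycle the term \<open>T (\<delta> z)\<close>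
  drops out, so the difference is \<open>\<delta> (T z)\<close> with \<open>T z\<close> again
  invariant.\<close>

lemma (in contracted_resolution) endomorphism_homotopic_id:
  assumes ext: "\<And>n m. extends_over (D n) (D (Suc n)) (\<delta> n) (D m)"
    and f: "\<And>n. g_map G (D n) (D n) (f n)"
    and f_\<delta>: "\<And>n e x. e \<in> Ob G \<Longrightarrow> x \<in> car (D n) e \<Longrightarrow> f (Suc n) e (\<delta> n e x) = \<delta> n e (f n e x)"
    and f_\<epsilon>: "\<And>e v. e \<in> Ob G \<Longrightarrow> v \<in> car V e \<Longrightarrow> f 0 e (\<epsilon> e v) = \<epsilon> e v"
    and z: "z \<in> cocycles (invariant_complex G D \<delta>) n"
  shows "apply_family G (f n) z - z \<in> coboundaries (invariant_complex G D \<delta>) n"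
proof -
  let ?\<phi> = "\<lambda>n e x. f n e x - x"
  have \<phi>: "g_map G (D n) (D n) (?\<phi> n)" for n
    by (rule g_map_difference[OF normed_D normed_D f g_map_id[OF normed_D]])
  have \<phi>_\<delta>: "?\<phi> (Suc n) e (\<delta> n e x) = \<delta> n e (?\<phi> n e x)" if "e \<in> Ob G" "x \<in> car (D n) e" for n e x
    using f_\<delta>[OF that] lin_on_diff[OF g_map_lin[OF g_map_\<delta> that(1)] gmodule_subspace[OF normed_D that(1)]
        g_map_in[OF f that] that(2)] by simp
  obtain T where T: "\<And>n. g_map G (D (Suc n)) (D n) (T n)"
    and T0: "\<And>e x. e \<in> Ob G \<Longrightarrow> x \<in> car (D 0) e \<Longrightarrow> T 0 e (\<delta> 0 e x) = ?\<phi> 0 e x"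
    and TS: "\<And>n e x. e \<in> Ob G \<Longrightarrow> x \<in> car (D (Suc n)) e \<Longrightarrow>
      T (Suc n) e (\<delta> (Suc n) e x) = ?\<phi> (Suc n) e x - \<delta> n e (T n e x)"
    using null_homotopy[OF normed_D g_map_\<delta> \<delta>_\<delta> ext \<phi> \<phi>_\<delta>] f_\<epsilon> by auto
  have z': "z \<in> invariants G (D n)" and "apply_family G (\<delta> n) z = 0"
    using z by (simp_all add: cocycles_def invariant_complex_def)
  then have dz: "\<delta> n e (z e) = 0" if "e \<in> Ob G" for e
    using that by (auto simp: apply_family_def fun_eq_iff split: if_splits)
  have Td: "T n e (\<delta> n e (z e)) = 0" if "e \<in> Ob G" for e
    using dz[OF that] lin_on_zero[OF g_map_lin[OF T that] gmodule_subspace[OF normed_D that]] by simp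
  note zc = invariants_car[OF z']
  have out: "z e = 0" if "e \<notin> Ob G" for e
    using z' that by (simp add: invariants_def)
  show ?thesis
  proof (cases n)
    case 0
    \<comment> \<open>In degree 0 the homotopy formula has only the term
      \<open>T 0 \<circ> \<delta> 0\<close>, which kills \<open>z\<close>; this matches the fact
      that 0 is the only coboundary.\<close>
    have "apply_family G (f n) z - z = 0"
      using T0 Td zc out by (auto simp: 0 fun_eq_iff apply_family_def)
    then show ?thesis
      by (simp add: 0 coboundaries_def)
  next
    case (Suc m)
    have "?\<phi> (Suc m) e (z e) = \<delta> m e (T m e (z e))" if "e \<in> Ob G" for e
      using TS[OF that, of "z e" m] Td[OF that] zc[OF that] by (simp add: Suc)
    then have "apply_family G (f n) z - z = apply_family G (\<delta> m) (apply_family G (T m) z)"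
      using out by (auto simp: Suc fun_eq_iff apply_family_def)
    moreover have "apply_family G (T m) z \<in> invariants G (D m)"
      using z' by (intro apply_family_in[OF normed_D normed_D T]) (simp add: Suc)
    ultimately show ?thesis
      by (simp add: Suc coboundaries_def invariant_complex_def)
  qed
qed

theorem theorem2:
  fixes G :: "('o, 'g) groupoid_data"
    and V :: "('o, 'g, 'v::real_vector) gmodule"
    and D :: "nat \<Rightarrow> ('o, 'g, 'd::real_vector) gmodule"
    and \<delta> :: "nat \<Rightarrow> 'o \<Rightarrow> 'd \<Rightarrow> 'd"
    and \<epsilon> :: "'o \<Rightarrow> 'v \<Rightarrow> 'd"
  assumes "groupoid G"
    and "banach_gmodule G V"
    and "strong_resolution G V D \<delta> \<epsilon>"
    and "\<And>n. rel_injective_module TYPE(('g, 'v, 'd) test_space) G (D n)"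
  shows "\<exists>\<phi>. canonical G V D \<delta> \<epsilon> \<phi> \<and>
           graded_iso (invariant_complex G D \<delta>) (bounded_cochains G V) \<phi> \<and>
           seminorm_nonincreasing (invariant_complex G D \<delta>) (bounded_cochains G V) \<phi>"
proof -
  interpret groupoid_on G
    by unfold_locales (rule assms(1))
  obtain s0 s where "contracted_resolution G V D \<delta> \<epsilon> s0 s"
    using strong_resolutionE[OF assms(1-3)] .
  then interpret D: contracted_resolution G V D \<delta> \<epsilon> s0 s .
  let ?B = "std_module G V" and ?d = "std_coboundary G" and ?\<eta> = "std_augmentation G"
  have B: "strong_resolution G V ?B ?d ?\<eta>"
    by (rule strong_resolution_std[OF D.normed_V assms(2)])
  obtain t0 t where "contracted_resolution G V ?B ?d ?\<eta> t0 t"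
    using strong_resolutionE[OF assms(1,2) B] .
  then interpret B: contracted_resolution G V ?B ?d ?\<eta> t0 t .
  let ?K = "invariant_complex G D \<delta>" and ?L = "bounded_cochains G V"
  have K: "cochain_complex ?K" and L: "cochain_complex ?L"
    using assms(3) B unfolding bounded_cochains_def strong_resolution_def
    by (auto intro: cochain_complex_invariant)

  \<comment> \<open>The two factors of \<open>test_space\<close> hold the modules that become test
    modules: those of \<open>D\<close> through \<open>inl\<close>, the bar cochains through
    \<open>inr\<close>. The projections serve as left inverses.\<close>
  have inl: "linear (\<lambda>x. (x, 0) :: ('g, 'v, 'd) test_space)"
    and inr: "linear (\<lambda>x. (0, x) :: ('g, 'v, 'd) test_space)"
    by (auto intro!: linearI)
  have DD: "extends_over (D n) (D (Suc n)) (\<delta> n) (D m)" for n m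
    by (rule D.coboundary_extends_over_rel_injective[OF assms(4) D.normed_D inl, where p = fst]) simp
  have BD: "extends_over (?B n) (?B (Suc n)) (?d n) (D m)" for n m
    by (rule B.coboundary_extends_over_rel_injective[OF assms(4) D.normed_D inr, where p = snd]) simp
  have VD: "extends_over V (?B 0) ?\<eta> (D m)" for m
    by (rule B.augmentation_extends_over_rel_injective[OF assms(4) D.normed_D inr, where p = snd]) simp
  \<comment> \<open>Here the target is a bar cochain module, so the extension comes from prescribed
    values and not from the injectivity of \<open>D\<close>.\<close>
  have BB: "extends_over (?B n) (?B (Suc n)) (?d n) (?B m)" for n m
    by (rule B.coboundary_extends_over_std[OF D.normed_V])

  let ?f = D.std_comparison
  note f = D.g_map_std_comparison and f_\<delta> = D.std_comparison_\<delta> and f_\<epsilon> = D.std_comparison_\<epsilon>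
  \<comment> \<open>An arbitrary bounded comparison map is enough in this direction; its norm never
    enters the estimate.\<close>
  obtain h where h: "\<And>n. g_map G (?B n) (D n) (h n)"
    and h_d: "\<And>n e x. e \<in> Ob G \<Longrightarrow> x \<in> car (?B n) e \<Longrightarrow> h (Suc n) e (?d n e x) = \<delta> n e (h n e x)"
    and h_\<eta>: "\<And>e v. e \<in> Ob G \<Longrightarrow> v \<in> car V e \<Longrightarrow> h 0 e (?\<eta> e v) = \<epsilon> e v"
    by (rule B.comparison_map[OF D.normed_D D.g_map_\<delta> D.\<delta>_\<delta> BD VD D.g_map_\<epsilon> D.\<delta>_\<epsilon>])
      (assumption | rule that)+

  let ?F = "\<lambda>n. apply_family G (?f n)" and ?H = "\<lambda>n. apply_family G (h n)"
  have F: "cochain_map ?K ?L ?F"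
    unfolding bounded_cochains_def
    by (rule cochain_map_invariant[where f = ?f and \<delta> = \<delta> and d = ?d, OF D.normed_D B.normed_D f f_\<delta>])
  have H: "cochain_map ?L ?K ?H"
    unfolding bounded_cochains_def
    by (rule cochain_map_invariant[where f = h and \<delta> = ?d and d = \<delta>, OF B.normed_D D.normed_D h h_d])
  have HF: "?H n (?F n z) - z \<in> coboundaries ?K n" if "z \<in> cocycles ?K n" for n z
  proof -
    \<comment> \<open>The composite is taken at the level of \<open>G\<close>-maps first, where it
      extends the identity of \<open>V\<close> and the homotopy exists; passing to invariants comes
      afterwards.\<close>
    have "apply_family G (\<lambda>e x. h n e (?f n e x)) z - z \<in> coboundaries ?K n"
      using that by (rule D.endomorphism_homotopic_id[where f = "\<lambda>n e x. h n e (?f n e x)", OF DD g_map_compose[OF D.normed_D B.normed_D D.normed_D f h], rotated 2])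
        (simp_all add: f_\<delta> h_d f_\<epsilon> h_\<eta> D.std_comparison_in)
    then show ?thesis
      by (simp add: apply_family_def cong: if_cong)
  qed
  have FH: "?F n (?H n w) - w \<in> coboundaries ?L n" if "w \<in> cocycles ?L n" for n w
  proof -
    have "apply_family G (\<lambda>e x. ?f n e (h n e x)) w - w \<in> coboundaries ?L n"
      using that unfolding bounded_cochains_def
      by (rule B.endomorphism_homotopic_id[where f = "\<lambda>n e x. ?f n e (h n e x)", OF BB g_map_compose[OF B.normed_D D.normed_D B.normed_D h f], rotated 2])
        (simp_all add: f_\<delta> h_d f_\<epsilon> h_\<eta> g_map_in[OF h])
    then show ?thesis
      by (simp add: apply_family_def cong: if_cong)
  qed
  have nonneg: "0 \<le> cnrm ?L n w" if "w \<in> sp ?L n" for n w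
    using that inv_norm_nonneg by (simp add: bounded_cochains_def invariant_complex_def)
  have le: "cnrm ?L n (?F n z) \<le> cnrm ?K n z" if "z \<in> sp ?K n" for n z
    using that inv_norm_apply_family_le[OF _ D.std_comparison_nrm_le]
    by (simp add: bounded_cochains_def invariant_complex_def)
  obtain \<phi> where \<phi>: "\<And>n z. z \<in> cocycles ?K n \<Longrightarrow> \<phi> n (coh_class ?K n z) = coh_class ?L n (?F n z)"
    and iso: "graded_iso ?K ?L \<phi>" "seminorm_nonincreasing ?K ?L \<phi>"
    by (rule homotopy_equivalence_graded_iso[where F = ?F and H = ?H, OF K L F H HF FH nonneg le])
      (assumption | rule that)+
  have "cochain_map_extending_id G V D \<delta> \<epsilon> ?f"
    unfolding cochain_map_extending_id_def using f f_\<delta> f_\<epsilon> by blast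
  then have "canonical G V D \<delta> \<epsilon> \<phi>"
    unfolding canonical_def using \<phi> by blast
  then show ?thesis
    using iso by blast
qed

end
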